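(* Let $K$ be a field, $R=K[[t_1,\ldots,t_m]]$, let $>$ be a $\underline{t}$-local monomial ordering on $\mathrm{Mon}^s(\underline{t},\underline{x})$, let $g_1,\ldots,g_k\in R[\underline{x}]_>^s$ be non-zero, and suppose that for each $i<j$ the element $\mathrm{spoly}(g_i,g_j)$ has a weak standard representation with respect to $G=(g_1,\ldots,g_k)$. For each $i<j$ fix a division with remainder $$\mathrm{spoly}(g_i,g_j)=\sum_{\nu=1}^kq_{i,j,\nu}\cdot g_\nu+r_{ij}$$ with respect to $G$, and set $$s_{ij}=\frac{m_{ji}}{\mathrm{lc}_>(g_i)}\varepsilon_i-\frac{m_{ij}}{\mathrm{lc}_>(g_j)}\varepsilon_j-\sum_{\nu=1}^kq_{i,j,\nu}\varepsilon_\nu\in R[\underline{x}]_>^k,$$ where $m_{ji}=\frac{\mathrm{lcm}(\mathrm{lm}_>(g_i),\mathrm{lm}_>(g_j))}{\mathrm{lm}_>(g_i)}$, $m_{ij}=\frac{\mathrm{lcm}(\mathrm{lm}_>(g_i),\mathrm{lm}_>(g_j))}{\mathrm{lm}_>(g_j)}$ and $\varepsilon_1,\ldots,\varepsilon_k$ is the canonical basis of $R[\underline{x}]_>^k$. Then $G$ is a standard basis (of $\langle G\rangle\leq R[\underline{x}]_>^s$) with respect to $>$, and $\{s_{ij}\mid i<j\}$ is a standard basis of $\mathrm{syz}(g_1,\ldots,g_k)$ with respect to the Schreyer ordering $>_S$ on $\mathrm{Mon}^k(\underline{t},\underline{x})$ defined by $>$ and $(g_1,\ldots,g_k)$.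
   Context: $R[\underline{x}]=K[[t_1,\ldots,t_m]][x_1,\ldots,x_n]$ is the polynomial ring in $\underline{x}=(x_1,\ldots,x_n)$ over the formal power series ring $R$ in $\underline{t}=(t_1,\ldots,t_m)$. $\mathrm{Mon}(\underline{t},\underline{x})=\{\underline{t}^\alpha\underline{x}^\beta\mid\alpha\in\mathbb{N}^m,\beta\in\mathbb{N}^n\}$ and $\mathrm{Mon}^s(\underline{t},\underline{x})=\{\underline{t}^\alpha\underline{x}^\beta e_i\mid \alpha\in\mathbb{N}^m,\beta\in\mathbb{N}^n,1\le i\le s\}$, with $e_i$ the $i$-th unit vector. A module monomial $p$ divides $p'$ if $p'=\underline{t}^\alpha\underline{x}^\beta p$ for some $\alpha,\beta$; $\mathrm{lcm}(p,p')$ is the usual least common multiple if $p,p'$ involve the same $e_i$, and $0$ otherwise. A monomial ordering on $\mathrm{Mon}(\underline{t},\underline{x})$ is a total ordering compatible with multiplication. A monomial ordering on $\mathrm{Mon}^s(\underline{t},\underline{x})$ is a total ordering $>$ such that $p>p'$ implies $\underline{t}^\alpha\underline{x}^\beta p>\underline{t}^\alpha\underline{x}^\beta p'$ for all $\alpha,\beta$, and for which there is a monomial ordering on $\mathrm{Mon}(\underline{t},\underline{x})$ (the induced one, also denoted $>$) such that $\underline{t}^\alpha\underline{x}^\beta>\underline{t}^{\alpha'}\underline{x}^{\beta'}\Leftrightarrow\underline{t}^\alpha\underline{x}^\beta e_i>\underline{t}^{\alpha'}\underline{x}^{\beta'}e_i$ for each $i$. It is $\underline{t}$-local if $t_i<1$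 for all $i=1,\ldots,m$ in the induced ordering. For $0\ne f\in R[\underline{x}]^s$, $\mathrm{lm}_>(f)$ is the largest monomial occurring in $f$ with non-zero coefficient, $\mathrm{lc}_>(f)\in K$ its coefficient, and $\mathrm{lt}_>(f)=\mathrm{lc}_>(f)\mathrm{lm}_>(f)$; $\mathrm{lm}_>(0)=\mathrm{lt}_>(0)=0$, and $0$ is regarded as smaller than every monomial and as dividing no monomial. $S_>=\{u\in R[\underline{x}]\mid\mathrm{lt}_>(u)=1\}$ and $R[\underline{x}]_>=S_>^{-1}R[\underline{x}]$. For $f/u\in R[\underline{x}]_>^s$ with $u\in S_>$ the leading monomial, coefficient and term are those of $f$ (well defined). For $G\subseteq R[\underline{x}]_>^s$ let $L_>(G)=\langle\mathrm{lm}_>(g)\mid g\in G\rangle\leq K[\underline{t},\underline{x}]^s$. A standard basis of a submodule $J\leq R[\underline{x}]_>^s$ is a finite $G\subset J$ with $L_>(G)=L_>(J)$. A division with remainder of $f\in R[\underline{x}]_>^s$ with respect to $(g_1,\ldots,g_k)$ is a representation $f=q_1g_1+\ldots+q_kg_k+r$ with $q_i\in R[\underline{x}]_>$, $r\in R[\underline{x}]_>^s$ such that $\mathrm{lm}_>(f)\ge\mathrm{lm}_>(q_ig_i)$ for all $i$, and, unless $r=0$, $\mathrm{lm}_>(g_i)\nmid\mathrm{lm}_>(r)$ for all $i$. It is a standard representation of $f$ if $r=0$; a weak standard representation of $f$ is a standard representation of $u\cdot f$ for some $u\in S_>$. (Since elements of $S_>$ are units in $R[\underline{x}]_>$ with leading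 term $1$, over $R[\underline{x}]_>$ having a weak standard representation is the same as having a standard representation.) $\mathrm{spoly}(f,g)=\frac{\mathrm{lcm}(\mathrm{lm}_>(f),\mathrm{lm}_>(g))}{\mathrm{lt}_>(f)}f-\frac{\mathrm{lcm}(\mathrm{lm}_>(f),\mathrm{lm}_>(g))}{\mathrm{lt}_>(g)}g$ for non-zero $f,g\in R[\underline{x}]_>^s$. Schreyer ordering: on $\mathrm{Mon}^k(\underline{t},\underline{x})$ (with unit vectors $\varepsilon_i$), $\underline{t}^\alpha\underline{x}^\beta\varepsilon_i>_S\underline{t}^{\alpha'}\underline{x}^{\beta'}\varepsilon_j$ iff $\underline{t}^\alpha\underline{x}^\beta\mathrm{lm}_>(g_i)>\underline{t}^{\alpha'}\underline{x}^{\beta'}\mathrm{lm}_>(g_j)$, or these are equal and $i<j$. It is a $\underline{t}$-local monomial ordering. $\mathrm{syz}(g_1,\ldots,g_k)=\{(q_1,\ldots,q_k)\in R[\underline{x}]_>^k\mid q_1g_1+\ldots+q_kg_k=0\}$. *)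

theory Defs
  imports
    "HOL-Library.Poly_Mapping"
    "HOL-Library.Product_Plus"
    "HOL-Library.Multiset_Order"
    "HOL-Computational_Algebra.Fraction_Field"
begin

section \<open>Formal power series in several variables\<close>

text \<open>
  An exponent vector is a finitely supported function \<^typ>\<open>nat \<Rightarrow>\<^sub>0 nat\<close>. The type \<open>'k mps\<close> below
  consists of the power series in countably many variables; for every \<open>m\<close> it contains
  \<open>K[[t\<^sub>0,\<dots>,t\<^sub>m\<^sub>-\<^sub>1]]\<close> as the subring of the series in which only exponent vectors supported in
  \<open>{..<m}\<close> occur. In this way \<open>m\<close> is an ordinary natural number, and \<open>m = 0\<close> is allowed.
\<close>

type_synonym expo = "nat \<Rightarrow>\<^sub>0 nat"

definition splits :: "expo \<Rightarrow> (expo \<times> expo) set" where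
  "splits c = {(a, b). a + b = c}"

lemma mem_splits: "(a, b) \<in> splits c \<longleftrightarrow> a + b = c"
  by (simp add: splits_def)

lemma finite_expo_below:
  "finite {a :: expo. \<forall>i. Poly_Mapping.lookup a i \<le> Poly_Mapping.lookup c i}" (is "finite ?A")
proof -
  let ?K = "Poly_Mapping.keys c" and ?M = "\<Sum>i\<in>Poly_Mapping.keys c. Poly_Mapping.lookup c i"
  let ?F = "{f :: nat \<Rightarrow> nat. \<forall>i. (i \<in> ?K \<longrightarrow> f i \<in> {..?M}) \<and> (i \<notin> ?K \<longrightarrow> f i = 0)}"
  have "finite ?F"
    by (rule finite_set_of_finite_funs) auto
  moreover have "Poly_Mapping.lookup ` ?A \<subseteq> ?F"
  proof clarify
    fix a :: expo and i
    assume a: "\<forall>i. Poly_Mapping.lookup a i \<le> Poly_Mapping.lookup c i"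
    have "Poly_Mapping.lookup c i \<le> ?M" if "i \<in> ?K"
      using that by (intro member_le_sum) auto
    moreover have "Poly_Mapping.lookup a i = 0" if "i \<notin> ?K"
      using a[rule_format, of i] that by (simp add: in_keys_iff)
    ultimately show "(i \<in> ?K \<longrightarrow> Poly_Mapping.lookup a i \<in> {..?M}) \<and>
        (i \<notin> ?K \<longrightarrow> Poly_Mapping.lookup a i = 0)"
      using a[rule_format, of i] by auto
  qed
  ultimately have "finite (Poly_Mapping.lookup ` ?A)"
    by (rule rev_finite_subset)
  then show ?thesis
    by (rule finite_imageD) (rule inj_onI, simp only: lookup_inject)
qed

lemma finite_splits [simp]: "finite (splits c)"
proof (rule finite_subset)
  let ?A = "{a :: expo. \<forall>i. Poly_Mapping.lookup a i \<le> Poly_Mapping.lookup c i}"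
  show "splits c \<subseteq> ?A \<times> ?A"
    by (auto simp: splits_def lookup_add)
qed (intro finite_cartesian_product finite_expo_below)

typedef 'k mps = "UNIV :: (expo \<Rightarrow> 'k) set"
  morphisms mps_nth Abs_mps ..

setup_lifting type_definition_mps

lemma mps_eqI: "(\<And>a. mps_nth f a = mps_nth g a) \<Longrightarrow> f = g"
  by (simp add: mps_nth_inject[symmetric] fun_eq_iff)

instantiation mps :: (comm_ring_1) comm_ring_1
begin

lift_definition zero_mps :: "'a mps" is "\<lambda>_. 0" .
lift_definition one_mps :: "'a mps" is "\<lambda>a. if a = 0 then 1 else 0" .
lift_definition plus_mps :: "'a mps \<Rightarrow> 'a mps \<Rightarrow> 'a mps" is "\<lambda>f g a. f a + g a" .
lift_definition minus_mps :: "'a mps \<Rightarrow> 'a mps \<Rightarrow> 'a mps" is "\<lambda>f g a. f a - g a" .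
lift_definition uminus_mps :: "'a mps \<Rightarrow> 'a mps" is "\<lambda>f a. - f a" .
lift_definition times_mps :: "'a mps \<Rightarrow> 'a mps \<Rightarrow> 'a mps"
  is "\<lambda>f g c. \<Sum>(a, b)\<in>splits c. f a * g b" .

instance
proof
  fix f g h :: "'a mps"
  show "f * g * h = f * (g * h)"
  proof (rule mps_eqI)
    fix c
    have "mps_nth (f * g * h) c =
        (\<Sum>x\<in>splits c. \<Sum>y\<in>splits (fst x). mps_nth f (fst y) * mps_nth g (snd y) * mps_nth h (snd x))"
      by (simp add: times_mps.rep_eq case_prod_unfold sum_distrib_right)
    also have "\<dots> = (\<Sum>(x, y)\<in>(SIGMA x:splits c. splits (fst x)).
        mps_nth f (fst y) * mps_nth g (snd y) * mps_nth h (snd x))"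
      by (subst sum.Sigma) auto
    also have "\<dots> = (\<Sum>(x, y)\<in>(SIGMA x:splits c. splits (snd x)).
        mps_nth f (fst x) * (mps_nth g (fst y) * mps_nth h (snd y)))"
      by (rule sum.reindex_bij_witness
            [where i = "\<lambda>(x, y). ((fst x + fst y, snd y), (fst x, fst y))"
               and j = "\<lambda>(x, y). ((fst y, snd y + snd x), (snd y, snd x))"])
         (auto simp: splits_def algebra_simps)
    also have "\<dots> =
        (\<Sum>x\<in>splits c. \<Sum>y\<in>splits (snd x). mps_nth f (fst x) * (mps_nth g (fst y) * mps_nth h (snd y)))"
      by (subst sum.Sigma) auto
    also have "\<dots> = mps_nth (f * (g * h)) c"
      by (simp add: times_mps.rep_eq case_prod_unfold sum_distrib_left)
    finally show "mps_nth (f * g * h) c = mps_nth (f * (g * h)) c" .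
  qed
  show "f * g = g * f"
  proof (rule mps_eqI)
    fix c
    show "mps_nth (f * g) c = mps_nth (g * f) c"
      unfolding times_mps.rep_eq
      by (rule sum.reindex_bij_witness[where i = prod.swap and j = prod.swap])
         (auto simp: splits_def add.commute mult.commute)
  qed
  show "1 * f = f"
  proof (rule mps_eqI)
    fix c
    have "mps_nth (1 * f) c = (\<Sum>x\<in>splits c. if x = (0, c) then mps_nth f c else 0)"
      unfolding times_mps.rep_eq one_mps.rep_eq
      by (rule sum.cong) (auto simp: splits_def split: if_splits)
    also have "\<dots> = mps_nth f c"
      by (simp add: mem_splits)
    finally show "mps_nth (1 * f) c = mps_nth f c" .
  qed
  show "(f + g) * h = f * h + g * h"
    by (rule mps_eqI)
      (simp add: times_mps.rep_eq plus_mps.rep_eq case_prod_unfold distrib_right sum.distrib)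
  show "(0 :: 'a mps) \<noteq> 1"
  proof
    assume "(0 :: 'a mps) = 1"
    then have "mps_nth (0 :: 'a mps) 0 = mps_nth 1 0"
      by simp
    then show False
      by (simp add: zero_mps.rep_eq one_mps.rep_eq)
  qed
qed (transfer; simp add: fun_eq_iff algebra_simps)+

end

text \<open>
  The multiset order well-orders the exponent vectors compatibly with addition, so that the product
  of the two smallest terms cannot cancel.
\<close>

definition expo_mset :: "expo \<Rightarrow> nat multiset" where
  "expo_mset a = Abs_multiset (Poly_Mapping.lookup a)"

lemma count_expo_mset [simp]: "count (expo_mset a) i = Poly_Mapping.lookup a i"
proof -
  have "{i. 0 < Poly_Mapping.lookup a i} = Poly_Mapping.keys a"
    by (auto simp: in_keys_iff)
  then have "finite {i. 0 < Poly_Mapping.lookup a i}"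
    by simp
  then show ?thesis
    by (simp add: expo_mset_def count_Abs_multiset)
qed

lemma expo_mset_add: "expo_mset (a + b) = expo_mset a + expo_mset b"
  by (simp add: multiset_eq_iff lookup_add)

lemma expo_mset_inject: "expo_mset a = expo_mset b \<longleftrightarrow> a = b"
  by (metis count_expo_mset poly_mapping_eqI)

instance mps :: (idom) idom
proof
  fix f g :: "'a mps"
  assume "f \<noteq> 0" and "g \<noteq> 0"
  have *: "\<exists>a. mps_nth h a \<noteq> 0 \<and> (\<forall>b. mps_nth h b \<noteq> 0 \<longrightarrow> expo_mset a \<le> expo_mset b)"
    if "h \<noteq> 0" for h :: "'a mps"
  proof -
    obtain a where "mps_nth h a \<noteq> 0"
      using \<open>h \<noteq> 0\<close> mps_eqI[of h 0] by (auto simp: zero_mps.rep_eq)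
    then have "\<exists>M a. mps_nth h a \<noteq> 0 \<and> M = expo_mset a"
      by blast
    then obtain M where "\<exists>a. mps_nth h a \<noteq> 0 \<and> M = expo_mset a"
        and "\<And>N. \<exists>a. mps_nth h a \<noteq> 0 \<and> N = expo_mset a \<Longrightarrow> M \<le> N"
      using exists_least_iff[of "\<lambda>M. \<exists>a. mps_nth h a \<noteq> 0 \<and> M = expo_mset a"]
      by (metis not_less)
    then show ?thesis
      by blast
  qed
  obtain a where a: "mps_nth f a \<noteq> 0" "\<And>b. mps_nth f b \<noteq> 0 \<Longrightarrow> expo_mset a \<le> expo_mset b"
    using *[OF \<open>f \<noteq> 0\<close>] by blast
  obtain b where b: "mps_nth g b \<noteq> 0" "\<And>c. mps_nth g c \<noteq> 0 \<Longrightarrow> expo_mset b \<le> expo_mset c"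
    using *[OF \<open>g \<noteq> 0\<close>] by blast
  have "mps_nth (f * g) (a + b) =
      (\<Sum>x\<in>splits (a + b). if x = (a, b) then mps_nth f a * mps_nth g b else 0)"
    unfolding times_mps.rep_eq
  proof (rule sum.cong[OF refl])
    fix x
    assume "x \<in> splits (a + b)"
    then obtain c d where x: "x = (c, d)" and cd: "c + d = a + b"
      by (auto simp: splits_def)
    have "mps_nth f c * mps_nth g d = 0" if ne: "(c, d) \<noteq> (a, b)"
    proof (rule ccontr)
      assume "\<not> ?thesis"
      then have le: "expo_mset a \<le> expo_mset c" "expo_mset b \<le> expo_mset d"
        using a b by auto
      have "expo_mset c + expo_mset d = expo_mset a + expo_mset b"
        using cd by (simp flip: expo_mset_add)
      then have "expo_mset c = expo_mset a \<and> expo_mset d = expo_mset b"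
        using le by (metis add_less_le_mono add_le_less_mono order.order_iff_strict less_irrefl)
      then show False
        using ne by (simp add: expo_mset_inject)
    qed
    then show "(case x of (c, d) \<Rightarrow> mps_nth f c * mps_nth g d) =
        (if x = (a, b) then mps_nth f a * mps_nth g b else 0)"
      by (auto simp: x)
  qed
  also have "\<dots> = mps_nth f a * mps_nth g b"
    by (simp add: mem_splits)
  also have "\<dots> \<noteq> 0"
    using a b by simp
  finally show "f * g \<noteq> 0"
    by (auto simp: zero_mps.rep_eq)
qed



section \<open>The ring \<open>R[x] = K[[t\<^sub>0,\<dots>,t\<^sub>m\<^sub>-\<^sub>1]][x\<^sub>0,\<dots>,x\<^sub>n\<^sub>-\<^sub>1]\<close>\<close>

text \<open>
  Polynomials over \<^typ>\<open>'k mps\<close> are finitely supported functions from exponent vectors of \<open>x\<close> to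
  power series; \<open>RX m n\<close> is the subring in which only \<open>t\<^sub>i\<close> with \<open>i < m\<close> and \<open>x\<^sub>j\<close> with \<open>j < n\<close>
  occur. A monomial \<open>t\<^sup>\<alpha> x\<^sup>\<beta>\<close> is the pair \<open>(\<alpha>, \<beta>)\<close>, with multiplication written additively, and a
  module monomial \<open>t\<^sup>\<alpha> x\<^sup>\<beta> e\<^sub>i\<close> is \<open>((\<alpha>, \<beta>), i)\<close>. All indices start at \<open>0\<close>.
\<close>

type_synonym 'k rx = "expo \<Rightarrow>\<^sub>0 'k mps"
type_synonym mon = "expo \<times> expo"
type_synonym modmon = "mon \<times> nat"

definition Mon :: "nat \<Rightarrow> nat \<Rightarrow> mon set" where
  "Mon m n = {(\<alpha>, \<beta>). Poly_Mapping.keys \<alpha> \<subseteq> {..<m} \<and> Poly_Mapping.keys \<beta> \<subseteq> {..<n}}"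

definition modMon :: "nat \<Rightarrow> nat \<Rightarrow> nat \<Rightarrow> modmon set" where
  "modMon m n s = Mon m n \<times> {..<s}"

definition mon_act :: "mon \<Rightarrow> modmon \<Rightarrow> modmon" where
  "mon_act a p = (a + fst p, snd p)"

definition mcoeff :: "'k::comm_ring_1 rx \<Rightarrow> mon \<Rightarrow> 'k" where
  "mcoeff f a = mps_nth (Poly_Mapping.lookup f (snd a)) (fst a)"

text \<open>The term \<open>c t\<^sup>\<alpha> x\<^sup>\<beta>\<close> as an element of the ring.\<close>

definition mterm :: "'k::comm_ring_1 \<Rightarrow> mon \<Rightarrow> 'k rx" where
  "mterm c a = Poly_Mapping.single (snd a) (Abs_mps (\<lambda>\<alpha>. if \<alpha> = fst a then c else 0))"

definition supp :: "'k::comm_ring_1 rx \<Rightarrow> mon set" where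
  "supp f = {a. mcoeff f a \<noteq> 0}"

definition vsupp :: "(nat \<Rightarrow> 'k::comm_ring_1 rx) \<Rightarrow> modmon set" where
  "vsupp f = {(a, i). mcoeff (f i) a \<noteq> 0}"

definition RX :: "nat \<Rightarrow> nat \<Rightarrow> 'k::comm_ring_1 rx set" where
  "RX m n = {f. supp f \<subseteq> Mon m n}"

definition KTX :: "nat \<Rightarrow> nat \<Rightarrow> 'k::comm_ring_1 rx set" where
  "KTX m n = {f \<in> RX m n. finite (supp f)}"

text \<open>The free module \<open>A\<^sup>s\<close> over a subring \<open>A\<close>, and the submodule generated by a set of vectors.\<close>

definition free_mod :: "nat \<Rightarrow> 'r::zero set \<Rightarrow> (nat \<Rightarrow> 'r) set" where
  "free_mod s A = {v. (\<forall>i<s. v i \<in> A) \<and> (\<forall>i\<ge>s. v i = 0)}"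

definition mod_span :: "'r::comm_ring_1 set \<Rightarrow> (nat \<Rightarrow> 'r) set \<Rightarrow> (nat \<Rightarrow> 'r) set" where
  "mod_span A G =
    {(\<lambda>i. \<Sum>g\<in>F. a g * g i) | F a. finite F \<and> F \<subseteq> G \<and> (\<forall>g\<in>F. a g \<in> A)}"

definition unit_vec :: "nat \<Rightarrow> nat \<Rightarrow> 'r::{zero,one}" where
  "unit_vec i = (\<lambda>j. if j = i then 1 else 0)"


section \<open>Monomial orderings\<close>

text \<open>Orderings are given by their strict part: \<open>gt p q\<close> stands for \<open>p > q\<close>.\<close>

definition strict_total_ordering_on :: "'a set \<Rightarrow> ('a \<Rightarrow> 'a \<Rightarrow> bool) \<Rightarrow> bool" where
  "strict_total_ordering_on A gt \<longleftrightarrow> irreflp_on A gt \<and> transp_on A gt \<and> totalp_on A gt"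

definition monomial_ordering :: "nat \<Rightarrow> nat \<Rightarrow> (mon \<Rightarrow> mon \<Rightarrow> bool) \<Rightarrow> bool" where
  "monomial_ordering m n gt \<longleftrightarrow>
    strict_total_ordering_on (Mon m n) gt \<and>
    (\<forall>a\<in>Mon m n. \<forall>b\<in>Mon m n. \<forall>c\<in>Mon m n. gt a b \<longrightarrow> gt (c + a) (c + b))"

text \<open>
  \<open>gt\<close> is the ordering on \<open>Mon(t, x)\<close> induced by the ordering \<open>gtm\<close> on \<open>Mon\<^sup>s(t, x)\<close>;
  for \<open>s > 0\<close> it is determined by \<open>gtm\<close> on \<^term>\<open>Mon m n\<close>.
\<close>

definition module_monomial_ordering ::
    "nat \<Rightarrow> nat \<Rightarrow> nat \<Rightarrow> (mon \<Rightarrow> mon \<Rightarrow> bool) \<Rightarrow> (modmon \<Rightarrow> modmon \<Rightarrow> bool) \<Rightarrow> bool" where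
  "module_monomial_ordering m n s gt gtm \<longleftrightarrow>
    strict_total_ordering_on (modMon m n s) gtm \<and>
    (\<forall>p\<in>modMon m n s. \<forall>q\<in>modMon m n s. \<forall>a\<in>Mon m n.
       gtm p q \<longrightarrow> gtm (mon_act a p) (mon_act a q)) \<and>
    monomial_ordering m n gt \<and>
    (\<forall>a\<in>Mon m n. \<forall>b\<in>Mon m n. \<forall>i<s. gt a b \<longleftrightarrow> gtm (a, i) (b, i))"

definition t_local :: "nat \<Rightarrow> (mon \<Rightarrow> mon \<Rightarrow> bool) \<Rightarrow> bool" where
  "t_local m gt \<longleftrightarrow> (\<forall>i<m. gt 0 (Poly_Mapping.single i 1, 0))"

text \<open>
  Leading monomials are of option type, \<^const>\<open>None\<close> playing the role of \<open>lm(0) = 0\<close>, which is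
  smaller than all monomials and divides none.
\<close>

definition max_mon :: "('a \<Rightarrow> 'a \<Rightarrow> bool) \<Rightarrow> 'a set \<Rightarrow> 'a option" where
  "max_mon gt A = (if A = {} then None else Some (THE p. p \<in> A \<and> (\<forall>q\<in>A. q \<noteq> p \<longrightarrow> gt p q)))"

fun gt0 :: "('a \<Rightarrow> 'a \<Rightarrow> bool) \<Rightarrow> 'a option \<Rightarrow> 'a option \<Rightarrow> bool" where
  "gt0 gt (Some p) (Some q) \<longleftrightarrow> gt p q"
| "gt0 gt (Some p) None \<longleftrightarrow> True"
| "gt0 gt None q \<longleftrightarrow> False"

definition ge0 :: "('a \<Rightarrow> 'a \<Rightarrow> bool) \<Rightarrow> 'a option \<Rightarrow> 'a option \<Rightarrow> bool" where
  "ge0 gt p q \<longleftrightarrow> p = q \<or> gt0 gt p q"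

definition mon_dvd :: "modmon option \<Rightarrow> modmon option \<Rightarrow> bool" where
  "mon_dvd p p' \<longleftrightarrow> (\<exists>q a. p = Some q \<and> p' = Some (mon_act a q))"

lift_definition expo_max :: "expo \<Rightarrow> expo \<Rightarrow> expo" is "\<lambda>a b i. max (a i) (b i)"
proof -
  fix a b :: "nat \<Rightarrow> nat"
  assume "finite {i. a i \<noteq> 0}" "finite {i. b i \<noteq> 0}"
  then show "finite {i. max (a i) (b i) \<noteq> 0}"
    by (rule_tac finite_subset[of _ "{i. a i \<noteq> 0} \<union> {i. b i \<noteq> 0}"]) (auto simp: max_def)
qed

fun mon_lcm :: "modmon option \<Rightarrow> modmon option \<Rightarrow> modmon option" where
  "mon_lcm (Some ((\<alpha>, \<beta>), i)) (Some ((\<alpha>', \<beta>'), j)) =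
     (if i = j then Some ((expo_max \<alpha> \<alpha>', expo_max \<beta> \<beta>'), i) else None)"
| "mon_lcm None q = None"
| "mon_lcm p None = None"

text \<open>The quotient of a multiple \<open>p'\<close> of \<open>p\<close> (possibly \<open>p' = 0\<close>) by \<open>p\<close>, as an element of the ring.\<close>

fun mon_quot :: "modmon option \<Rightarrow> modmon option \<Rightarrow> 'k::comm_ring_1 rx" where
  "mon_quot (Some (b, j)) (Some (a, i)) = mterm 1 (b - a)"
| "mon_quot None p = 0"
| "mon_quot p' None = 0"


section \<open>The localisation and its leading monomials\<close>

definition ring_lm :: "(mon \<Rightarrow> mon \<Rightarrow> bool) \<Rightarrow> 'k::comm_ring_1 rx \<Rightarrow> mon option" where
  "ring_lm gt f = max_mon gt (supp f)"

definition ring_lt :: "(mon \<Rightarrow> mon \<Rightarrow> bool) \<Rightarrow> 'k::comm_ring_1 rx \<Rightarrow> 'k rx" where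
  "ring_lt gt f = (case ring_lm gt f of None \<Rightarrow> 0 | Some a \<Rightarrow> mterm (mcoeff f a) a)"

definition S_gt :: "nat \<Rightarrow> nat \<Rightarrow> (mon \<Rightarrow> mon \<Rightarrow> bool) \<Rightarrow> 'k::comm_ring_1 rx set" where
  "S_gt m n gt = {u \<in> RX m n. ring_lt gt u = 1}"

text \<open>\<open>R[x]\<^sub>> = S\<^sub>>\<^sup>-\<^sup>1 R[x]\<close>, as a subring of the field of fractions of the domain \<^typ>\<open>'k::idom rx\<close>.\<close>

definition RXloc :: "nat \<Rightarrow> nat \<Rightarrow> (mon \<Rightarrow> mon \<Rightarrow> bool) \<Rightarrow> 'k::idom rx fract set" where
  "RXloc m n gt = {Fract f u | f u. f \<in> RX m n \<and> u \<in> S_gt m n gt}"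

definition to_loc :: "'k::idom rx \<Rightarrow> 'k rx fract" where
  "to_loc f = Fract f 1"

text \<open>
  A numerator of a vector over the localisation, with respect to a common denominator in \<open>S\<^sub>>\<close>.
  Leading monomial and leading coefficient do not depend on its choice.
\<close>

definition numerator ::
    "nat \<Rightarrow> nat \<Rightarrow> (mon \<Rightarrow> mon \<Rightarrow> bool) \<Rightarrow> (nat \<Rightarrow> 'k::idom rx fract) \<Rightarrow> (nat \<Rightarrow> 'k rx)" where
  "numerator m n gt v =
    (SOME f. \<exists>u\<in>S_gt m n gt. \<forall>i. f i \<in> RX m n \<and> v i = Fract (f i) u)"

definition lm :: "nat \<Rightarrow> nat \<Rightarrow> (mon \<Rightarrow> mon \<Rightarrow> bool) \<Rightarrow> (modmon \<Rightarrow> modmon \<Rightarrow> bool) \<Rightarrow>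
    (nat \<Rightarrow> 'k::idom rx fract) \<Rightarrow> modmon option" where
  "lm m n gt gtm v = max_mon gtm (vsupp (numerator m n gt v))"

definition lc :: "nat \<Rightarrow> nat \<Rightarrow> (mon \<Rightarrow> mon \<Rightarrow> bool) \<Rightarrow> (modmon \<Rightarrow> modmon \<Rightarrow> bool) \<Rightarrow>
    (nat \<Rightarrow> 'k::idom rx fract) \<Rightarrow> 'k" where
  "lc m n gt gtm v =
    (case lm m n gt gtm v of None \<Rightarrow> 0 | Some (a, i) \<Rightarrow> mcoeff (numerator m n gt v i) a)"


section \<open>Standard bases, division with remainder, syzygies\<close>

text \<open>A module monomial, or \<open>0\<close>, as an element of \<open>K[t, x]\<^sup>s\<close>.\<close>

definition mon_vec :: "modmon option \<Rightarrow> (nat \<Rightarrow> 'k::comm_ring_1 rx)" where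
  "mon_vec p = (\<lambda>j. case p of None \<Rightarrow> 0 | Some (a, i) \<Rightarrow> mterm 1 a * unit_vec i j)"

definition L_gt :: "nat \<Rightarrow> nat \<Rightarrow> (mon \<Rightarrow> mon \<Rightarrow> bool) \<Rightarrow> (modmon \<Rightarrow> modmon \<Rightarrow> bool) \<Rightarrow>
    (nat \<Rightarrow> 'k::idom rx fract) set \<Rightarrow> (nat \<Rightarrow> 'k rx) set" where
  "L_gt m n gt gtm G = mod_span (KTX m n) ((\<lambda>g. mon_vec (lm m n gt gtm g)) ` G)"

definition standard_basis :: "nat \<Rightarrow> nat \<Rightarrow> (mon \<Rightarrow> mon \<Rightarrow> bool) \<Rightarrow> (modmon \<Rightarrow> modmon \<Rightarrow> bool) \<Rightarrow>
    (nat \<Rightarrow> 'k::idom rx fract) set \<Rightarrow> (nat \<Rightarrow> 'k rx fract) set \<Rightarrow> bool" where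
  "standard_basis m n gt gtm J G \<longleftrightarrow>
    finite G \<and> G \<subseteq> J \<and> L_gt m n gt gtm G = L_gt m n gt gtm J"

text \<open>\<open>f = q\<^sub>0 g\<^sub>0 + \<dots> + q\<^sub>k\<^sub>-\<^sub>1 g\<^sub>k\<^sub>-\<^sub>1 + r\<close> is a division with remainder.\<close>

definition division_with_remainder :: "nat \<Rightarrow> nat \<Rightarrow> nat \<Rightarrow> (mon \<Rightarrow> mon \<Rightarrow> bool) \<Rightarrow>
    (modmon \<Rightarrow> modmon \<Rightarrow> bool) \<Rightarrow> nat \<Rightarrow> (nat \<Rightarrow> nat \<Rightarrow> 'k::idom rx fract) \<Rightarrow>
    (nat \<Rightarrow> 'k rx fract) \<Rightarrow> (nat \<Rightarrow> 'k rx fract) \<Rightarrow> (nat \<Rightarrow> 'k rx fract) \<Rightarrow> bool" where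
  "division_with_remainder m n s gt gtm k g f q r \<longleftrightarrow>
    (\<forall>\<nu><k. q \<nu> \<in> RXloc m n gt) \<and>
    r \<in> free_mod s (RXloc m n gt) \<and>
    f = (\<lambda>l. (\<Sum>\<nu><k. q \<nu> * g \<nu> l) + r l) \<and>
    (\<forall>\<nu><k. ge0 gtm (lm m n gt gtm f) (lm m n gt gtm (\<lambda>l. q \<nu> * g \<nu> l))) \<and>
    (r \<noteq> (\<lambda>_. 0) \<longrightarrow> (\<forall>\<nu><k. \<not> mon_dvd (lm m n gt gtm (g \<nu>)) (lm m n gt gtm r)))"

definition has_standard_rep :: "nat \<Rightarrow> nat \<Rightarrow> nat \<Rightarrow> (mon \<Rightarrow> mon \<Rightarrow> bool) \<Rightarrow>
    (modmon \<Rightarrow> modmon \<Rightarrow> bool) \<Rightarrow> nat \<Rightarrow> (nat \<Rightarrow> nat \<Rightarrow> 'k::idom rx fract) \<Rightarrow>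
    (nat \<Rightarrow> 'k rx fract) \<Rightarrow> bool" where
  "has_standard_rep m n s gt gtm k g f \<longleftrightarrow>
    (\<exists>q. division_with_remainder m n s gt gtm k g f q (\<lambda>_. 0))"

definition has_weak_standard_rep :: "nat \<Rightarrow> nat \<Rightarrow> nat \<Rightarrow> (mon \<Rightarrow> mon \<Rightarrow> bool) \<Rightarrow>
    (modmon \<Rightarrow> modmon \<Rightarrow> bool) \<Rightarrow> nat \<Rightarrow> (nat \<Rightarrow> nat \<Rightarrow> 'k::idom rx fract) \<Rightarrow>
    (nat \<Rightarrow> 'k rx fract) \<Rightarrow> bool" where
  "has_weak_standard_rep m n s gt gtm k g f \<longleftrightarrow>
    (\<exists>u\<in>S_gt m n gt. has_standard_rep m n s gt gtm k g (\<lambda>l. to_loc u * f l))"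

text \<open>
  \<open>lcm(lm(f), lm(g)) / lt(f)\<close>, which is also the coefficient \<open>m\<^sub>j\<^sub>i / lc(g\<^sub>i)\<close> of the syzygy
  \<open>s\<^sub>i\<^sub>j\<close> when \<open>f = g\<^sub>i\<close> and \<open>g = g\<^sub>j\<close>.
\<close>

definition lcm_over_lt :: "nat \<Rightarrow> nat \<Rightarrow> (mon \<Rightarrow> mon \<Rightarrow> bool) \<Rightarrow> (modmon \<Rightarrow> modmon \<Rightarrow> bool) \<Rightarrow>
    (nat \<Rightarrow> 'k::idom rx fract) \<Rightarrow> (nat \<Rightarrow> 'k rx fract) \<Rightarrow> 'k rx fract" where
  "lcm_over_lt m n gt gtm f g =
    to_loc (mon_quot (mon_lcm (lm m n gt gtm f) (lm m n gt gtm g)) (lm m n gt gtm f)) /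
    to_loc (mterm (lc m n gt gtm f) 0)"

definition spoly :: "nat \<Rightarrow> nat \<Rightarrow> (mon \<Rightarrow> mon \<Rightarrow> bool) \<Rightarrow> (modmon \<Rightarrow> modmon \<Rightarrow> bool) \<Rightarrow>
    (nat \<Rightarrow> 'k::idom rx fract) \<Rightarrow> (nat \<Rightarrow> 'k rx fract) \<Rightarrow> (nat \<Rightarrow> 'k rx fract)" where
  "spoly m n gt gtm f g =
    (\<lambda>l. lcm_over_lt m n gt gtm f g * f l - lcm_over_lt m n gt gtm g f * g l)"

definition schreyer_syz :: "nat \<Rightarrow> nat \<Rightarrow> (mon \<Rightarrow> mon \<Rightarrow> bool) \<Rightarrow> (modmon \<Rightarrow> modmon \<Rightarrow> bool) \<Rightarrow>
    nat \<Rightarrow> (nat \<Rightarrow> nat \<Rightarrow> 'k::idom rx fract) \<Rightarrow> (nat \<Rightarrow> nat \<Rightarrow> nat \<Rightarrow> 'k rx fract) \<Rightarrow>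
    nat \<Rightarrow> nat \<Rightarrow> (nat \<Rightarrow> 'k rx fract)" where
  "schreyer_syz m n gt gtm k g q i j =
    (\<lambda>l. lcm_over_lt m n gt gtm (g i) (g j) * unit_vec i l
       - lcm_over_lt m n gt gtm (g j) (g i) * unit_vec j l
       - (\<Sum>\<nu><k. q i j \<nu> * unit_vec \<nu> l))"

text \<open>
  The Schreyer ordering on \<open>Mon\<^sup>k(t, x)\<close>. It induces the same ordering on \<open>Mon(t, x)\<close> as \<open>gtm\<close>,
  hence the same localisation.
\<close>

definition schreyer_ordering :: "nat \<Rightarrow> nat \<Rightarrow> (mon \<Rightarrow> mon \<Rightarrow> bool) \<Rightarrow>
    (modmon \<Rightarrow> modmon \<Rightarrow> bool) \<Rightarrow> (nat \<Rightarrow> nat \<Rightarrow> 'k::idom rx fract) \<Rightarrow>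
    modmon \<Rightarrow> modmon \<Rightarrow> bool" where
  "schreyer_ordering m n gt gtm g p p' \<longleftrightarrow>
    (let h = map_option (mon_act (fst p)) (lm m n gt gtm (g (snd p)));
         h' = map_option (mon_act (fst p')) (lm m n gt gtm (g (snd p')))
     in gt0 gtm h h' \<or> h = h' \<and> snd p < snd p')"

definition syz :: "nat \<Rightarrow> nat \<Rightarrow> (mon \<Rightarrow> mon \<Rightarrow> bool) \<Rightarrow> nat \<Rightarrow>
    (nat \<Rightarrow> nat \<Rightarrow> 'k::idom rx fract) \<Rightarrow> (nat \<Rightarrow> 'k rx fract) set" where
  "syz m n gt k g = {q \<in> free_mod k (RXloc m n gt). \<forall>l. (\<Sum>\<nu><k. q \<nu> * g \<nu> l) = 0}"

end

theory Submission
  imports Defs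
begin

text \<open>
  The submodule generated by the \<open>g\<^sub>\<nu>\<close> is the image of the map \<open>\<phi>\<close> that sends \<open>Q\<close> to the sum of
  the \<open>Q\<^sub>\<nu> g\<^sub>\<nu>\<close>. The Schreyer ordering is made so that the leading monomial \<open>a \<epsilon>\<^sub>i\<close> of \<open>Q\<close> names the
  largest monomial \<open>a lm(g\<^sub>i)\<close> of the summands and the first index \<open>i\<close> at which it occurs. So either
  \<open>a lm(g\<^sub>i)\<close> is the leading monomial of \<open>\<phi>(Q)\<close>, or it cancels; then it is also the leading monomial
  of a summand with a later index \<open>j\<close>, and \<open>m\<^sub>j\<^sub>i\<close> divides \<open>a\<close> (\<open>cancellation_dvd\<close>). A standard
  representation of \<open>spoly(g\<^sub>i, g\<^sub>j)\<close> gives a syzygy with leading monomial \<open>m\<^sub>j\<^sub>i \<epsilon>\<^sub>i\<close>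
  (\<open>pair_syz_lead\<close>). Hence the second alternative says that \<open>a \<epsilon>\<^sub>i\<close> is the leading monomial of a
  syzygy.

  For a syzygy \<open>Q\<close> the first alternative is impossible, and so its leading monomial is divisible by
  that of some \<open>s\<^sub>i\<^sub>j\<close>: this is the statement on \<open>syz\<close>, once the remainders \<open>r\<^sub>i\<^sub>j\<close> are known to
  vanish, which follows from the statement on \<open>G\<close>. For the latter, let \<open>f = \<phi>(Q)\<close>. It suffices to
  change \<open>Q\<close> modulo syzygies into a vector \<open>R\<close> whose leading monomial is not that of a syzygy, since
  then the first alternative holds for \<open>R\<close>.

  This is \<open>weak_normal_form\<close>, valid for any submodule \<open>N\<close> in place of the syzygies: there are
  \<open>u \<in> S\<^sub>>\<close> and \<open>R\<close> with \<open>u Q - R \<in> N\<close> such that \<open>R = 0\<close> or \<open>lm(R)\<close> is not the leading monomial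
  of an element of \<open>N\<close>. Subtracting elements of \<open>N\<close> repeatedly need not end, as the ordering is not
  a well-ordering. Following Mora, earlier intermediate results are used as reducers too; they only
  change the factor \<open>u\<close>. Each intermediate result comes with a bound \<open>d\<close> on its degree in \<open>x\<close>, and is
  first reduced by all earlier ones, without raising the degree bound. Here one works with the
  monomials of bounded degree in \<open>x\<close>, on which \<open>>\<close> has no infinite ascending chain, because \<open>t\<^sub>i < 1\<close>.
  Therefore the coefficients of the multipliers, which are power series in \<open>t\<close>, can be found by
  well-founded recursion from the largest monomial downwards (\<open>bounded_division\<close>), and no question
  of convergence arises. In terms of homogenised monomials, none of the pairs of degree bound and
  leading monomial so obtained divides a later one, so that Dickson's lemma ends the process.
\<close>

section \<open>Coefficients and supports\<close>

definition msplits :: "mon \<Rightarrow> (mon \<times> mon) set" where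
  "msplits c = {(a, b). a + b = c}"

lemma mem_msplits: "(a, b) \<in> msplits c \<longleftrightarrow> a + b = c"
  by (simp add: msplits_def)

lemma finite_msplits [simp]: "finite (msplits c)"
proof (rule finite_subset)
  show "msplits c \<subseteq> (\<lambda>((a, b), (a', b')). ((a, a'), (b, b'))) ` (splits (fst c) \<times> splits (snd c))"
    by (force simp: msplits_def splits_def image_iff)
  show "finite ((\<lambda>((a, b), (a', b')). ((a, a'), (b, b'))) ` (splits (fst c) \<times> splits (snd c)))"
    by (intro finite_imageI finite_cartesian_product finite_splits)
qed

lemma mcoeff_0 [simp]: "mcoeff 0 a = 0"
  by (simp add: mcoeff_def zero_mps.rep_eq)

lemma mcoeff_add [simp]: "mcoeff (f + g) a = mcoeff f a + mcoeff g a"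
  by (simp add: mcoeff_def lookup_add plus_mps.rep_eq)

lemma mcoeff_minus [simp]: "mcoeff (f - g) a = mcoeff f a - mcoeff g a"
  by (simp add: mcoeff_def lookup_minus minus_mps.rep_eq)

lemma mcoeff_uminus [simp]: "mcoeff (- f) a = - mcoeff f a"
  using mcoeff_minus[of 0 f a] by simp

lemma mcoeff_sum: "mcoeff (\<Sum>i\<in>A. f i) a = (\<Sum>i\<in>A. mcoeff (f i) a)"
  by (induction A rule: infinite_finite_induct) simp_all

lemma mcoeff_eqI: "(\<And>a. mcoeff f a = mcoeff g a) \<Longrightarrow> f = g"
  by (rule poly_mapping_eqI, rule mps_eqI) (force simp: mcoeff_def)

lemma mcoeff_mterm: "mcoeff (mterm c a) b = (if b = a then c else 0)"
  by (auto simp: mcoeff_def mterm_def lookup_single when_def Abs_mps_inverse zero_mps.rep_eq prod_eq_iff)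

lemma mterm_one [simp]: "mterm 1 0 = 1"
proof -
  have "Abs_mps (\<lambda>\<alpha>. if \<alpha> = 0 then 1 else 0) = (1 :: 'a mps)"
    by (rule mps_eqI) (simp add: one_mps.rep_eq Abs_mps_inverse)
  then show ?thesis
    by (simp add: mterm_def single_one)
qed

lemma mcoeff_one: "mcoeff 1 b = (if b = 0 then 1 else 0)"
  by (metis mcoeff_mterm mterm_one)

lemma lookup_mult_splits:
  fixes f g :: "'k::comm_ring_1 rx"
  shows "Poly_Mapping.lookup (f * g) c = (\<Sum>(a, b)\<in>splits c. Poly_Mapping.lookup f a * Poly_Mapping.lookup g b)"
proof -
  have "Poly_Mapping.lookup (f * g) c =
      (\<Sum>(a, b). Poly_Mapping.lookup f a * Poly_Mapping.lookup g b when c = a + b)"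
    unfolding times_poly_mapping.rep_eq
    by (rule prod_fun_unfold_prod) simp_all
  also have "\<dots> = (\<Sum>(a, b)\<in>splits c. Poly_Mapping.lookup f a * Poly_Mapping.lookup g b when c = a + b)"
    by (rule Sum_any.expand_superset) (auto simp: mem_splits)
  also have "\<dots> = (\<Sum>(a, b)\<in>splits c. Poly_Mapping.lookup f a * Poly_Mapping.lookup g b)"
    by (rule sum.cong) (auto simp: mem_splits)
  finally show ?thesis .
qed

lemma mps_nth_sum: "mps_nth (\<Sum>i\<in>A. f i) a = (\<Sum>i\<in>A. mps_nth (f i) a)"
  by (induction A rule: infinite_finite_induct) (simp_all add: zero_mps.rep_eq plus_mps.rep_eq)

lemma mcoeff_mult:
  fixes f g :: "'k::comm_ring_1 rx"
  shows "mcoeff (f * g) c = (\<Sum>(a, b)\<in>msplits c. mcoeff f a * mcoeff g b)"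
proof -
  have "mcoeff (f * g) c = (\<Sum>x\<in>splits (snd c). \<Sum>y\<in>splits (fst c).
      mcoeff f (fst y, fst x) * mcoeff g (snd y, snd x))"
    by (simp add: mcoeff_def lookup_mult_splits mps_nth_sum times_mps.rep_eq case_prod_unfold)
  also have "\<dots> = (\<Sum>(x, y)\<in>splits (snd c) \<times> splits (fst c).
      mcoeff f (fst y, fst x) * mcoeff g (snd y, snd x))"
    by (simp add: sum.cartesian_product)
  also have "\<dots> = (\<Sum>(a, b)\<in>msplits c. mcoeff f a * mcoeff g b)"
    by (rule sum.reindex_bij_witness
          [where i = "\<lambda>(a, b). ((snd a, snd b), (fst a, fst b))"
             and j = "\<lambda>(x, y). ((fst y, fst x), (snd y, snd x))"])
       (auto simp: splits_def msplits_def)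
  finally show ?thesis .
qed

text \<open>
  When an extreme monomial of a product arises in one way only, its coefficient is a product of two
  coefficients; leading coefficients are multiplicative for this reason.
\<close>

lemma mcoeff_mult_unique_split:
  fixes f g :: "'k::comm_ring_1 rx"
  assumes "\<And>c d. c \<in> supp f \<Longrightarrow> d \<in> supp g \<Longrightarrow> c + d = a + b \<Longrightarrow> c = a"
  shows "mcoeff (f * g) (a + b) = mcoeff f a * mcoeff g b"
proof -
  have "mcoeff (f * g) (a + b) =
      (\<Sum>x\<in>msplits (a + b). if x = (a, b) then mcoeff f a * mcoeff g b else 0)"
    unfolding mcoeff_mult
  proof (rule sum.cong[OF refl], clarify)
    fix c d assume "(c, d) \<in> msplits (a + b)"
    then have cd: "c + d = a + b" by (simp add: mem_msplits)
    show "mcoeff f c * mcoeff g d = (if (c, d) = (a, b) then mcoeff f a * mcoeff g b else 0)"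
    proof (cases "c = a")
      case True
      then have "d = b" using cd by simp
      then show ?thesis using True by simp
    next
      case False
      then have "c \<notin> supp f \<or> d \<notin> supp g" using assms cd by blast
      then show ?thesis using False by (auto simp: supp_def)
    qed
  qed
  also have "\<dots> = mcoeff f a * mcoeff g b"
    by (simp add: mem_msplits)
  finally show ?thesis .
qed

lemma mcoeff_mterm_mult [simp]: "mcoeff (mterm c a * f) (a + b) = c * mcoeff f b"
  by (subst mcoeff_mult_unique_split) (auto simp: supp_def mcoeff_mterm split: if_splits)

lemma supp_mult: "a \<in> supp (f * g) \<Longrightarrow> \<exists>b\<in>supp f. \<exists>c\<in>supp g. a = b + c"
proof (rule ccontr)
  assume a: "a \<in> supp (f * g)" and n: "\<not> (\<exists>b\<in>supp f. \<exists>c\<in>supp g. a = b + c)"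
  have "mcoeff (f * g) a = 0"
    unfolding mcoeff_mult
  proof (rule sum.neutral, clarify)
    fix b c assume "(b, c) \<in> msplits a"
    then have "b \<notin> supp f \<or> c \<notin> supp g" using n by (metis mem_msplits)
    then show "mcoeff f b * mcoeff g c = 0" by (auto simp: supp_def)
  qed
  then show False using a by (simp add: supp_def)
qed

lemma supp_0 [simp]: "supp 0 = {}"
  by (simp add: supp_def)

lemma supp_eq_empty_iff [simp]: "supp f = {} \<longleftrightarrow> f = 0"
  using mcoeff_eqI[of f 0] by (auto simp: supp_def)

lemma mem_vsupp: "(a, i) \<in> vsupp v \<longleftrightarrow> a \<in> supp (v i)"
  by (simp add: vsupp_def supp_def)

lemma mem_vsupp': "p \<in> vsupp v \<longleftrightarrow> fst p \<in> supp (v (snd p))"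
  by (cases p) (simp add: mem_vsupp)

lemma vsupp_eq_empty_iff [simp]: "vsupp v = {} \<longleftrightarrow> v = (\<lambda>_. 0)"
proof
  assume e: "vsupp v = {}"
  have "supp (v i) = {}" for i using e mem_vsupp[of _ i v] by blast
  then show "v = (\<lambda>_. 0)" by (simp add: fun_eq_iff)
qed (simp add: vsupp_def)

text \<open>
  An element of \<open>R[x]\<close> may be prescribed coefficientwise, arbitrarily in \<open>t\<close>, as long as finitely
  many monomials in \<open>x\<close> occur. This is how multipliers found by recursion become ring elements.
\<close>

lemma mcoeff_series:
  assumes "finite {\<beta>. \<exists>\<alpha>. C (\<alpha>, \<beta>) \<noteq> (0::'k::comm_ring_1)}"
  shows "\<exists>f. \<forall>a. mcoeff f a = C a"
proof -
  let ?c = "\<lambda>\<beta>. Abs_mps (\<lambda>\<alpha>. C (\<alpha>, \<beta>))"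
  have "{\<beta>. ?c \<beta> \<noteq> 0} \<subseteq> {\<beta>. \<exists>\<alpha>. C (\<alpha>, \<beta>) \<noteq> 0}"
  proof clarify
    fix \<beta> assume "?c \<beta> \<noteq> 0"
    then have "\<not> (\<forall>\<alpha>. mps_nth (?c \<beta>) \<alpha> = mps_nth 0 \<alpha>)" by (meson mps_eqI)
    then show "\<exists>\<alpha>. C (\<alpha>, \<beta>) \<noteq> 0" by (simp add: Abs_mps_inverse zero_mps.rep_eq)
  qed
  then have "finite {\<beta>. ?c \<beta> \<noteq> 0}"
    using assms by (rule finite_subset)
  then have "mcoeff (Abs_poly_mapping ?c) a = C a" for a
    by (simp add: mcoeff_def Abs_mps_inverse)
  then show ?thesis by blast
qed

lemma Mon_0 [simp]: "0 \<in> Mon m n"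
  by (auto simp: Mon_def zero_prod_def)

lemma keys_expo_add: "Poly_Mapping.keys ((a::expo) + b) = Poly_Mapping.keys a \<union> Poly_Mapping.keys b"
  by (auto simp: in_keys_iff lookup_add)

lemma Mon_add_iff [simp]: "a + b \<in> Mon m n \<longleftrightarrow> a \<in> Mon m n \<and> b \<in> Mon m n"
  by (cases a; cases b) (auto simp: Mon_def keys_expo_add)

lemma RX_0 [simp]: "0 \<in> RX m n" by (simp add: RX_def)
lemma RX_1 [simp]: "1 \<in> RX m n" by (auto simp: RX_def supp_def mcoeff_one split: if_splits)
lemma RX_iff: "f \<in> RX m n \<longleftrightarrow> (\<forall>a. a \<notin> Mon m n \<longrightarrow> mcoeff f a = 0)"
  by (auto simp: RX_def supp_def)
lemma RX_add: "f \<in> RX m n \<Longrightarrow> g \<in> RX m n \<Longrightarrow> f + g \<in> RX m n" by (simp add: RX_iff)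
lemma RX_minus: "f \<in> RX m n \<Longrightarrow> g \<in> RX m n \<Longrightarrow> f - g \<in> RX m n" by (simp add: RX_iff)
lemma RX_mult: "f \<in> RX m n \<Longrightarrow> g \<in> RX m n \<Longrightarrow> f * g \<in> RX m n"
  unfolding RX_def
proof (rule CollectI, rule subsetI)
  fix a assume fg: "f \<in> {f. supp f \<subseteq> Mon m n}" "g \<in> {f. supp f \<subseteq> Mon m n}" and "a \<in> supp (f * g)"
  then obtain b c where "b \<in> supp f" "c \<in> supp g" "a = b + c" using supp_mult by blast
  then show "a \<in> Mon m n" using fg by (simp only: Mon_add_iff) blast
qed
lemma RX_sum: "(\<And>i. i \<in> A \<Longrightarrow> f i \<in> RX m n) \<Longrightarrow> (\<Sum>i\<in>A. f i) \<in> RX m n"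
  by (induction A rule: infinite_finite_induct) (auto intro: RX_add)
lemma RX_mterm: "a \<in> Mon m n \<Longrightarrow> mterm c a \<in> RX m n"
  by (auto simp: RX_def supp_def mcoeff_mterm split: if_splits)

lemma mterm_mult: "mterm c a * mterm d b = mterm (c * d) (a + b)"
proof (rule mcoeff_eqI)
  fix e
  show "mcoeff (mterm c a * mterm d b) e = mcoeff (mterm (c * d) (a + b)) e"
  proof (cases "e \<in> supp (mterm c a * mterm d b)")
    case True
    then have "e = a + b" using supp_mult by (fastforce simp: supp_def mcoeff_mterm split: if_splits)
    then show ?thesis by (simp add: mcoeff_mterm)
  next
    case False
    show ?thesis
    proof (cases "e = a + b")
      case True
      then show ?thesis by (simp add: mcoeff_mterm)
    next
      case F2: False
      then show ?thesis using False by (simp add: supp_def mcoeff_mterm)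
    qed
  qed
qed

lemma mon_act_0 [simp]: "mon_act 0 p = p" by (simp add: mon_act_def)
lemma mon_act_add: "mon_act (a + b) p = mon_act a (mon_act b p)" by (simp add: mon_act_def add.assoc)
lemma fst_mon_act [simp]: "fst (mon_act a p) = a + fst p" by (simp add: mon_act_def)
lemma snd_mon_act [simp]: "snd (mon_act a p) = snd p" by (simp add: mon_act_def)
lemma mon_act_pair [simp]: "mon_act a (b, i) = (a + b, i)" by (simp add: mon_act_def)
lemma mon_act_inject [simp]: "mon_act a p = mon_act b p \<longleftrightarrow> a = b" by (simp add: mon_act_def)

lemma vsupp_scale:
  assumes "p \<in> vsupp (\<lambda>l. u * v l)"
  obtains a q where "a \<in> supp u" "q \<in> vsupp v" "p = mon_act a q"
proof -
  obtain a b where "a \<in> supp u" "b \<in> supp (v (snd p))" "fst p = a + b"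
    using supp_mult[of "fst p" u "v (snd p)"] assms by (auto simp: mem_vsupp')
  then show ?thesis
    by (intro that[of a "(b, snd p)"]) (auto simp: mem_vsupp prod_eq_iff)
qed

lemma supp_minus: "supp (f - g) \<subseteq> supp f \<union> supp g"
  by (auto simp: supp_def)

lemma supp_sum: "supp (\<Sum>i\<in>A. f i) \<subseteq> (\<Union>i\<in>A. supp (f i))"
proof
  fix a assume "a \<in> supp (\<Sum>i\<in>A. f i)"
  then have "(\<Sum>i\<in>A. mcoeff (f i) a) \<noteq> 0" by (simp add: supp_def mcoeff_sum)
  then obtain i where "i \<in> A" "mcoeff (f i) a \<noteq> 0" by (rule sum.not_neutral_contains_not_neutral)
  then show "a \<in> (\<Union>i\<in>A. supp (f i))" by (auto simp: supp_def)
qed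

lemma vsupp_minus: "vsupp (\<lambda>l. v l - w l) \<subseteq> vsupp v \<union> vsupp w"
  by (auto simp: mem_vsupp dest: subsetD[OF supp_minus])

lemma vsupp_sum: "vsupp (\<lambda>l. \<Sum>i\<in>A. v i l) \<subseteq> (\<Union>i\<in>A. vsupp (v i))"
proof clarify
  fix a l assume "(a, l) \<in> vsupp (\<lambda>l. \<Sum>i\<in>A. v i l)"
  then have "a \<in> (\<Union>i\<in>A. supp (v i l))"
    using supp_sum[of "\<lambda>i. v i l" A] by (auto simp: mem_vsupp)
  then show "(a, l) \<in> (\<Union>i\<in>A. vsupp (v i))" by (auto simp: mem_vsupp)
qed

lemma modMon_mon_act [simp]: "mon_act a p \<in> modMon m n s \<longleftrightarrow> a \<in> Mon m n \<and> p \<in> modMon m n s"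
  by (cases p) (auto simp: modMon_def)

lemma vsupp_free_mod: "v \<in> free_mod s (RX m n) \<Longrightarrow> vsupp v \<subseteq> modMon m n s"
proof clarify
  fix a i assume v: "v \<in> free_mod s (RX m n)" and ai: "(a, i) \<in> vsupp v"
  have "i < s"
    using v ai by (cases "i < s") (auto simp: free_mod_def mem_vsupp)
  moreover have "supp (v i) \<subseteq> Mon m n"
    using v \<open>i < s\<close> by (simp add: free_mod_def RX_def)
  ultimately show "(a, i) \<in> modMon m n s"
    using ai by (auto simp: modMon_def mem_vsupp)
qed

lemma free_mod_nth: "v \<in> free_mod s (RX m n) \<Longrightarrow> v i \<in> RX m n"
  by (cases "i < s") (auto simp: free_mod_def)

lemma free_mod_zero [simp]: "(\<lambda>_. 0) \<in> free_mod s (RX m n)" by (simp add: free_mod_def)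
lemma free_mod_minus: "v \<in> free_mod s (RX m n) \<Longrightarrow> w \<in> free_mod s (RX m n) \<Longrightarrow> (\<lambda>l. v l - w l) \<in> free_mod s (RX m n)"
  by (auto simp: free_mod_def RX_minus)
lemma free_mod_scale: "u \<in> RX m n \<Longrightarrow> v \<in> free_mod s (RX m n) \<Longrightarrow> (\<lambda>l. u * v l) \<in> free_mod s (RX m n)"
  by (auto simp: free_mod_def RX_mult)
lemma free_mod_sum: "(\<And>i. i \<in> A \<Longrightarrow> v i \<in> free_mod s (RX m n)) \<Longrightarrow> (\<lambda>l. \<Sum>i\<in>A. v i l) \<in> free_mod s (RX m n)"
  by (auto simp: free_mod_def RX_sum)

section \<open>Dickson's lemma\<close>

text \<open>
  Always jump to a position where the minimum over all later positions is attained.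
\<close>

lemma nat_seq_mono_subsequence:
  fixes f :: "nat \<Rightarrow> nat"
  shows "\<exists>h :: nat \<Rightarrow> nat. strict_mono h \<and> mono (\<lambda>j. f (h j))"
proof -
  have next_min: "\<exists>j>N. \<forall>i\<ge>j. f j \<le> f i" for N
  proof -
    obtain j where "j > N" "\<And>i. i > N \<Longrightarrow> f j \<le> f i"
      using exists_least_iff[of "\<lambda>x. \<exists>j>N. x = f j"] by (metis lessI not_less)
    then show ?thesis by (meson le_less_trans less_le_trans)
  qed
  have "\<exists>h. \<forall>k. (\<forall>i\<ge>h k. f (h k) \<le> f i) \<and> h k < h (Suc k)"
    using next_min by (intro dependent_nat_choice) blast+
  then obtain h :: "nat \<Rightarrow> nat" where h: "\<And>k i. h k \<le> i \<Longrightarrow> f (h k) \<le> f i" "\<And>k. h k < h (Suc k)"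
    by blast
  have "strict_mono h" using h(2) by (rule strict_mono_Suc_iff[THEN iffD2, rule_format])
  then have "mono (\<lambda>j. f (h j))" using h(1) by (simp add: mono_def strict_mono_less_eq)
  with \<open>strict_mono h\<close> show ?thesis by blast
qed

lemma simultaneous_mono_subsequence:
  fixes f :: "nat \<Rightarrow> 'a \<Rightarrow> nat"
  assumes "finite A"
  shows "\<exists>h :: nat \<Rightarrow> nat. strict_mono h \<and> (\<forall>x\<in>A. mono (\<lambda>j. f (h j) x))"
  using assms
proof (induction A)
  case empty
  show ?case by (auto intro!: exI[of _ id] simp: strict_mono_def)
next
  case (insert x A)
  then obtain h :: "nat \<Rightarrow> nat" where h: "strict_mono h" "\<And>y. y \<in> A \<Longrightarrow> mono (\<lambda>j. f (h j) y)" by blast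
  obtain h' :: "nat \<Rightarrow> nat" where h': "strict_mono h'" "mono (\<lambda>j. f (h (h' j)) x)"
    using nat_seq_mono_subsequence[of "\<lambda>j. f (h j) x"] by blast
  have "strict_mono (h \<circ> h')" using h h' by (simp add: strict_mono_def)
  moreover have "mono (\<lambda>j. f ((h \<circ> h') j) y)" if "y \<in> insert x A" for y
    using that h(2)[of y] h'(2) strict_mono_mono[OF h'(1)]
    by (cases "y = x") (auto simp: mono_def)
  ultimately show ?case by blast
qed

text \<open>
  The total degree in \<open>x\<close>. Size is additive on multisets, hence so is this degree.
\<close>

definition xdeg :: "mon \<Rightarrow> nat" where
  "xdeg a = size (expo_mset (snd a))"

lemma xdeg_add [simp]: "xdeg (a + b) = xdeg a + xdeg b"
  by (simp add: xdeg_def expo_mset_add)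

lemma xdeg_eq_0D:
  assumes "xdeg a = 0" shows "snd a = 0"
proof (rule poly_mapping_eqI)
  fix i show "Poly_Mapping.lookup (snd a) i = Poly_Mapping.lookup 0 i"
    using assms count_expo_mset[of "snd a" i] by (simp add: xdeg_def)
qed

lemma lookup_le_xdeg: "Poly_Mapping.lookup (snd a) i \<le> xdeg a"
  using count_le_size[of "expo_mset (snd a)" i] by (simp add: xdeg_def)

lemma expo_diff_add:
  fixes a b :: expo
  assumes "\<And>i. Poly_Mapping.lookup a i \<le> Poly_Mapping.lookup b i"
  shows "b - a + a = b"
  by (rule poly_mapping_eqI) (simp add: lookup_add lookup_minus assms)

text \<open>
  The pair \<open>(d, t\<^sup>\<alpha> x\<^sup>\<beta> e\<^sub>l)\<close> stands for the monomial made homogeneous of degree \<open>d\<close> in \<open>x\<close> by a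
  further variable, whose exponent is \<open>d - |\<beta>|\<close>; the conclusion is divisibility of such monomials.
  Monotone subsequences are taken in all exponents at once, and for the component \<open>l\<close> in both \<open>l\<close> and
  \<open>s - l\<close>, which forces equality. For constant \<open>d\<close> the cofactor does not involve \<open>x\<close>.
\<close>

lemma dickson_graded:
  fixes p :: "nat \<Rightarrow> modmon" and d :: "nat \<Rightarrow> nat"
  assumes p: "\<And>j. p j \<in> modMon m n s" and d: "\<And>j. xdeg (fst (p j)) \<le> d j"
  shows "\<exists>i j. i < j \<and> (\<exists>b\<in>Mon m n. p j = mon_act b (p i) \<and> xdeg b + d i \<le> d j)"
proof -
  define f :: "nat \<Rightarrow> (nat \<times> modmon \<Rightarrow> nat) \<Rightarrow> nat" where "f j \<phi> = \<phi> (d j, p j)" for j \<phi>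
  let ?A = "(\<lambda>i. \<lambda>x. Poly_Mapping.lookup (fst (fst (snd x))) i) ` {..<m}"
  let ?B = "(\<lambda>i. \<lambda>x. Poly_Mapping.lookup (snd (fst (snd x))) i) ` {..<n}"
  let ?C = "{\<lambda>x. snd (snd x), \<lambda>x. s - snd (snd x), \<lambda>x. fst x - xdeg (fst (snd x))}"
  obtain h :: "nat \<Rightarrow> nat" where h: "strict_mono h" "\<And>\<phi>. \<phi> \<in> ?A \<union> ?B \<union> ?C \<Longrightarrow> mono (\<lambda>j. f (h j) \<phi>)"
    using simultaneous_mono_subsequence[of "?A \<union> ?B \<union> ?C" f] by auto
  let ?i = "h 0" and ?j = "h 1"
  have ij: "?i < ?j" using h(1) by (simp add: strict_mono_def)
  have le: "f ?i \<phi> \<le> f ?j \<phi>" if "\<phi> \<in> ?A \<union> ?B \<union> ?C" for \<phi>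
    using h(2)[OF that] by (simp add: mono_def)
  have keys: "Poly_Mapping.keys (fst (fst (p j))) \<subseteq> {..<m}" "Poly_Mapping.keys (snd (fst (p j))) \<subseteq> {..<n}"
      "snd (p j) < s" for j
    using p[of j] by (auto simp: modMon_def Mon_def)
  define b where "b = fst (p ?j) - fst (p ?i)"
  have 1: "Poly_Mapping.lookup (fst (fst (p ?i))) x \<le> Poly_Mapping.lookup (fst (fst (p ?j))) x" for x
  proof (cases "x < m")
    case True
    then show ?thesis using le[of "\<lambda>y. Poly_Mapping.lookup (fst (fst (snd y))) x"] by (simp add: f_def)
  next
    case False
    then have "x \<notin> Poly_Mapping.keys (fst (fst (p ?i)))" using keys(1)[of ?i] by auto
    then show ?thesis by (simp add: in_keys_iff)
  qed
  have 2: "Poly_Mapping.lookup (snd (fst (p ?i))) x \<le> Poly_Mapping.lookup (snd (fst (p ?j))) x" for x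
  proof (cases "x < n")
    case True
    then show ?thesis using le[of "\<lambda>y. Poly_Mapping.lookup (snd (fst (snd y))) x"] by (simp add: f_def)
  next
    case False
    then have "x \<notin> Poly_Mapping.keys (snd (fst (p ?i)))" using keys(2)[of ?i] by auto
    then show ?thesis by (simp add: in_keys_iff)
  qed
  have b: "b + fst (p ?i) = fst (p ?j)"
    using expo_diff_add[OF 1] expo_diff_add[OF 2] by (simp add: b_def prod_eq_iff)
  have "snd (p ?i) = snd (p ?j)"
    using le[of "\<lambda>x. snd (snd x)"] le[of "\<lambda>x. s - snd (snd x)"] keys(3)[of ?i] keys(3)[of ?j]
    by (simp add: f_def)
  then have pj: "p ?j = mon_act b (p ?i)"
    using b by (simp add: prod_eq_iff)
  moreover have "b \<in> Mon m n"
    using p[of ?j] unfolding pj by simp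
  moreover have "xdeg b + d ?i \<le> d ?j"
    using le[of "\<lambda>x. fst x - xdeg (fst (snd x))"] d[of ?i] d[of ?j] arg_cong[OF b, of xdeg]
    by (simp add: f_def)
  ultimately show ?thesis using ij by blast
qed

lemma finite_bounded_expo:
  "finite {\<beta> :: expo. Poly_Mapping.keys \<beta> \<subseteq> {..<n} \<and> (\<forall>i. Poly_Mapping.lookup \<beta> i \<le> D)}"
proof -
  define c :: expo where "c = (\<Sum>i<n. Poly_Mapping.single i D)"
  have c: "Poly_Mapping.lookup c i = D" if "i < n" for i
    using that by (simp add: c_def lookup_sum lookup_single when_def)
  have "Poly_Mapping.lookup \<beta> i \<le> Poly_Mapping.lookup c i"
    if "Poly_Mapping.keys \<beta> \<subseteq> {..<n}" "\<forall>i. Poly_Mapping.lookup \<beta> i \<le> D" for \<beta> :: expo and i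
  proof (cases "i < n")
    case True
    then show ?thesis using that c by simp
  next
    case False
    then have "i \<notin> Poly_Mapping.keys \<beta>" using that by auto
    then show ?thesis by (simp add: in_keys_iff)
  qed
  then show ?thesis
    by (intro finite_subset[OF _ finite_expo_below[of c]]) auto
qed

definition xbounded :: "nat \<Rightarrow> (nat \<Rightarrow> 'k::comm_ring_1 rx) \<Rightarrow> bool" where
  "xbounded D v \<longleftrightarrow> (\<forall>p\<in>vsupp v. xdeg (fst p) \<le> D)"

lemma supp_xdeg_bounded: "\<exists>D. \<forall>a\<in>supp f. xdeg a \<le> D"
proof -
  let ?X = "(\<lambda>\<beta>. xdeg (0, \<beta>)) ` Poly_Mapping.keys f"
  have "xdeg a \<le> Max ?X" if "a \<in> supp f" for a
  proof -
    have "snd a \<in> Poly_Mapping.keys f"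
      using that by (auto simp: supp_def mcoeff_def in_keys_iff zero_mps.rep_eq)
    then have "xdeg (0, snd a) \<le> Max ?X" by (intro Max_ge) auto
    then show ?thesis by (simp add: xdeg_def)
  qed
  then show ?thesis by blast
qed

lemma xbounded_minus: "xbounded D v \<Longrightarrow> xbounded D w \<Longrightarrow> xbounded D (\<lambda>l. v l - w l)"
  using vsupp_minus[of v w] by (auto simp: xbounded_def)

lemma xbounded_sum: "(\<And>i. i \<in> A \<Longrightarrow> xbounded D (v i)) \<Longrightarrow> xbounded D (\<lambda>l. \<Sum>i\<in>A. v i l)"
  using vsupp_sum[of v A] by (fastforce simp: xbounded_def)

lemma xbounded_free_mod:
  assumes "v \<in> free_mod s (RX m n)"
  shows "\<exists>D. xbounded D v"
proof -
  have "\<forall>i. \<exists>D. \<forall>a\<in>supp (v i). xdeg a \<le> D" using supp_xdeg_bounded by blast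
  then obtain D where D: "\<And>i a. a \<in> supp (v i) \<Longrightarrow> xdeg a \<le> D i" by metis
  have "xdeg (fst p) \<le> (\<Sum>i<s. D i)" if p: "p \<in> vsupp v" for p
  proof -
    have "snd p < s" using vsupp_free_mod[OF assms] p by (auto simp: modMon_def)
    then have "D (snd p) \<le> (\<Sum>i<s. D i)" by (intro member_le_sum) auto
    then show ?thesis using D p by (fastforce simp: mem_vsupp')
  qed
  then show ?thesis unfolding xbounded_def by blast
qed

section \<open>Leading monomials\<close>

definition is_lead :: "('a \<Rightarrow> 'a \<Rightarrow> bool) \<Rightarrow> 'a set \<Rightarrow> 'a \<Rightarrow> bool" where
  "is_lead gt A p \<longleftrightarrow> p \<in> A \<and> (\<forall>q\<in>A. q \<noteq> p \<longrightarrow> gt p q)"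

lemma is_lead_unique:
  assumes "strict_total_ordering_on C gt" "A \<subseteq> C" "is_lead gt A p" "is_lead gt A q"
  shows "p = q"
proof (rule ccontr)
  assume "p \<noteq> q"
  then have "gt p q" "gt q p" "p \<in> C" "q \<in> C"
    using assms by (auto simp: is_lead_def)
  then show False
    using assms(1) unfolding strict_total_ordering_on_def transp_on_def irreflp_on_def by blast
qed

lemma max_mon_eq:
  assumes "strict_total_ordering_on C gt" "A \<subseteq> C" "is_lead gt A p"
  shows "max_mon gt A = Some p"
proof -
  have "(THE p. is_lead gt A p) = p"
    using assms by (blast intro: is_lead_unique)
  moreover have "A \<noteq> {}" using assms by (auto simp: is_lead_def)
  ultimately show ?thesis by (simp add: max_mon_def is_lead_def)
qed

lemma ex_lead:
  assumes o: "strict_total_ordering_on C gt" and AC: "A \<subseteq> C" and ne: "A \<noteq> {}"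
    and wf: "wf {(p, q). p \<in> A \<and> q \<in> A \<and> gt p q}"
  shows "\<exists>p. is_lead gt A p"
proof -
  obtain p where p: "p \<in> A" "\<And>q. (q, p) \<in> {(p, q). p \<in> A \<and> q \<in> A \<and> gt p q} \<Longrightarrow> q \<notin> A"
    using wfE_min'[OF wf ne] by blast
  then have "is_lead gt A p"
    using o AC unfolding is_lead_def strict_total_ordering_on_def totalp_on_def by blast
  then show ?thesis ..
qed

locale monomial_order =
  fixes m n :: nat and gt :: "mon \<Rightarrow> mon \<Rightarrow> bool"
  assumes monord: "monomial_ordering m n gt" and t_local: "t_local m gt"
begin

lemma gt_total_ordering: "strict_total_ordering_on (Mon m n) gt"
  using monord by (simp add: monomial_ordering_def)

lemma gt_irrefl: "a \<in> Mon m n \<Longrightarrow> \<not> gt a a"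
  using gt_total_ordering by (auto simp: strict_total_ordering_on_def irreflp_on_def)

lemma gt_trans: "gt a b \<Longrightarrow> gt b c \<Longrightarrow> a \<in> Mon m n \<Longrightarrow> b \<in> Mon m n \<Longrightarrow> c \<in> Mon m n \<Longrightarrow> gt a c"
  using gt_total_ordering unfolding strict_total_ordering_on_def transp_on_def by blast

lemma gt_cases: "a \<in> Mon m n \<Longrightarrow> b \<in> Mon m n \<Longrightarrow> gt a b \<or> a = b \<or> gt b a"
  using gt_total_ordering unfolding strict_total_ordering_on_def totalp_on_def by blast

lemma gt_add: "gt a b \<Longrightarrow> a \<in> Mon m n \<Longrightarrow> b \<in> Mon m n \<Longrightarrow> c \<in> Mon m n \<Longrightarrow> gt (c + a) (c + b)"
  using monord unfolding monomial_ordering_def by blast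

lemma gt_add_mono:
  assumes "a \<in> Mon m n" "b \<in> Mon m n" "c \<in> Mon m n" "d \<in> Mon m n" "gt a b" "gt c d \<or> c = d"
  shows "gt (a + c) (b + d)"
proof -
  have "gt (c + a) (c + b)" using assms gt_add by blast
  moreover have "gt (b + c) (b + d) \<or> c = d" using assms gt_add by blast
  ultimately show ?thesis
    using gt_trans[of "a + c" "b + c" "b + d"] assms by (auto simp: add.commute)
qed

text \<open>
  Locality is required of the variables \<open>t\<^sub>i\<close> only; split off one variable at a time.
\<close>

lemma t_mon_less_1:
  assumes "(\<gamma>, 0) \<in> Mon m n" "\<gamma> \<noteq> 0"
  shows "gt 0 (\<gamma>, 0)"
  using assms
proof (induction "size (expo_mset \<gamma>)" arbitrary: \<gamma> rule: less_induct)
  case less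
  then obtain i where i: "i \<in> Poly_Mapping.keys \<gamma>" by (metis equals0I keys_eq_empty)
  then have "i < m" using less.prems by (auto simp: Mon_def)
  define e :: expo where "e = Poly_Mapping.single i 1"
  have \<gamma>: "\<gamma> - e + e = \<gamma>"
    using i by (intro expo_diff_add) (auto simp: e_def lookup_single when_def in_keys_iff)
  have e: "gt 0 (e, 0)" using t_local \<open>i < m\<close> by (simp add: t_local_def e_def)
  have "(\<gamma> - e + e, 0) \<in> Mon m n" using less.prems \<gamma> by simp
  then have M: "(\<gamma> - e, 0) \<in> Mon m n" "(e, 0) \<in> Mon m n"
    by (simp_all add: Mon_def keys_expo_add)
  show ?case
  proof (cases "\<gamma> - e = 0")
    case True
    then show ?thesis using \<gamma> e by simp
  next
    case False
    have "expo_mset \<gamma> = expo_mset (\<gamma> - e) + expo_mset e"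
      using \<gamma> expo_mset_add by metis
    moreover have "count (expo_mset e) i = 1" by (simp add: e_def)
    ultimately have "size (expo_mset (\<gamma> - e)) < size (expo_mset \<gamma>)"
      by (metis add.right_neutral count_empty nat_add_left_cancel_less nonempty_has_size size_union zero_neq_one)
    then have "gt 0 (\<gamma> - e, 0)" using less.hyps M False by blast
    then have "gt (0 + 0) ((\<gamma> - e, 0) + (e, 0))"
      by (intro gt_add_mono) (use M e in auto)
    then show ?thesis using \<gamma> by simp
  qed
qed

end

locale modmon_order = monomial_order +
  fixes s :: nat and gtm :: "modmon \<Rightarrow> modmon \<Rightarrow> bool"
  assumes modord: "module_monomial_ordering m n s gt gtm"
begin

lemma gtm_total_ordering: "strict_total_ordering_on (modMon m n s) gtm"
  using modord by (simp add: module_monomial_ordering_def)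

lemma gtm_irrefl: "p \<in> modMon m n s \<Longrightarrow> \<not> gtm p p"
  using gtm_total_ordering by (auto simp: strict_total_ordering_on_def irreflp_on_def)

lemma gtm_trans:
  "gtm p q \<Longrightarrow> gtm q r \<Longrightarrow> p \<in> modMon m n s \<Longrightarrow> q \<in> modMon m n s \<Longrightarrow> r \<in> modMon m n s \<Longrightarrow> gtm p r"
  using gtm_total_ordering unfolding strict_total_ordering_on_def transp_on_def by blast

lemma gtm_cases: "p \<in> modMon m n s \<Longrightarrow> q \<in> modMon m n s \<Longrightarrow> gtm p q \<or> p = q \<or> gtm q p"
  using gtm_total_ordering unfolding strict_total_ordering_on_def totalp_on_def by blast

lemma gtm_act:
  "gtm p q \<Longrightarrow> p \<in> modMon m n s \<Longrightarrow> q \<in> modMon m n s \<Longrightarrow> a \<in> Mon m n \<Longrightarrow> gtm (mon_act a p) (mon_act a q)"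
  using modord unfolding module_monomial_ordering_def by blast

lemma gt_imp_gtm_act:
  assumes "gt a b" "a \<in> Mon m n" "b \<in> Mon m n" "p \<in> modMon m n s"
  shows "gtm (mon_act a p) (mon_act b p)"
proof -
  obtain c i where p: "p = (c, i)" by (cases p)
  have c: "c \<in> Mon m n" "i < s" using assms(4) by (auto simp: p modMon_def)
  then have "gt (a + c) (b + c)" using gt_add[of a b c] assms by (simp add: add.commute)
  moreover have "a + c \<in> Mon m n" "b + c \<in> Mon m n" using c assms by simp_all
  ultimately show ?thesis
    using modord \<open>i < s\<close> unfolding module_monomial_ordering_def p mon_act_pair by blast
qed

lemma gtm_act_mono:
  assumes "gt a b \<or> a = b" "gtm p q \<or> p = q" "a \<in> Mon m n" "b \<in> Mon m n" "p \<in> modMon m n s" "q \<in> modMon m n s"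
  shows "gtm (mon_act a p) (mon_act b q) \<or> a = b \<and> p = q"
proof -
  have "gtm (mon_act a p) (mon_act b p) \<or> a = b" using assms gt_imp_gtm_act by blast
  moreover have "gtm (mon_act b p) (mon_act b q) \<or> p = q" using assms gtm_act by blast
  ultimately show ?thesis
    using gtm_trans[of "mon_act a p" "mon_act b p" "mon_act b q"] assms by auto
qed

text \<open>
  By Dickson's lemma an ascending sequence of monomials of bounded degree in \<open>x\<close> would contain a
  monomial followed by one of its multiples by some \<open>t\<^sup>\<gamma>\<close>, but such a multiple is not larger. So every
  non-empty set of such monomials has a largest element, and recursion from larger to smaller monomials is
  possible.
\<close>

lemma wf_xbounded:
  "wf {(p, q). p \<in> modMon m n s \<and> q \<in> modMon m n s \<and> xdeg (fst p) \<le> D \<and> xdeg (fst q) \<le> D \<and> gtm p q}"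
    (is "wf ?R")
  unfolding wf_iff_no_infinite_down_chain
proof
  assume "\<exists>p. \<forall>j. (p (Suc j), p j) \<in> ?R"
  then obtain p where p: "\<And>j. (p (Suc j), p j) \<in> ?R" by blast
  then have M: "p j \<in> modMon m n s" "xdeg (fst (p j)) \<le> D" for j by auto
  have inc: "gtm (p j) (p i)" if "i < j" for i j
    using that
  proof (induction j)
    case (Suc j)
    have "gtm (p (Suc j)) (p j)" using p by auto
    then show ?case
      using Suc M gtm_trans[of "p (Suc j)" "p j" "p i"] by (cases "i = j") auto
  qed simp
  obtain i j b where ij: "i < j" "b \<in> Mon m n" "p j = mon_act b (p i)" "xdeg b + D \<le> D"
    using dickson_graded[of p m n s "\<lambda>_. D"] M by blast
  then have "snd b = 0" by (simp add: xdeg_eq_0D)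
  then have "b = 0 \<or> gt 0 b"
    using t_mon_less_1[of "fst b"] ij(2) by (cases b) (auto simp: zero_prod_def)
  then have "p j = p i \<or> gtm (p i) (p j)"
    using gt_imp_gtm_act[of 0 b "p i"] ij M by auto
  then show False
    using inc[OF ij(1)] gtm_irrefl[of "p i"] gtm_trans[of "p i" "p j" "p i"] M by auto
qed

lemma vector_ex_lead:
  assumes v: "v \<in> free_mod s (RX m n)" and nz: "v \<noteq> (\<lambda>_. 0)"
  shows "\<exists>p. is_lead gtm (vsupp v) p"
proof (rule ex_lead[OF gtm_total_ordering])
  show M: "vsupp v \<subseteq> modMon m n s" using v by (rule vsupp_free_mod)
  show "vsupp v \<noteq> {}" using nz by simp
  obtain D where "xbounded D v" using xbounded_free_mod[OF v] by blast
  then show "wf {(p, q). p \<in> vsupp v \<and> q \<in> vsupp v \<and> gtm p q}"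
    using M by (intro wf_subset[OF wf_xbounded[of D]]) (auto simp: xbounded_def)
qed

lemma lead_in_modMon: "v \<in> free_mod s (RX m n) \<Longrightarrow> is_lead gtm (vsupp v) p \<Longrightarrow> p \<in> modMon m n s"
  using vsupp_free_mod[of v s m n] unfolding is_lead_def by blast

lemma scale_upper_bound:
  assumes "u \<in> RX m n" "\<And>b. b \<in> supp u \<Longrightarrow> gt a b \<or> a = b" "a \<in> Mon m n"
    "v \<in> free_mod s (RX m n)" "\<And>q. q \<in> vsupp v \<Longrightarrow> gtm p q \<or> p = q" "p \<in> modMon m n s"
    "q \<in> vsupp (\<lambda>l. u * v l)"
  shows "gtm (mon_act a p) q \<or> mon_act a p = q"
proof -
  obtain b q' where b: "b \<in> supp u" "q' \<in> vsupp v" "q = mon_act b q'"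
    using assms(7) by (rule vsupp_scale)
  then have "b \<in> Mon m n" "q' \<in> modMon m n s"
    using assms(1) vsupp_free_mod[OF assms(4)] by (auto simp: RX_def)
  then show ?thesis
    using gtm_act_mono[of a b p q'] assms(2)[OF b(1)] assms(5)[OF b(2)] assms b(3) by auto
qed

lemma mcoeff_scale_lead:
  assumes "u \<in> RX m n" "\<And>b. b \<in> supp u \<Longrightarrow> gt a b \<or> a = b" "a \<in> Mon m n"
    "v \<in> free_mod s (RX m n)" "\<And>q. q \<in> vsupp v \<Longrightarrow> gtm p q \<or> p = q" "p \<in> modMon m n s"
  shows "mcoeff (u * v (snd p)) (a + fst p) = mcoeff u a * mcoeff (v (snd p)) (fst p)"
proof (rule mcoeff_mult_unique_split)
  fix c d assume c: "c \<in> supp u" and d: "d \<in> supp (v (snd p))" and cd: "c + d = a + fst p"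
  then have q: "(d, snd p) \<in> vsupp v" by (simp add: mem_vsupp)
  then have M: "(d, snd p) \<in> modMon m n s" "c \<in> Mon m n"
    using c assms(1) vsupp_free_mod[OF assms(4)] by (auto simp: RX_def)
  have e: "mon_act a p = mon_act c (d, snd p)" using cd by (simp add: mon_act_def)
  have "gtm (mon_act a p) (mon_act c (d, snd p)) \<or> a = c \<and> p = (d, snd p)"
    using gtm_act_mono[of a c p "(d, snd p)"] assms(2)[OF c] assms(5)[OF q] assms M by auto
  then show "c = a"
    using gtm_irrefl[of "mon_act a p"] e assms(3,6) by (metis modMon_mon_act)
qed

text \<open>
  The extreme term of the product comes from the two leading terms only, and it survives because
  \<open>K\<close> has no zero divisors.
\<close>

lemma lead_scale:
  fixes u :: "'k::idom rx"
  assumes u: "u \<in> RX m n" "is_lead gt (supp u) a" and v: "v \<in> free_mod s (RX m n)" "is_lead gtm (vsupp v) p"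
  shows "is_lead gtm (vsupp (\<lambda>l. u * v l)) (mon_act a p)"
    and "mcoeff (u * v (snd p)) (a + fst p) = mcoeff u a * mcoeff (v (snd p)) (fst p)"
proof -
  have a: "a \<in> Mon m n" "\<And>b. b \<in> supp u \<Longrightarrow> gt a b \<or> a = b" "mcoeff u a \<noteq> 0"
    using u by (auto simp: is_lead_def RX_def supp_def)
  have p: "p \<in> modMon m n s" "\<And>q. q \<in> vsupp v \<Longrightarrow> gtm p q \<or> p = q" "mcoeff (v (snd p)) (fst p) \<noteq> 0"
    using v lead_in_modMon[OF v] by (auto simp: is_lead_def vsupp_def)
  show c: "mcoeff (u * v (snd p)) (a + fst p) = mcoeff u a * mcoeff (v (snd p)) (fst p)"
    by (rule mcoeff_scale_lead) (use u v a p in auto)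
  then have "mon_act a p \<in> vsupp (\<lambda>l. u * v l)"
    using a p by (simp add: mem_vsupp' supp_def)
  then show "is_lead gtm (vsupp (\<lambda>l. u * v l)) (mon_act a p)"
    unfolding is_lead_def using scale_upper_bound[OF u(1) a(2,1) v(1) p(2,1)] by blast
qed

end

context monomial_order
begin

text \<open>
  Ring elements are vectors with one entry, so that the results on vectors apply to them.
\<close>

lemma ring_modmon_order: "modmon_order m n gt 1 (\<lambda>p q. gt (fst p) (fst q))"
proof
  have "strict_total_ordering_on (modMon m n 1) (\<lambda>p q. gt (fst p) (fst q))"
    unfolding strict_total_ordering_on_def
  proof (intro conjI)
    show "irreflp_on (modMon m n 1) (\<lambda>p q. gt (fst p) (fst q))"
      using gt_irrefl by (auto simp: irreflp_on_def modMon_def)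
    show "transp_on (modMon m n 1) (\<lambda>p q. gt (fst p) (fst q))"
      by (rule transp_onI) (use gt_trans in \<open>auto simp: modMon_def mem_Times_iff\<close>)
    show "totalp_on (modMon m n 1) (\<lambda>p q. gt (fst p) (fst q))"
      using gt_cases by (force simp: totalp_on_def modMon_def)
  qed
  then show "module_monomial_ordering m n 1 gt (\<lambda>p q. gt (fst p) (fst q))"
    using monord gt_add by (auto simp: module_monomial_ordering_def modMon_def)
qed

lemma ring_ex_lead:
  fixes f :: "'k::comm_ring_1 rx"
  assumes "f \<in> RX m n" "f \<noteq> 0"
  shows "\<exists>a. is_lead gt (supp f) a"
proof -
  interpret ring: modmon_order m n gt 1 "\<lambda>p q. gt (fst p) (fst q)" by (rule ring_modmon_order)
  let ?v = "\<lambda>i. if i = (0::nat) then f else 0"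
  have "?v \<in> free_mod 1 (RX m n)" "?v \<noteq> (\<lambda>_. 0)" using assms by (auto simp: free_mod_def fun_eq_iff)
  then obtain p where p: "is_lead (\<lambda>p q. gt (fst p) (fst q)) (vsupp ?v) p"
    using ring.vector_ex_lead by blast
  have "vsupp ?v = supp f \<times> {0}" by (auto simp: vsupp_def supp_def split: if_splits)
  then have "is_lead gt (supp f) (fst p)" using p by (auto simp: is_lead_def)
  then show ?thesis ..
qed

lemma ring_lead_mult:
  fixes f g :: "'k::idom rx"
  assumes "f \<in> RX m n" "is_lead gt (supp f) a" "g \<in> RX m n" "is_lead gt (supp g) b"
  shows "is_lead gt (supp (f * g)) (a + b)" and "mcoeff (f * g) (a + b) = mcoeff f a * mcoeff g b"
proof -
  interpret ring: modmon_order m n gt 1 "\<lambda>p q. gt (fst p) (fst q)" by (rule ring_modmon_order)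
  let ?v = "\<lambda>h::'k rx. \<lambda>i. if i = (0::nat) then h else 0"
  have vs: "vsupp (?v h) = supp h \<times> {0}" for h by (auto simp: vsupp_def supp_def split: if_splits)
  have v: "?v g \<in> free_mod 1 (RX m n)" using assms by (auto simp: free_mod_def)
  have l: "is_lead (\<lambda>p q. gt (fst p) (fst q)) (vsupp (?v g)) (b, 0)"
    using assms unfolding vs by (auto simp: is_lead_def)
  have e: "(\<lambda>l. f * ?v g l) = ?v (f * g)" by auto
  show "is_lead gt (supp (f * g)) (a + b)"
    using ring.lead_scale(1)[OF assms(1,2) v l] unfolding e vs by (auto simp: is_lead_def)
  show "mcoeff (f * g) (a + b) = mcoeff f a * mcoeff g b"
    using ring.lead_scale(2)[OF assms(1,2) v l] by simp
qed

lemma S_gt_iff: "u \<in> S_gt m n gt \<longleftrightarrow> u \<in> RX m n \<and> mcoeff u 0 = 1 \<and> is_lead gt (supp u) 0"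
proof (cases "u \<in> RX m n")
  case True
  note u = this
  show ?thesis
  proof (cases "u = 0")
    case True
    then show ?thesis
      using mcoeff_one[of 0, where 'a = 'a] by (auto simp: S_gt_def ring_lt_def ring_lm_def max_mon_def is_lead_def)
  next
    case False
    then obtain a where a: "is_lead gt (supp u) a" using ring_ex_lead u by blast
    have sub: "supp u \<subseteq> Mon m n" using u by (simp add: RX_def)
    have "ring_lt gt u = mterm (mcoeff u a) a"
      using max_mon_eq[OF gt_total_ordering sub a] by (simp add: ring_lt_def ring_lm_def)
    moreover have "mterm c a = 1 \<longleftrightarrow> c = 1 \<and> a = 0" for c :: 'a
    proof
      assume "mterm c a = 1"
      then have "mcoeff (mterm c a) 0 = 1" by (simp add: mcoeff_one)
      then show "c = 1 \<and> a = 0" by (simp add: mcoeff_mterm split: if_splits)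
    qed simp
    ultimately have "ring_lt gt u = 1 \<longleftrightarrow> mcoeff u a = 1 \<and> a = 0" by simp
    also have "\<dots> \<longleftrightarrow> mcoeff u 0 = 1 \<and> is_lead gt (supp u) 0"
      using is_lead_unique[OF gt_total_ordering sub a, of 0] a by auto
    finally show ?thesis using u by (simp add: S_gt_def)
  qed
qed (simp add: S_gt_def)

end

section \<open>Division in bounded degree in \<open>x\<close>\<close>

context modmon_order
begin

text \<open>
  Here \<open>K p' p\<close> will be the coefficient at \<open>p\<close> of the multiple of a divisor that has leading monomial
  \<open>p'\<close>. The system is triangular with respect to the ordering, which is well-founded in bounded
  degree, and each equation is finite, so that it can be solved from the largest monomial downwards.
  The last clause says that nothing is subtracted above the monomials that have to be removed.
\<close>

lemma triangular_system:
  fixes K :: "modmon \<Rightarrow> modmon \<Rightarrow> 'k::field"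
  assumes L: "L \<subseteq> {p \<in> modMon m n s. xdeg (fst p) \<le> D}"
    and Y: "\<And>p. p \<in> L \<Longrightarrow> finite (Y p) \<and> Y p \<subseteq> L \<and> p \<in> Y p"
    and K: "\<And>p p'. p \<in> L \<Longrightarrow> p' \<in> Y p \<Longrightarrow> K p' p \<noteq> 0 \<Longrightarrow> p' = p \<or> gtm p' p"
    and diag: "\<And>p. p \<in> L \<Longrightarrow> K p p \<noteq> 0"
  shows "\<exists>c. (\<forall>p\<in>L. (\<Sum>p'\<in>Y p. c p' * K p' p) = y p) \<and>
    (\<forall>p\<in>L. c p \<noteq> 0 \<longrightarrow> (\<exists>q\<in>L. y q \<noteq> 0 \<and> (q = p \<or> gtm q p)))"
proof -
  define W where "W = {(p, q). p \<in> modMon m n s \<and> q \<in> modMon m n s \<and> xdeg (fst p) \<le> D \<and> xdeg (fst q) \<le> D \<and> gtm p q}"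
  have wf_W: "wf W" unfolding W_def by (rule wf_xbounded)
  let ?P = "\<lambda>f p x. if p \<in> L
      then (\<Sum>p'\<in>Y p - {p}. if (p', p) \<in> W then f p' * K p' p else 0) + x * K p p = y p else x = 0"
  have "\<exists>f. \<forall>p. ?P f p (f p)"
  proof (rule dependent_wf_choice[OF wf_W])
    fix f g :: "modmon \<Rightarrow> 'k" and p x
    assume eq: "\<And>z. (z, p) \<in> W \<Longrightarrow> f z = g z"
    have "(\<Sum>p'\<in>Y p - {p}. if (p', p) \<in> W then f p' * K p' p else 0) =
        (\<Sum>p'\<in>Y p - {p}. if (p', p) \<in> W then g p' * K p' p else 0)"
      by (rule sum.cong[OF refl], rule if_cong[OF refl]) (simp only: eq, rule refl)
    then show "?P f p x = ?P g p x" by simp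
  next
    fix p f
    show "\<exists>x. ?P f p x"
    proof (cases "p \<in> L")
      case True
      let ?S = "\<Sum>p'\<in>Y p - {p}. if (p', p) \<in> W then f p' * K p' p else 0"
      have "?S + (y p - ?S) / K p p * K p p = y p" using diag[OF True] by simp
      then show ?thesis using True by (intro exI[of _ "(y p - ?S) / K p p"]) simp
    qed simp
  qed
  then obtain c where c: "\<And>p. ?P c p (c p)" by blast
  have split: "(\<Sum>p'\<in>Y p. c p' * K p' p) = (\<Sum>p'\<in>Y p - {p}. c p' * K p' p) + c p * K p p" if "p \<in> L" for p
    using Y[OF that] by (subst sum.remove[of "Y p" p]) (auto simp: add.commute)
  have pred: "(p', p) \<in> W" if "p \<in> L" "p' \<in> Y p - {p}" "K p' p \<noteq> 0" for p p'
    using that K[of p p'] Y[of p] L unfolding W_def by blast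
  have eq: "(\<Sum>p'\<in>Y p. c p' * K p' p) = y p" if "p \<in> L" for p
  proof -
    have "(\<Sum>p'\<in>Y p - {p}. if (p', p) \<in> W then c p' * K p' p else 0) = (\<Sum>p'\<in>Y p - {p}. c p' * K p' p)"
      by (rule sum.cong[OF refl]) (use pred[OF that] in auto)
    then show ?thesis using c[of p] that by (simp add: split)
  qed
  have "p \<in> L \<Longrightarrow> c p \<noteq> 0 \<Longrightarrow> \<exists>q\<in>L. y q \<noteq> 0 \<and> (q = p \<or> gtm q p)" for p
  proof (induction p rule: wf_induct_rule[OF wf_W])
    case (1 p)
    show ?case
    proof (cases "\<exists>p'\<in>Y p - {p}. c p' * K p' p \<noteq> 0")
      case True
      then obtain p' where p': "p' \<in> Y p - {p}" "c p' \<noteq> 0" "K p' p \<noteq> 0" by auto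
      have W: "(p', p) \<in> W" using pred[OF 1(2) p'(1,3)] .
      have "p' \<in> L" using p'(1) Y[OF 1(2)] by blast
      then obtain q where q: "q \<in> L" "y q \<noteq> 0" "q = p' \<or> gtm q p'" using 1(1)[OF W] p'(2) by blast
      have "gtm q p" using q W L gtm_trans[of q p' p] unfolding W_def by blast
      then show ?thesis using q by blast
    next
      case False
      then have "(\<Sum>p'\<in>Y p - {p}. c p' * K p' p) = 0" by (intro sum.neutral) blast
      then have "y p \<noteq> 0" using eq[OF 1(2)] split[OF 1(2)] 1(3) diag[OF 1(2)] by auto
      then show ?thesis using 1(2) by blast
    qed
  qed
  then show ?thesis using eq by blast
qed

text \<open>
  All monomials of \<open>h\<close>, and not just the leading one, are reduced in a single step. For every
  monomial \<open>p\<close> that is divisible in bounded degree by some \<open>lm(\<tau>\<^sub>i)\<close>, one such \<open>i\<close> and the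
  cofactor \<open>\<beta>\<close> are fixed, and \<open>c p\<close> is the coefficient with which \<open>\<beta> \<tau>\<^sub>i\<close> is subtracted. For fixed
  \<open>i\<close> different \<open>p\<close> have different cofactors, so that \<open>c\<close> directly describes the coefficients of the
  multipliers \<open>A\<^sub>i\<close>.
\<close>

lemma bounded_division:
  fixes h :: "nat \<Rightarrow> 'k::field rx" and I :: "'i set"
  assumes I: "finite I"
    and \<tau>: "\<And>i. i \<in> I \<Longrightarrow> \<tau> i \<in> free_mod s (RX m n)" "\<And>i. i \<in> I \<Longrightarrow> is_lead gtm (vsupp (\<tau> i)) (P i)"
      "\<And>i. i \<in> I \<Longrightarrow> xbounded (d i) (\<tau> i)"
  obtains A where "\<And>i. i \<in> I \<Longrightarrow> A i \<in> RX m n"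
    "\<And>i b. i \<in> I \<Longrightarrow> b \<in> supp (A i) \<Longrightarrow> xdeg b + d i \<le> D"
    "\<And>i b. i \<in> I \<Longrightarrow> b \<in> supp (A i) \<Longrightarrow> \<exists>p\<in>vsupp h. p = mon_act b (P i) \<or> gtm p (mon_act b (P i))"
    "\<And>i b p. i \<in> I \<Longrightarrow> b \<in> Mon m n \<Longrightarrow> xdeg b + d i \<le> D \<Longrightarrow>
       mon_act b (P i) \<notin> vsupp (\<lambda>l. h l - (\<Sum>i\<in>I. A i * \<tau> i l))"
proof -
  define L where "L = {p. \<exists>i\<in>I. \<exists>b\<in>Mon m n. p = mon_act b (P i) \<and> xdeg b + d i \<le> D}"
  have "\<forall>p\<in>L. \<exists>x. fst x \<in> I \<and> snd x \<in> Mon m n \<and> p = mon_act (snd x) (P (fst x)) \<and> xdeg (snd x) + d (fst x) \<le> D"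
    unfolding L_def by auto
  from bchoice[OF this] obtain x where x: "\<forall>p\<in>L. fst (x p) \<in> I \<and> snd (x p) \<in> Mon m n \<and>
      p = mon_act (snd (x p)) (P (fst (x p))) \<and> xdeg (snd (x p)) + d (fst (x p)) \<le> D" ..
  define \<iota> where "\<iota> p = fst (x p)" for p
  define \<beta> where "\<beta> p = snd (x p)" for p
  have \<iota>: "\<iota> p \<in> I" and \<beta>: "\<beta> p \<in> Mon m n" and p_eq: "mon_act (\<beta> p) (P (\<iota> p)) = p"
    and dg: "xdeg (\<beta> p) + d (\<iota> p) \<le> D" if "p \<in> L" for p
    using bspec[OF x that] by (simp_all add: \<iota>_def \<beta>_def)
  have PM: "P i \<in> modMon m n s" if "i \<in> I" for i using lead_in_modMon[OF \<tau>(1,2)] that by blast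
  have Pd: "xdeg (fst (P i)) \<le> d i" if "i \<in> I" for i
    using \<tau>(2,3)[OF that] by (auto simp: is_lead_def xbounded_def)
  have L: "L \<subseteq> {p \<in> modMon m n s. xdeg (fst p) \<le> D}"
    unfolding L_def using PM Pd by (fastforce)
  define Y where "Y p = {p'\<in>L. \<exists>e. \<beta> p' + e = fst p}" for p :: modmon
  define K where "K p' p = mcoeff (\<tau> (\<iota> p') (snd p)) (fst p - \<beta> p')" for p' p :: modmon
  have K_eq: "K p' p = mcoeff (\<tau> (\<iota> p') (snd p)) e" if "\<beta> p' + e = fst p" for p' p e
    using that[symmetric] by (simp add: K_def)
  have fY: "finite (Y p)" for p
  proof (rule finite_imageD[OF finite_subset])
    show "x ` Y p \<subseteq> I \<times> fst ` msplits (fst p)"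
    proof
      fix z assume "z \<in> x ` Y p"
      then obtain p' e where p': "p' \<in> L" "z = x p'" "\<beta> p' + e = fst p" by (auto simp: Y_def)
      then have "(\<beta> p', e) \<in> msplits (fst p)" by (simp add: mem_msplits)
      then have "\<beta> p' \<in> fst ` msplits (fst p)" by force
      then show "z \<in> I \<times> fst ` msplits (fst p)"
        using \<iota>[OF p'(1)] p'(2) by (simp add: \<iota>_def \<beta>_def mem_Times_iff)
    qed
    show "finite (I \<times> fst ` msplits (fst p))" using I by simp
    show "inj_on x (Y p)"
    proof (rule inj_onI)
      fix p1 p2 assume a: "p1 \<in> Y p" "p2 \<in> Y p" "x p1 = x p2"
      then have "p1 \<in> L" "p2 \<in> L" by (simp_all add: Y_def)
      then show "p1 = p2" using p_eq[of p1] p_eq[of p2] a(3) by (simp add: \<iota>_def \<beta>_def)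
    qed
  qed
  have diag: "K p p \<noteq> 0" "p \<in> Y p" if "p \<in> L" for p
  proof -
    have e: "\<beta> p + fst (P (\<iota> p)) = fst p" "snd (P (\<iota> p)) = snd p"
      using p_eq[OF that] by (metis fst_mon_act, metis snd_mon_act)
    then show "p \<in> Y p" using that unfolding Y_def by blast
    show "K p p \<noteq> 0" unfolding K_eq[OF e(1)]
      using \<tau>(2)[OF \<iota>[OF that]] e(2) by (auto simp: is_lead_def mem_vsupp' supp_def)
  qed
  have tri: "p' = p \<or> gtm p' p" if "p \<in> L" "p' \<in> Y p" "K p' p \<noteq> 0" for p p'
  proof -
    from that(2) obtain e where e: "\<beta> p' + e = fst p" and L': "p' \<in> L" by (auto simp: Y_def)
    have v: "(e, snd p) \<in> vsupp (\<tau> (\<iota> p'))" using that(3) by (simp add: K_eq[OF e] mem_vsupp supp_def)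
    then have "(e, snd p) \<in> modMon m n s" using vsupp_free_mod[OF \<tau>(1)[OF \<iota>[OF L']]] by blast
    moreover have "P (\<iota> p') = (e, snd p) \<or> gtm (P (\<iota> p')) (e, snd p)"
      using \<tau>(2)[OF \<iota>[OF L']] v by (auto simp: is_lead_def)
    moreover have "mon_act (\<beta> p') (e, snd p) = p" using e by (simp add: prod_eq_iff)
    ultimately show ?thesis
      using gtm_act[of "P (\<iota> p')" "(e, snd p)" "\<beta> p'"] p_eq[OF L'] PM[OF \<iota>[OF L']] \<beta>[OF L'] by metis
  qed
  have Y: "finite (Y p) \<and> Y p \<subseteq> L \<and> p \<in> Y p" if "p \<in> L" for p
    using fY diag(2)[OF that] by (auto simp: Y_def)
  have "\<exists>c. (\<forall>p\<in>L. (\<Sum>p'\<in>Y p. c p' * K p' p) = mcoeff (h (snd p)) (fst p)) \<and>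
      (\<forall>p\<in>L. c p \<noteq> 0 \<longrightarrow> (\<exists>q\<in>L. mcoeff (h (snd q)) (fst q) \<noteq> 0 \<and> (q = p \<or> gtm q p)))"
    by (rule triangular_system[OF L]) (fact Y tri diag(1))+
  then obtain c where c: "\<And>p. p \<in> L \<Longrightarrow> (\<Sum>p'\<in>Y p. c p' * K p' p) = mcoeff (h (snd p)) (fst p)"
      and cb: "\<And>p. p \<in> L \<Longrightarrow> c p \<noteq> 0 \<Longrightarrow> \<exists>q\<in>L. mcoeff (h (snd q)) (fst q) \<noteq> 0 \<and> (q = p \<or> gtm q p)"
    by blast
  \<comment> \<open>\<open>C i\<close> lists the coefficients of \<open>A\<^sub>i\<close>: the monomial \<open>b\<close> may occur in \<open>A\<^sub>i\<close> only if \<open>i\<close> is the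
    divisor fixed for the monomial \<open>b lm(\<tau>\<^sub>i)\<close>.\<close>
  define C where "C i b = (if mon_act b (P i) \<in> L \<and> \<iota> (mon_act b (P i)) = i then c (mon_act b (P i)) else 0)" for i b
  have C: "mon_act b (P i) \<in> L \<and> \<iota> (mon_act b (P i)) = i \<and> \<beta> (mon_act b (P i)) = b \<and> c (mon_act b (P i)) \<noteq> 0"
    if "C i b \<noteq> 0" for i b
  proof -
    have 1: "mon_act b (P i) \<in> L" "\<iota> (mon_act b (P i)) = i" "c (mon_act b (P i)) \<noteq> 0"
      using that by (auto simp: C_def split: if_splits)
    moreover have "\<beta> (mon_act b (P i)) = b" using p_eq[OF 1(1)] 1(2) by simp
    ultimately show ?thesis by blast
  qed
  have CM: "b \<in> Mon m n" "xdeg b + d i \<le> D" if "C i b \<noteq> 0" for i b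
    using C[OF that] \<beta>[of "mon_act b (P i)"] dg[of "mon_act b (P i)"] by auto
  have "\<exists>f. \<forall>a. mcoeff f a = C i a" for i
  proof (rule mcoeff_series, rule finite_subset[OF _ finite_bounded_expo[of n D]])
    show "{\<beta>. \<exists>\<alpha>. C i (\<alpha>, \<beta>) \<noteq> 0} \<subseteq> {\<beta>. Poly_Mapping.keys \<beta> \<subseteq> {..<n} \<and> (\<forall>i. Poly_Mapping.lookup \<beta> i \<le> D)}"
    proof clarify
      fix \<alpha> \<beta> assume "C i (\<alpha>, \<beta>) \<noteq> 0"
      from CM[OF this] show "Poly_Mapping.keys \<beta> \<subseteq> {..<n} \<and> (\<forall>i. Poly_Mapping.lookup \<beta> i \<le> D)"
        using lookup_le_xdeg[of "(\<alpha>, \<beta>)"]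
        by (auto simp: Mon_def) (meson add_leD1 order_trans)
    qed
  qed
  then obtain A where A: "\<And>i a. mcoeff (A i) a = C i a" by metis
  have supp_A: "b \<in> supp (A i) \<longleftrightarrow> C i b \<noteq> 0" for i b by (simp add: supp_def A)
  have sum_eq: "mcoeff (\<Sum>i\<in>I. A i * \<tau> i (snd p)) (fst p) = (\<Sum>p'\<in>Y p. c p' * K p' p)" for p
  proof -
    \<comment> \<open>A term \<open>b\<close> of \<open>A\<^sub>i\<close> times a term \<open>e\<close> of \<open>\<tau>\<^sub>i\<close> contributes to \<open>p\<close> if \<open>b e = p\<close>. The triples
      \<open>(i, b, e)\<close> with non-zero \<open>C i b\<close> are determined by the monomial \<open>b lm(\<tau>\<^sub>i)\<close>.\<close>
    let ?T = "\<lambda>(i, b, e). C i b * mcoeff (\<tau> i (snd p)) e"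
    let ?S = "{z \<in> I \<times> msplits (fst p). mon_act (fst (snd z)) (P (fst z)) \<in> L \<and> \<iota> (mon_act (fst (snd z)) (P (fst z))) = fst z}"
    have "mcoeff (\<Sum>i\<in>I. A i * \<tau> i (snd p)) (fst p) = (\<Sum>i\<in>I. \<Sum>(b, e)\<in>msplits (fst p). ?T (i, b, e))"
      by (simp add: mcoeff_sum mcoeff_mult A)
    also have "\<dots> = (\<Sum>z\<in>I \<times> msplits (fst p). ?T z)"
      by (simp add: sum.cartesian_product case_prod_unfold)
    also have "\<dots> = (\<Sum>z\<in>?S. ?T z)"
      by (rule sum.mono_neutral_right) (use I in \<open>auto simp: C_def split: if_splits\<close>)
    also have "\<dots> = (\<Sum>p'\<in>Y p. c p' * K p' p)"
    proof (rule sum.reindex_bij_witness[where i = "\<lambda>p'. (\<iota> p', \<beta> p', fst p - \<beta> p')"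
          and j = "\<lambda>z. mon_act (fst (snd z)) (P (fst z))"])
      fix z assume "z \<in> ?S"
      then obtain i b e where z: "z = (i, b, e)" "i \<in> I" "b + e = fst p" "mon_act b (P i) \<in> L"
          "\<iota> (mon_act b (P i)) = i" by (cases z) (auto simp: mem_msplits)
      then have bb: "\<beta> (mon_act b (P i)) = b" using p_eq[OF z(4)] by simp
      then show "(\<iota> (mon_act (fst (snd z)) (P (fst z))), \<beta> (mon_act (fst (snd z)) (P (fst z))),
          fst p - \<beta> (mon_act (fst (snd z)) (P (fst z)))) = z"
        using z(1,5) z(3)[symmetric] by simp
      show "mon_act (fst (snd z)) (P (fst z)) \<in> Y p" using z bb by (auto simp: Y_def simp del: split_paired_Ex)
      show "c (mon_act (fst (snd z)) (P (fst z))) * K (mon_act (fst (snd z)) (P (fst z))) p = ?T z"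
        using z bb K_eq[of "mon_act b (P i)" e p] by (simp add: C_def)
    next
      fix p' assume "p' \<in> Y p"
      then obtain e where e: "\<beta> p' + e = fst p" and L': "p' \<in> L" by (auto simp: Y_def)
      show "mon_act (fst (snd (\<iota> p', \<beta> p', fst p - \<beta> p'))) (P (fst (\<iota> p', \<beta> p', fst p - \<beta> p'))) = p'"
        using p_eq[OF L'] by simp
      have "fst p - \<beta> p' = e" using e[symmetric] by simp
      then show "(\<iota> p', \<beta> p', fst p - \<beta> p') \<in> ?S"
        using p_eq[OF L'] \<iota>[OF L'] L' e by (simp add: mem_msplits)
    qed
    finally show ?thesis .
  qed
  show thesis
  proof (rule that[of A])
    fix i b assume i: "i \<in> I"
    show "A i \<in> RX m n" unfolding RX_def using CM supp_A by blast
    assume b: "b \<in> supp (A i)"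
    then show "xdeg b + d i \<le> D" using CM supp_A by blast
    show "\<exists>p\<in>vsupp h. p = mon_act b (P i) \<or> gtm p (mon_act b (P i))"
    proof -
      have "C i b \<noteq> 0" using b supp_A by blast
      then have "mon_act b (P i) \<in> L" "c (mon_act b (P i)) \<noteq> 0" using C by blast+
      then obtain q where "mcoeff (h (snd q)) (fst q) \<noteq> 0" "q = mon_act b (P i) \<or> gtm q (mon_act b (P i))"
        using cb by blast
      then show ?thesis by (intro bexI[of _ q]) (auto simp: mem_vsupp' supp_def)
    qed
  next
    fix i b assume "i \<in> I" "b \<in> Mon m n" "xdeg b + d i \<le> D"
    then have "mon_act b (P i) \<in> L" by (auto simp: L_def)
    from c[OF this] sum_eq[of "mon_act b (P i)"]
    show "mon_act b (P i) \<notin> vsupp (\<lambda>l. h l - (\<Sum>i\<in>I. A i * \<tau> i l))"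
      by (simp add: mem_vsupp' supp_def)
  qed
qed

end

section \<open>Weak normal forms\<close>

context monomial_order
begin

lemma S_gt_one [simp]: "1 \<in> S_gt m n gt"
  unfolding S_gt_iff by (auto simp: mcoeff_one is_lead_def supp_def split: if_splits)

lemma S_gt_in_RX: "u \<in> S_gt m n gt \<Longrightarrow> u \<in> RX m n"
  by (simp add: S_gt_iff)

lemma S_gt_nonzero: "u \<in> S_gt m n gt \<Longrightarrow> u \<noteq> 0"
  by (auto simp: S_gt_iff)

lemma S_gt_mult:
  fixes u v :: "'k::idom rx"
  assumes "u \<in> S_gt m n gt" "v \<in> S_gt m n gt"
  shows "u * v \<in> S_gt m n gt"
  using assms ring_lead_mult[of u 0 v 0] by (auto simp: S_gt_iff RX_mult)

text \<open>
  The factor \<open>u\<close> keeps leading term \<open>1\<close> when reducing by earlier results, as the multipliers then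
  only involve monomials smaller than \<open>1\<close>.
\<close>

lemma S_gt_minus_smaller:
  assumes u: "u \<in> S_gt m n gt" and v: "v \<in> S_gt m n gt"
    and A: "A \<in> RX m n" "\<And>b. b \<in> supp A \<Longrightarrow> gt 0 b"
  shows "u - A * v \<in> S_gt m n gt"
proof -
  have "gt 0 b" if b: "b \<in> supp (A * v)" for b
  proof -
    obtain a c where a: "a \<in> supp A" "c \<in> supp v" "b = a + c" using supp_mult[OF b] by blast
    then have "gt 0 c \<or> 0 = c" "a \<in> Mon m n" "c \<in> Mon m n"
      using v A by (auto simp: S_gt_iff is_lead_def RX_def)
    then show ?thesis using gt_add_mono[of 0 a 0 c] A(2)[OF a(1)] a(3) by simp
  qed
  note small = this
  have "0 \<notin> supp (A * v)" using small[of 0] gt_irrefl[of 0] by auto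
  then have "mcoeff (A * v) 0 = 0" by (simp add: supp_def)
  then have c: "mcoeff (u - A * v) 0 = 1" using u by (simp add: S_gt_iff)
  moreover have "is_lead gt (supp (u - A * v)) 0"
    unfolding is_lead_def
  proof (intro conjI ballI impI)
    show "0 \<in> supp (u - A * v)" unfolding supp_def using c by (simp del: mcoeff_minus)
    fix b assume "b \<in> supp (u - A * v)" "b \<noteq> 0"
    then have "b \<in> supp u \<or> b \<in> supp (A * v)" using supp_minus by blast
    then show "gt 0 b" using small u \<open>b \<noteq> 0\<close> unfolding S_gt_iff is_lead_def by blast
  qed
  ultimately show ?thesis
    using u v A by (simp add: S_gt_iff RX_minus RX_mult)
qed

end

context modmon_order
begin

lemma lead_below_act_imp_less_1:
  assumes "gtm P q" "q = mon_act b P \<or> gtm q (mon_act b P)" "b \<in> Mon m n" "P \<in> modMon m n s" "q \<in> modMon m n s"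
  shows "gt 0 b"
proof (rule ccontr)
  assume "\<not> gt 0 b"
  then have "b = 0 \<or> gt b 0" using gt_cases[of 0 b] assms by auto
  then have "b = 0 \<or> gtm (mon_act b P) P" using gt_imp_gtm_act[of b 0 P] assms by auto
  moreover have "gtm P (mon_act b P)" using assms gtm_trans[of P q "mon_act b P"] by auto
  ultimately show False
    using gtm_irrefl[of P] gtm_trans[of P "mon_act b P" P] assms by auto
qed

text \<open>
  If the assertion fails, every vector \<open>R\<close> in the set \<open>E\<close> of those congruent to some \<open>u Q\<close> is
  non-zero and has the leading monomial of an element of \<open>N\<close>, and so it can be reduced further within
  \<open>E\<close>. Starting with \<open>Q\<close>, this yields an infinite sequence of pairs of a degree bound and a vector in
  \<open>E\<close>, in which each leading monomial is smaller than the earlier ones and, as a homogeneous monomial,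
  not divisible by them. The step is: subtract an element of \<open>N\<close> to make the leading monomial
  smaller, which may raise the degree by any amount, and divide the result by all earlier vectors in
  that new degree. This contradicts Dickson's lemma.
\<close>

theorem weak_normal_form:
  fixes N :: "(nat \<Rightarrow> 'k::field rx) set"
  assumes N0: "(\<lambda>_. 0) \<in> N"
    and N_minus: "\<And>v w. v \<in> N \<Longrightarrow> w \<in> N \<Longrightarrow> (\<lambda>l. v l - w l) \<in> N"
    and N_scale: "\<And>u v. u \<in> RX m n \<Longrightarrow> v \<in> N \<Longrightarrow> (\<lambda>l. u * v l) \<in> N"
    and N_free: "N \<subseteq> free_mod s (RX m n)"
    and Q: "Q \<in> free_mod s (RX m n)"
  shows "\<exists>u\<in>S_gt m n gt. \<exists>R\<in>free_mod s (RX m n). (\<lambda>l. u * Q l - R l) \<in> N \<and>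
    (R = (\<lambda>_. 0) \<or> (\<exists>p. is_lead gtm (vsupp R) p \<and> (\<forall>v\<in>N. \<not> is_lead gtm (vsupp v) p)))"
proof (rule ccontr)
  assume contra: "\<not> ?thesis"
  have contra': False if "u \<in> S_gt m n gt" "(\<lambda>l. u * Q l - R l) \<in> N" "R \<in> free_mod s (RX m n)"
      "R = (\<lambda>_. 0) \<or> (\<exists>p. is_lead gtm (vsupp R) p \<and> (\<forall>v\<in>N. \<not> is_lead gtm (vsupp v) p))" for u R
    by (rule notE[OF contra], intro bexI[of _ u] bexI[of _ R] conjI that)
  define E where "E = {R \<in> free_mod s (RX m n). \<exists>u\<in>S_gt m n gt. (\<lambda>l. u * Q l - R l) \<in> N}"
  have E_lead: "\<exists>v\<in>N. is_lead gtm (vsupp v) p" if "R \<in> E" "is_lead gtm (vsupp R) p" for R p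
    using contra' that unfolding E_def by blast
  have E_nz: "R \<noteq> (\<lambda>_. 0)" if "R \<in> E" for R
  proof
    assume R: "R = (\<lambda>_. 0)"
    from that obtain u where "u \<in> S_gt m n gt" "(\<lambda>l. u * Q l - R l) \<in> N" "R \<in> free_mod s (RX m n)"
      by (auto simp: E_def)
    then show False by (rule contra') (rule disjI1[OF R])
  qed
  have E_free: "R \<in> free_mod s (RX m n)" if "R \<in> E" for R using that by (simp add: E_def)
  have Q_E: "Q \<in> E" using Q N0 by (auto simp: E_def intro!: bexI[of _ 1])
  have E_minus_N: "(\<lambda>l. h l - v l) \<in> E" if h: "h \<in> E" and v: "v \<in> N" for h v
  proof -
    obtain u where u: "u \<in> S_gt m n gt" "(\<lambda>l. u * Q l - h l) \<in> N" using h by (auto simp: E_def)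
    have "(\<lambda>l. 0 - v l) \<in> N" using N_minus[OF N0 v] .
    from N_minus[OF u(2) this] have "(\<lambda>l. u * Q l - (h l - v l)) \<in> N" by (simp add: algebra_simps)
    then show ?thesis using u(1) h v N_free by (auto simp: E_def intro!: free_mod_minus)
  qed
  have E_minus: "(\<lambda>l. h l - A * r l) \<in> E"
    if h: "h \<in> E" and r: "r \<in> E" and A: "A \<in> RX m n" "\<And>b. b \<in> supp A \<Longrightarrow> gt 0 b" for h A r
  proof -
    obtain u where u: "u \<in> S_gt m n gt" "(\<lambda>l. u * Q l - h l) \<in> N" using h by (auto simp: E_def)
    obtain v where v: "v \<in> S_gt m n gt" "(\<lambda>l. v * Q l - r l) \<in> N" using r by (auto simp: E_def)
    from N_minus[OF u(2) N_scale[OF A(1) v(2)]]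
    have "(\<lambda>l. (u - A * v) * Q l - (h l - A * r l)) \<in> N" by (simp add: algebra_simps)
    moreover have "u - A * v \<in> S_gt m n gt" using S_gt_minus_smaller[OF u(1) v(1) A] .
    ultimately show ?thesis using h r A(1) by (auto simp: E_def intro!: free_mod_minus free_mod_scale)
  qed
  have E_minus_sum: "(\<lambda>l. h l - (\<Sum>i\<in>I. A i * r i l)) \<in> E"
    if "finite I" "h \<in> E" "\<And>i. i \<in> I \<Longrightarrow> r i \<in> E" "\<And>i. i \<in> I \<Longrightarrow> A i \<in> RX m n"
      "\<And>i b. i \<in> I \<Longrightarrow> b \<in> supp (A i) \<Longrightarrow> gt 0 b" for h A r and I :: "nat set"
    using that
  proof (induction I)
    case (insert i I)
    then have "(\<lambda>l. h l - (\<Sum>i\<in>I. A i * r i l)) \<in> E" by blast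
    moreover have "r i \<in> E" "A i \<in> RX m n" "\<And>b. b \<in> supp (A i) \<Longrightarrow> gt 0 b"
      using insert.prems by blast+
    ultimately have "(\<lambda>l. h l - (\<Sum>i\<in>I. A i * r i l) - A i * r i l) \<in> E" by (rule E_minus)
    then show ?case using insert.hyps by (simp add: algebra_simps)
  qed simp
  define lead where "lead R = (SOME p. is_lead gtm (vsupp R) p)" for R :: "nat \<Rightarrow> 'k rx"
  have lead: "is_lead gtm (vsupp R) (lead R)" if "R \<in> E" for R
    unfolding lead_def using vector_ex_lead[OF E_free[OF that] E_nz[OF that]] by (rule someI_ex)
  have leadM: "lead R \<in> modMon m n s" if "R \<in> E" for R
    using lead_in_modMon[OF E_free[OF that] lead[OF that]] .
  let ?P = "\<lambda>f (j::nat) x. snd x \<in> E \<and> xbounded (fst x) (snd x) \<and>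
    (\<forall>i<j. gtm (lead (snd (f i))) (lead (snd x)) \<and>
       (\<forall>b\<in>Mon m n. lead (snd x) = mon_act b (lead (snd (f i))) \<longrightarrow> \<not> xdeg b + fst (f i) \<le> fst x))"
  have "\<exists>f. \<forall>j. ?P f j (f j)"
  proof (rule dependent_wf_choice[OF wf_less_than])
    fix f g :: "nat \<Rightarrow> nat \<times> (nat \<Rightarrow> 'k rx)" and j x
    assume "\<And>i. (i, j) \<in> less_than \<Longrightarrow> f i = g i"
    then have "f i = g i" if "i < j" for i using that by simp
    then show "?P f j x = ?P g j x" by simp
  next
    fix j and f :: "nat \<Rightarrow> nat \<times> (nat \<Rightarrow> 'k rx)"
    assume "\<And>i. (i, j) \<in> less_than \<Longrightarrow> ?P f i (f i)"
    then have f: "?P f i (f i)" if "i < j" for i using that by simp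
    define r where "r i = snd (f i)" for i
    define d where "d i = fst (f i)" for i
    have r: "r i \<in> E" "xbounded (d i) (r i)" if "i < j" for i
      using f[OF that] by (simp_all add: r_def d_def)
    \<comment> \<open>Cancel the leading term of the last vector by an element of \<open>N\<close>.\<close>
    have "\<exists>h\<in>E. \<forall>i<j. gtm (lead (r i)) (lead h)"
    proof (cases j)
      case 0
      then show ?thesis using Q_E by blast
    next
      case (Suc k)
      define p where "p = lead (r k)"
      have k: "r k \<in> E" "is_lead gtm (vsupp (r k)) p" "p \<in> modMon m n s"
        using r(1)[of k] lead[of "r k"] leadM[of "r k"] Suc by (simp_all add: p_def)
      obtain v where v: "v \<in> N" "is_lead gtm (vsupp v) p" using E_lead[OF k(1,2)] by blast
      define c where "c = mcoeff (r k (snd p)) (fst p) / mcoeff (v (snd p)) (fst p)"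
      define h where "h = (\<lambda>l. r k l - mterm c 0 * v l)"
      have "h \<in> E" unfolding h_def by (intro E_minus_N k(1) N_scale v(1) RX_mterm) simp
      have "p \<notin> vsupp h"
        using v(2) mcoeff_mterm_mult[of c 0 "v (snd p)" "fst p"]
        by (simp add: h_def mem_vsupp' supp_def is_lead_def c_def)
      moreover have "gtm p q \<or> p = q" if "q \<in> vsupp h" for q
      proof -
        have "q \<in> vsupp (r k) \<union> vsupp (\<lambda>l. mterm c 0 * v l)"
          using that vsupp_minus[of "r k" "\<lambda>l. mterm c 0 * v l"] unfolding h_def by blast
        then consider "q \<in> vsupp (r k)" | "q \<in> vsupp (\<lambda>l. mterm c 0 * v l)" by blast
        then show ?thesis
        proof cases
          case 2
          then obtain a q' where "a \<in> supp (mterm c 0)" "q' \<in> vsupp v" "q = mon_act a q'"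
            by (rule vsupp_scale)
          then have "q \<in> vsupp v" by (simp add: supp_def mcoeff_mterm split: if_splits)
          then show ?thesis using v(2) by (auto simp: is_lead_def)
        qed (use k(2) in \<open>auto simp: is_lead_def\<close>)
      qed
      ultimately have lt: "gtm p (lead h)" using lead[OF \<open>h \<in> E\<close>] unfolding is_lead_def by metis
      have "gtm (lead (r i)) (lead h)" if "i < j" for i
      proof (cases "i = k")
        case True
        then show ?thesis using lt by (simp add: p_def)
      next
        case False
        then have "gtm (lead (r i)) p" using f[of k] that Suc by (simp add: p_def r_def)
        then show ?thesis using lt gtm_trans leadM[OF r(1)[OF that]] k(3) leadM[OF \<open>h \<in> E\<close>] by blast
      qed
      then show ?thesis using \<open>h \<in> E\<close> by blast
    qed
    then obtain h where h: "h \<in> E" "\<And>i. i < j \<Longrightarrow> gtm (lead (r i)) (lead h)" by blast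
    obtain D where D: "xbounded D h" using xbounded_free_mod[OF E_free[OF h(1)]] by blast
    obtain A where A: "\<And>i. i \<in> {..<j} \<Longrightarrow> A i \<in> RX m n"
      "\<And>i b. i \<in> {..<j} \<Longrightarrow> b \<in> supp (A i) \<Longrightarrow> xdeg b + d i \<le> D"
      "\<And>i b. i \<in> {..<j} \<Longrightarrow> b \<in> supp (A i) \<Longrightarrow>
         \<exists>p\<in>vsupp h. p = mon_act b (lead (r i)) \<or> gtm p (mon_act b (lead (r i)))"
      "\<And>i b p. i \<in> {..<j} \<Longrightarrow> b \<in> Mon m n \<Longrightarrow> xdeg b + d i \<le> D \<Longrightarrow>
         mon_act b (lead (r i)) \<notin> vsupp (\<lambda>l. h l - (\<Sum>i\<in>{..<j}. A i * r i l))"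
      by (rule bounded_division[of "{..<j}" r "\<lambda>i. lead (r i)" d D h])
         (use r E_free lead in \<open>auto\<close>)
    have AM: "b \<in> Mon m n" if "i < j" "b \<in> supp (A i)" for i b
      using A(1)[of i] that by (auto simp: RX_def)
    have top: "lead h = mon_act b (lead (r i)) \<or> gtm (lead h) (mon_act b (lead (r i)))"
      if "i < j" "b \<in> supp (A i)" for i b
    proof -
      from A(3)[of i b] that obtain p
        where p: "p \<in> vsupp h" "p = mon_act b (lead (r i)) \<or> gtm p (mon_act b (lead (r i)))" by blast
      have "lead h = p \<or> gtm (lead h) p" using lead[OF h(1)] p(1) by (auto simp: is_lead_def)
      moreover have "p \<in> modMon m n s" using p(1) vsupp_free_mod[OF E_free[OF h(1)]] by blast
      moreover have "mon_act b (lead (r i)) \<in> modMon m n s"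
        using AM[OF that] leadM[OF r(1)[OF that(1)]] by simp
      ultimately show ?thesis
        using p(2) gtm_trans[of "lead h" p "mon_act b (lead (r i))"] leadM[OF h(1)] by auto
    qed
    \<comment> \<open>\<open>b lm(r\<^sub>i) \<le> lm(h) < lm(r\<^sub>i)\<close>\<close>
    have small: "gt 0 b" if "i < j" "b \<in> supp (A i)" for i b
      by (rule lead_below_act_imp_less_1[of "lead (r i)" "lead h"])
         (use h(2) top AM leadM h(1) r(1) that in auto)
    define R where "R = (\<lambda>l. h l - (\<Sum>i<j. A i * r i l))"
    have "R \<in> E" unfolding R_def by (rule E_minus_sum) (use h(1) r(1) A(1) small in auto)
    have R_low: "lead h = q \<or> gtm (lead h) q" if q: "q \<in> vsupp R" for q
    proof -
      have "q \<in> vsupp h \<or> (\<exists>i<j. q \<in> vsupp (\<lambda>l. A i * r i l))"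
        using q vsupp_minus[of h "\<lambda>l. \<Sum>i<j. A i * r i l"] vsupp_sum[of "\<lambda>i l. A i * r i l" "{..<j}"]
        unfolding R_def by fast
      then show ?thesis
      proof (elim disjE exE conjE)
        fix i assume i: "i < j" "q \<in> vsupp (\<lambda>l. A i * r i l)"
        from i(2) obtain b q' where b: "b \<in> supp (A i)" "q' \<in> vsupp (r i)" "q = mon_act b q'"
          by (rule vsupp_scale)
        have M: "q' \<in> modMon m n s" using b(2) vsupp_free_mod[OF E_free[OF r(1)[OF i(1)]]] by blast
        have "lead (r i) = q' \<or> gtm (lead (r i)) q'"
          using lead[OF r(1)[OF i(1)]] b(2) by (auto simp: is_lead_def)
        then have "mon_act b (lead (r i)) = q \<or> gtm (mon_act b (lead (r i))) q"
          using gtm_act leadM[OF r(1)[OF i(1)]] M AM[OF i(1) b(1)] b(3) by blast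
        then show ?thesis
          using top[OF i(1) b(1)] gtm_trans[of "lead h" "mon_act b (lead (r i))" q]
            leadM[OF r(1)[OF i(1)]] leadM[OF h(1)] M AM[OF i(1) b(1)] b(3) by auto
      qed (use lead[OF h(1)] in \<open>auto simp: is_lead_def\<close>)
    qed
    have xb: "xbounded D R"
      unfolding R_def
    proof (intro xbounded_minus D xbounded_sum)
      fix i assume "i \<in> {..<j}"
      then have i: "i < j" by simp
      show "xbounded D (\<lambda>l. A i * r i l)"
        unfolding xbounded_def
      proof
        fix p assume "p \<in> vsupp (\<lambda>l. A i * r i l)"
        then obtain b q where "b \<in> supp (A i)" "q \<in> vsupp (r i)" "p = mon_act b q" by (rule vsupp_scale)
        then show "xdeg (fst p) \<le> D"
          using A(2)[of i b] i r(2)[OF i] by (fastforce simp: xbounded_def)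
      qed
    qed
    have "?P f j (D, R)"
    proof (intro conjI allI impI ballI)
      show "snd (D, R) \<in> E" "xbounded (fst (D, R)) (snd (D, R))" using \<open>R \<in> E\<close> xb by simp_all
      fix i assume i: "i < j"
      have "lead R \<in> vsupp R" using lead[OF \<open>R \<in> E\<close>] by (simp add: is_lead_def)
      then show "gtm (lead (snd (f i))) (lead (snd (D, R)))"
        using R_low[of "lead R"] h(2)[OF i] gtm_trans[of "lead (r i)" "lead h" "lead R"]
          leadM[OF r(1)[OF i]] leadM[OF h(1)] leadM[OF \<open>R \<in> E\<close>] by (auto simp: r_def)
      fix b assume "b \<in> Mon m n" "lead (snd (D, R)) = mon_act b (lead (snd (f i)))"
      then show "\<not> xdeg b + fst (f i) \<le> fst (D, R)"
        using A(4)[of i b] i \<open>lead R \<in> vsupp R\<close> unfolding R_def[symmetric] by (auto simp: r_def d_def)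
    qed
    then show "\<exists>x. ?P f j x" by blast
  qed
  then obtain f where f: "\<And>j. ?P f j (f j)" by blast
  have "lead (snd (f j)) \<in> modMon m n s" "xdeg (fst (lead (snd (f j)))) \<le> fst (f j)" for j
    using f[of j] leadM lead[of "snd (f j)"] by (auto simp: xbounded_def is_lead_def)
  then obtain i j b where "i < j" "b \<in> Mon m n" "lead (snd (f j)) = mon_act b (lead (snd (f i)))"
      "xdeg b + fst (f i) \<le> fst (f j)"
    using dickson_graded[of "\<lambda>j. lead (snd (f j))" m n s "\<lambda>j. fst (f j)"] by blast
  then show False using f[of j] by blast
qed

end

section \<open>Submodules generated by sets\<close>

definition closed_under_ops :: "'r::comm_ring_1 set \<Rightarrow> bool" where
  "closed_under_ops A \<longleftrightarrow> 0 \<in> A \<and> (\<forall>a\<in>A. \<forall>b\<in>A. a + b \<in> A \<and> a * b \<in> A)"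

lemma closed_sum: "closed_under_ops A \<Longrightarrow> (\<And>i. i \<in> I \<Longrightarrow> f i \<in> A) \<Longrightarrow> (\<Sum>i\<in>I. f i) \<in> A"
  by (induction I rule: infinite_finite_induct) (auto simp: closed_under_ops_def)

text \<open>
  The family may have repetitions: the coefficients of equal members are added up, and conversely
  one index is chosen for every vector.
\<close>

lemma mod_span_family:
  assumes A: "closed_under_ops A" and I: "finite I"
  shows "mod_span A (g ` I) = {(\<lambda>l. \<Sum>i\<in>I. q i * g i l) | q. \<forall>i\<in>I. q i \<in> A}"
proof (intro equalityI subsetI)
  fix f assume "f \<in> mod_span A (g ` I)"
  then obtain F a where F: "finite F" "F \<subseteq> g ` I" "\<And>x. x \<in> F \<Longrightarrow> a x \<in> A" "f = (\<lambda>l. \<Sum>x\<in>F. a x * x l)"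
    unfolding mod_span_def by blast
  define idx where "idx = inv_into I g"
  have idx: "idx x \<in> I" "g (idx x) = x" if "x \<in> F" for x
    using F(2) that by (auto simp: idx_def inv_into_into f_inv_into_f)
  have inj: "inj_on idx F" using idx(2) by (metis inj_onI)
  define q where "q i = (if i \<in> idx ` F then a (g i) else 0)" for i
  have "f = (\<lambda>l. \<Sum>i\<in>I. q i * g i l)"
  proof
    fix l
    have "(\<Sum>i\<in>I. q i * g i l) = (\<Sum>i\<in>idx ` F. q i * g i l)"
      by (rule sum.mono_neutral_right) (use I idx(1) in \<open>auto simp: q_def\<close>)
    also have "\<dots> = (\<Sum>x\<in>F. q (idx x) * g (idx x) l)" by (simp add: sum.reindex[OF inj])
    also have "\<dots> = f l" unfolding F(4) by (rule sum.cong) (auto simp: q_def idx)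
    finally show "f l = (\<Sum>i\<in>I. q i * g i l)" ..
  qed
  moreover have "\<forall>i\<in>I. q i \<in> A" using F(3) idx A by (auto simp: q_def closed_under_ops_def)
  ultimately show "f \<in> {(\<lambda>l. \<Sum>i\<in>I. q i * g i l) | q. \<forall>i\<in>I. q i \<in> A}" by blast
next
  fix f assume "f \<in> {(\<lambda>l. \<Sum>i\<in>I. q i * g i l) | q. \<forall>i\<in>I. q i \<in> A}"
  then obtain q where q: "f = (\<lambda>l. \<Sum>i\<in>I. q i * g i l)" "\<And>i. i \<in> I \<Longrightarrow> q i \<in> A" by blast
  define a where "a x = (\<Sum>i\<in>{i\<in>I. g i = x}. q i)" for x
  have "f = (\<lambda>l. \<Sum>x\<in>g ` I. a x * x l)"
  proof
    fix l
    have "(\<Sum>x\<in>g ` I. a x * x l) = (\<Sum>x\<in>g ` I. \<Sum>i\<in>{i\<in>I. g i = x}. q i * g i l)"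
      by (rule sum.cong) (auto simp: a_def sum_distrib_right)
    also have "\<dots> = f l" unfolding q(1) using I by (intro sum.group) auto
    finally show "f l = (\<Sum>x\<in>g ` I. a x * x l)" ..
  qed
  moreover have "\<forall>x\<in>g ` I. a x \<in> A" unfolding a_def using q(2) by (auto intro!: closed_sum[OF A])
  ultimately show "f \<in> mod_span A (g ` I)" unfolding mod_span_def using I by blast
qed

lemma mod_span_mono: "X \<subseteq> Y \<Longrightarrow> mod_span A X \<subseteq> mod_span A Y"
  unfolding mod_span_def by blast

lemma mod_span_subset_of_multiples:
  assumes A: "closed_under_ops A"
    and XY: "\<And>x. x \<in> X \<Longrightarrow> x \<noteq> (\<lambda>_. 0) \<Longrightarrow> \<exists>y\<in>Y. \<exists>c\<in>A. x = (\<lambda>l. c * y l)"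
  shows "mod_span A X \<subseteq> mod_span A Y"
proof
  fix f assume "f \<in> mod_span A X"
  then obtain F a where F: "finite F" "F \<subseteq> X" "\<And>x. x \<in> F \<Longrightarrow> a x \<in> A" "f = (\<lambda>l. \<Sum>x\<in>F. a x * x l)"
    unfolding mod_span_def by blast
  define F0 where "F0 = F - {\<lambda>_. 0}"
  have "\<forall>x\<in>F0. \<exists>y c. y \<in> Y \<and> c \<in> A \<and> x = (\<lambda>l. c * y l)"
    using XY F(2) unfolding F0_def by blast
  then obtain y c where y: "\<And>x. x \<in> F0 \<Longrightarrow> y x \<in> Y" "\<And>x. x \<in> F0 \<Longrightarrow> c x \<in> A"
      "\<And>x. x \<in> F0 \<Longrightarrow> x = (\<lambda>l. c x * y x l)" by metis
  have "f = (\<lambda>l. \<Sum>x\<in>F0. (a x * c x) * y x l)"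
  proof
    fix l
    have "f l = (\<Sum>x\<in>F0. a x * x l)"
      unfolding F(4) F0_def by (rule sum.mono_neutral_right) (use F(1) in auto)
    also have "\<dots> = (\<Sum>x\<in>F0. (a x * c x) * y x l)"
    proof (rule sum.cong[OF refl])
      fix x assume "x \<in> F0"
      from fun_cong[OF y(3)[OF this], of l] show "a x * x l = (a x * c x) * y x l" by (simp add: mult.assoc)
    qed
    finally show "f l = \<dots>" .
  qed
  moreover have "\<forall>x\<in>F0. a x * c x \<in> A" using F(3) y(2) A by (auto simp: F0_def closed_under_ops_def)
  moreover have "finite F0" using F(1) by (simp add: F0_def)
  ultimately have "f \<in> mod_span A (y ` F0)" unfolding mod_span_family[OF A \<open>finite F0\<close>] by (intro CollectI exI[of _ "\<lambda>x. a x * c x"]) blast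
  moreover have "y ` F0 \<subseteq> Y" using y(1) by blast
  ultimately show "f \<in> mod_span A Y" using mod_span_mono by blast
qed

lemma closed_KTX: "closed_under_ops (KTX m n :: 'k::comm_ring_1 rx set)"
  unfolding closed_under_ops_def
proof (intro conjI ballI)
  show "0 \<in> (KTX m n :: 'k rx set)" by (simp add: KTX_def)
  fix a b :: "'k rx" assume ab: "a \<in> KTX m n" "b \<in> KTX m n"
  have "supp (a + b) \<subseteq> supp a \<union> supp b" by (auto simp: supp_def)
  then show "a + b \<in> KTX m n" using ab by (auto simp: KTX_def RX_add intro: finite_subset)
  have "supp (a * b) \<subseteq> (\<lambda>(c, d). c + d) ` (supp a \<times> supp b)"
  proof
    fix x assume "x \<in> supp (a * b)"
    then obtain c d where "c \<in> supp a" "d \<in> supp b" "x = c + d" using supp_mult by blast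
    then show "x \<in> (\<lambda>(c, d). c + d) ` (supp a \<times> supp b)" by (intro image_eqI[of _ _ "(c, d)"]) auto
  qed
  then show "a * b \<in> KTX m n" using ab by (auto simp: KTX_def RX_mult intro: finite_subset)
qed

section \<open>Leading monomials over the localisation\<close>

lemma to_loc_simps:
  "to_loc 0 = 0" "to_loc 1 = 1" "to_loc (a + b) = to_loc a + to_loc b" "to_loc (a - b) = to_loc a - to_loc b"
  "to_loc (a * b) = to_loc a * to_loc b" for a b :: "'k::idom rx"
  by (simp_all add: to_loc_def Zero_fract_def One_fract_def)

lemma to_loc_sum: "to_loc (\<Sum>i\<in>A. f i) = (\<Sum>i\<in>A. to_loc (f i))"
  by (induction A rule: infinite_finite_induct) (simp_all add: to_loc_simps)

lemma to_loc_inject [simp]: "to_loc a = to_loc b \<longleftrightarrow> a = b"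
  by (simp add: to_loc_def eq_fract)

lemma to_loc_eq_0_iff [simp]: "to_loc a = 0 \<longleftrightarrow> a = 0"
  using to_loc_inject[of a 0] by (simp only: to_loc_simps)

lemma Fract_conv_to_loc: "Fract a b = to_loc a / to_loc b"
  by (simp add: to_loc_def)

context monomial_order
begin

lemma RXloc_I: "f \<in> RX m n \<Longrightarrow> u \<in> S_gt m n gt \<Longrightarrow> Fract f u \<in> RXloc m n gt"
  unfolding RXloc_def by blast

lemma to_loc_RXloc: "f \<in> RX m n \<Longrightarrow> to_loc f \<in> RXloc m n gt"
  unfolding to_loc_def by (rule RXloc_I) simp_all

lemma RXloc_add_mult_minus:
  fixes a b :: "'k::idom rx fract"
  assumes "a \<in> RXloc m n gt" "b \<in> RXloc m n gt"
  shows "a + b \<in> RXloc m n gt" "a * b \<in> RXloc m n gt" "a - b \<in> RXloc m n gt"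
proof -
  obtain f u where a: "f \<in> RX m n" "u \<in> S_gt m n gt" "a = Fract f u" using assms(1) by (auto simp: RXloc_def)
  obtain h v where b: "h \<in> RX m n" "v \<in> S_gt m n gt" "b = Fract h v" using assms(2) by (auto simp: RXloc_def)
  note nz = S_gt_nonzero[OF a(2)] S_gt_nonzero[OF b(2)]
  show "a + b \<in> RXloc m n gt" "a * b \<in> RXloc m n gt" "a - b \<in> RXloc m n gt"
    unfolding a(3) b(3) using nz a(1,2) b(1,2) S_gt_in_RX[OF a(2)] S_gt_in_RX[OF b(2)]
    by (auto intro!: RXloc_I RX_add RX_minus RX_mult S_gt_mult)
qed

lemma RXloc_0 [simp]: "0 \<in> RXloc m n gt"
  using to_loc_RXloc[of 0] by (simp add: to_loc_simps)

lemma closed_RXloc: "closed_under_ops (RXloc m n gt :: 'k::idom rx fract set)"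
  unfolding closed_under_ops_def using RXloc_add_mult_minus by auto

lemma common_denominator:
  fixes x :: "'i \<Rightarrow> 'k::idom rx fract"
  assumes "finite I" "\<And>i. i \<in> I \<Longrightarrow> x i \<in> RXloc m n gt"
  shows "\<exists>V\<in>S_gt m n gt. \<exists>X. (\<forall>i\<in>I. X i \<in> RX m n \<and> x i = Fract (X i) V)"
  using assms
proof (induction I)
  case empty
  show ?case using S_gt_one by blast
next
  case (insert j I)
  then obtain V X where V: "V \<in> S_gt m n gt" "\<And>i. i \<in> I \<Longrightarrow> X i \<in> RX m n \<and> x i = Fract (X i) V" by blast
  have "x j \<in> RXloc m n gt" using insert.prems by blast
  then obtain f u where f: "f \<in> RX m n" "u \<in> S_gt m n gt" "x j = Fract f u" by (auto simp: RXloc_def)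
  note nz = S_gt_nonzero[OF V(1)] S_gt_nonzero[OF f(2)]
  define X' where "X' i = (if i = j then f * V else X i * u)" for i
  have "X' i \<in> RX m n \<and> x i = Fract (X' i) (V * u)" if "i \<in> insert j I" for i
    using that V(2)[of i] f V(1) nz S_gt_in_RX[OF V(1)] S_gt_in_RX[OF f(2)]
    by (auto simp: X'_def RX_mult eq_fract)
  then show ?case using S_gt_mult[OF V(1) f(2)] by blast
qed

lemma free_mod_RXloc_numerator:
  fixes v :: "nat \<Rightarrow> 'k::idom rx fract"
  assumes v: "v \<in> free_mod s (RXloc m n gt)"
  obtains V X where "V \<in> S_gt m n gt" "X \<in> free_mod s (RX m n)" "v = (\<lambda>l. Fract (X l) V)"
proof -
  obtain V X where V: "V \<in> S_gt m n gt" "\<And>i. i < s \<Longrightarrow> X i \<in> RX m n \<and> v i = Fract (X i) V"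
    using common_denominator[of "{..<s}" v] v by (auto simp: free_mod_def)
  define X' where "X' i = (if i < s then X i else 0)" for i
  have "X' \<in> free_mod s (RX m n)" using V(2) by (auto simp: free_mod_def X'_def)
  moreover have "v = (\<lambda>l. Fract (X' l) V)"
    using V(2) v by (auto simp: fun_eq_iff X'_def free_mod_def Fract_conv_to_loc to_loc_simps not_less)
  ultimately show thesis using that V(1) by blast
qed

end

context modmon_order
begin

text \<open>
  For two numerators \<open>X\<close> and \<open>Y\<close> of the same vector one has \<open>u Y = w X\<close> with \<open>u\<close> and \<open>w\<close> of leading
  term \<open>1\<close>, and multiplication by these does not change leading terms.
\<close>

lemma lm_lc_Fract:
  fixes X :: "nat \<Rightarrow> 'k::idom rx"
  assumes X: "X \<in> free_mod s (RX m n)" "is_lead gtm (vsupp X) p" and u: "u \<in> S_gt m n gt"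
  shows "lm m n gt gtm (\<lambda>l. Fract (X l) u) = Some p"
    and "lc m n gt gtm (\<lambda>l. Fract (X l) u) = mcoeff (X (snd p)) (fst p)"
proof -
  let ?v = "\<lambda>l. Fract (X l) u"
  define Y where "Y = numerator m n gt ?v"
  have "\<exists>f. \<exists>w\<in>S_gt m n gt. \<forall>i. f i \<in> RX m n \<and> ?v i = Fract (f i) w"
    using free_mod_nth[OF X(1)] u by blast
  then have "\<exists>w\<in>S_gt m n gt. \<forall>i. Y i \<in> RX m n \<and> ?v i = Fract (Y i) w"
    unfolding Y_def numerator_def by (rule someI_ex)
  then obtain w where w: "w \<in> S_gt m n gt" "\<And>i. Y i \<in> RX m n" "\<And>i. Fract (X i) u = Fract (Y i) w" by blast
  have eq: "u * Y i = w * X i" for i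
    using w(3)[of i] S_gt_nonzero[OF u] S_gt_nonzero[OF w(1)] by (simp add: eq_fract mult.commute)
  have "Y i = 0" if "i \<ge> s" for i
    using eq[of i] that X(1) S_gt_nonzero[OF u] by (auto simp: free_mod_def)
  then have Y: "Y \<in> free_mod s (RX m n)" using w(2) by (auto simp: free_mod_def)
  have "\<not> (Y = (\<lambda>_. 0))"
  proof
    assume "Y = (\<lambda>_. 0)"
    then have "X i = 0" for i using eq[of i] S_gt_nonzero[OF w(1)] by auto
    then show False using X(2) by (auto simp: is_lead_def mem_vsupp')
  qed
  then obtain q where q: "is_lead gtm (vsupp Y) q" using vector_ex_lead[OF Y] by blast
  have u': "u \<in> RX m n" "mcoeff u 0 = 1" "is_lead gt (supp u) 0" and w': "w \<in> RX m n" "mcoeff w 0 = 1" "is_lead gt (supp w) 0"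
    using u w(1) by (auto simp: S_gt_iff)
  have "is_lead gtm (vsupp (\<lambda>l. u * Y l)) q" using lead_scale(1)[OF u'(1,3) Y q] by simp
  moreover have "is_lead gtm (vsupp (\<lambda>l. u * Y l)) p"
    using lead_scale(1)[OF w'(1,3) X] by (simp add: eq)
  moreover have "vsupp (\<lambda>l. u * Y l) \<subseteq> modMon m n s" using free_mod_scale[OF u'(1) Y] by (rule vsupp_free_mod)
  ultimately have "p = q" using is_lead_unique[OF gtm_total_ordering] by blast
  show lm: "lm m n gt gtm ?v = Some p"
    unfolding lm_def Y_def[symmetric] \<open>p = q\<close>
    by (rule max_mon_eq[OF gtm_total_ordering vsupp_free_mod[OF Y] q])
  have "mcoeff (u * Y (snd p)) (fst p) = mcoeff (Y (snd p)) (fst p)"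
    using lead_scale(2)[OF u'(1,3) Y q] \<open>p = q\<close> u'(2) by simp
  moreover have "mcoeff (w * X (snd p)) (fst p) = mcoeff (X (snd p)) (fst p)"
    using lead_scale(2)[OF w'(1,3) X] w'(2) by simp
  ultimately show "lc m n gt gtm ?v = mcoeff (X (snd p)) (fst p)"
    unfolding lc_def lm Y_def[symmetric] using eq by (cases p) simp
qed

lemma lm_zero: "lm m n gt gtm (\<lambda>_. 0 :: 'k::idom rx fract) = None"
proof -
  let ?v = "\<lambda>_::nat. 0 :: 'k rx fract"
  define Y where "Y = numerator m n gt ?v"
  have "\<exists>f. \<exists>w\<in>S_gt m n gt. \<forall>i. f i \<in> RX m n \<and> ?v i = Fract (f i) w"
    by (intro exI[of _ "\<lambda>_. 0"] bexI[of _ 1]) (simp_all add: Fract_conv_to_loc to_loc_simps)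
  then have "\<exists>w\<in>S_gt m n gt. \<forall>i. Y i \<in> RX m n \<and> ?v i = Fract (Y i) w"
    unfolding Y_def numerator_def by (rule someI_ex)
  then obtain w where w: "w \<in> S_gt m n gt" "\<And>i. 0 = Fract (Y i) w" by blast
  have "Y i = 0" for i using w(2)[of i] S_gt_nonzero[OF w(1)] by (simp add: Fract_conv_to_loc)
  then have "Y = (\<lambda>_. 0)" by auto
  then show ?thesis by (simp add: lm_def Y_def[symmetric] max_mon_def del: vsupp_eq_empty_iff) (simp add: vsupp_def)
qed

lemma mon_vec_act: "mon_vec (Some (mon_act b p)) = (\<lambda>j. mterm 1 b * mon_vec (Some p) j)"
  by (cases p) (simp add: mon_vec_def mterm_mult mult.assoc[symmetric] fun_eq_iff)

text \<open>
  The submodules of leading monomials are spanned by monomials, so it suffices to compare these.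
\<close>

lemma standard_basisI:
  assumes "finite G" "G \<subseteq> J"
    and J: "\<And>f. f \<in> J \<Longrightarrow> f \<noteq> (\<lambda>_. 0) \<Longrightarrow>
      \<exists>g\<in>G. \<exists>p. \<exists>b\<in>Mon m n. lm m n gt gtm g = Some p \<and> lm m n gt gtm f = Some (mon_act b p)"
  shows "standard_basis m n gt gtm J (G :: (nat \<Rightarrow> 'k::idom rx fract) set)"
proof -
  have "L_gt m n gt gtm G \<subseteq> L_gt m n gt gtm J"
    unfolding L_gt_def by (rule mod_span_mono) (use assms(2) in blast)
  moreover have "L_gt m n gt gtm J \<subseteq> L_gt m n gt gtm G"
    unfolding L_gt_def
  proof (rule mod_span_subset_of_multiples[OF closed_KTX])
    fix x :: "nat \<Rightarrow> 'k rx" assume x: "x \<in> (\<lambda>g. mon_vec (lm m n gt gtm g)) ` J" "x \<noteq> (\<lambda>_. 0)"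
    then obtain f where f: "f \<in> J" "x = mon_vec (lm m n gt gtm f)" by blast
    have "f \<noteq> (\<lambda>_. 0)"
    proof
      assume "f = (\<lambda>_. 0)"
      then have "lm m n gt gtm f = None" using lm_zero by simp
      then show False using f(2) x(2) by (simp add: mon_vec_def)
    qed
    from J[OF f(1) this] obtain g p b where g: "g \<in> G" "b \<in> Mon m n" "lm m n gt gtm g = Some p"
      "lm m n gt gtm f = Some (mon_act b p)" by blast
    have "mterm 1 b \<in> (KTX m n :: 'k rx set)"
      using g(2) by (auto simp: KTX_def RX_mterm supp_def mcoeff_mterm)
    moreover have "x = (\<lambda>l. mterm 1 b * mon_vec (lm m n gt gtm g) l)"
      unfolding f(2) g(3,4) by (rule mon_vec_act)
    ultimately show "\<exists>y\<in>(\<lambda>g. mon_vec (lm m n gt gtm g)) ` G. \<exists>c\<in>KTX m n. x = (\<lambda>l. c * y l)"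
      using g(1) by blast
  qed
  ultimately show ?thesis using assms(1,2) by (simp add: standard_basis_def)
qed

end

section \<open>Least common multiples\<close>

definition mlcm :: "mon \<Rightarrow> mon \<Rightarrow> mon" where
  "mlcm a b = (expo_max (fst a) (fst b), expo_max (snd a) (snd b))"

lemma mon_lcm_Some: "mon_lcm (Some p) (Some q) = (if snd p = snd q then Some (mlcm (fst p) (fst q), snd p) else None)"
  by (cases p; cases q; cases "fst p"; cases "fst q") (auto simp: mlcm_def)

lemma mlcm_commute: "mlcm a b = mlcm b a"
proof -
  have "expo_max x y = expo_max y x" for x y
    by (rule poly_mapping_eqI) (simp add: expo_max.rep_eq max.commute)
  then show ?thesis by (simp add: mlcm_def)
qed

lemma mlcm_diff_add: "mlcm a b - a + a = mlcm a b"
proof -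
  have "expo_max x y - x + x = expo_max x y" for x y
    by (rule expo_diff_add) (simp add: expo_max.rep_eq)
  then show ?thesis by (simp add: mlcm_def prod_eq_iff)
qed

lemma mlcm_Mon: "a \<in> Mon m n \<Longrightarrow> b \<in> Mon m n \<Longrightarrow> mlcm a b \<in> Mon m n"
proof -
  have "Poly_Mapping.keys (expo_max x y) \<subseteq> Poly_Mapping.keys x \<union> Poly_Mapping.keys y" for x y
    by (auto simp: in_keys_iff expo_max.rep_eq)
  then show "a \<in> Mon m n \<Longrightarrow> b \<in> Mon m n \<Longrightarrow> mlcm a b \<in> Mon m n"
    unfolding Mon_def mlcm_def by (simp add: case_prod_unfold) blast
qed

lemma mlcm_least:
  assumes "a + c = b + d"
  obtains e where "a + c = e + mlcm a b"
proof -
  have le: "Poly_Mapping.lookup (expo_max x y) i \<le> Poly_Mapping.lookup (x + z) i" if "x + z = y + w" for x y z w :: expo and i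
  proof -
    have "Poly_Mapping.lookup (x + z) i = Poly_Mapping.lookup (y + w) i" using that by simp
    then show ?thesis by (simp add: expo_max.rep_eq lookup_add)
  qed
  have "fst a + fst c = fst b + fst d" "snd a + snd c = snd b + snd d"
    using assms by (auto simp: prod_eq_iff)
  note 1 = expo_diff_add[OF le[OF this(1)]] and 2 = expo_diff_add[OF le[OF this(2)]]
  have "a + c = (a + c - mlcm a b) + mlcm a b"
    using 1 2 by (simp add: mlcm_def prod_eq_iff)
  then show thesis by (rule that)
qed

text \<open>
  If \<open>a p = b q\<close>, then \<open>a p\<close> is a multiple of \<open>lcm(p, q)\<close>, so that \<open>lcm(p, q) / p\<close> divides \<open>a\<close>.
\<close>

lemma mlcm_quotient_dvd:
  assumes "mon_act b q = mon_act a p"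
  obtains e where "a = e + (mlcm (fst p) (fst q) - fst p)"
proof -
  have "fst p + a = fst q + b" using arg_cong[OF assms, of fst] by (simp add: add.commute)
  then obtain e where "fst p + a = e + mlcm (fst p) (fst q)" by (rule mlcm_least)
  also have "\<dots> = e + (mlcm (fst p) (fst q) - fst p + fst p)" by (simp only: mlcm_diff_add)
  also have "\<dots> = fst p + (e + (mlcm (fst p) (fst q) - fst p))" by (simp only: add.commute add.left_commute)
  finally have "a = e + (mlcm (fst p) (fst q) - fst p)" by simp
  then show thesis by (rule that)
qed

section \<open>The Schreyer ordering\<close>

text \<open>
  The vectors \<open>g\<^sub>\<nu>\<close> are written with a common denominator \<open>U\<close>. Syzygies of the \<open>g\<^sub>\<nu>\<close> are then the
  same as syzygies of the numerators \<open>G\<^sub>\<nu>\<close>, and most of the argument takes place over \<open>R[x]\<close>.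
\<close>

locale generators = modmon_order +
  fixes k :: nat and g :: "nat \<Rightarrow> nat \<Rightarrow> 'k::field rx fract"
    and G :: "nat \<Rightarrow> nat \<Rightarrow> 'k rx" and U :: "'k rx" and P :: "nat \<Rightarrow> modmon"
  assumes U: "U \<in> S_gt m n gt"
    and G_free: "\<And>\<nu>. \<nu> < k \<Longrightarrow> G \<nu> \<in> free_mod s (RX m n)"
    and G_lead: "\<And>\<nu>. \<nu> < k \<Longrightarrow> is_lead gtm (vsupp (G \<nu>)) (P \<nu>)"
    and g_eq: "\<And>\<nu>. \<nu> < k \<Longrightarrow> g \<nu> = (\<lambda>l. Fract (G \<nu> l) U)"
begin

abbreviation gtS :: "modmon \<Rightarrow> modmon \<Rightarrow> bool" where
  "gtS \<equiv> schreyer_ordering m n gt gtm g"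

lemma P_modMon: "\<nu> < k \<Longrightarrow> P \<nu> \<in> modMon m n s"
  using lead_in_modMon G_free G_lead by blast

lemma lm_g: "\<nu> < k \<Longrightarrow> lm m n gt gtm (g \<nu>) = Some (P \<nu>)"
  using lm_lc_Fract(1)[OF G_free G_lead U] by (simp add: g_eq)

lemma gtS_iff:
  assumes "i < k" "j < k"
  shows "gtS (a, i) (b, j) \<longleftrightarrow> gtm (mon_act a (P i)) (mon_act b (P j)) \<or> mon_act a (P i) = mon_act b (P j) \<and> i < j"
  using assms by (simp add: schreyer_ordering_def lm_g)

lemma act_P_modMon: "(a, i) \<in> modMon m n k \<Longrightarrow> i < k \<and> a \<in> Mon m n \<and> mon_act a (P i) \<in> modMon m n s"
  by (auto simp: modMon_def[of m n k] P_modMon)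

lemma schreyer_total_ordering: "strict_total_ordering_on (modMon m n k) gtS"
  unfolding strict_total_ordering_on_def
proof (intro conjI)
  show "irreflp_on (modMon m n k) gtS"
  proof (rule irreflp_onI)
    fix p assume "p \<in> modMon m n k"
    then show "\<not> gtS p p"
      using act_P_modMon[of "fst p" "snd p"] gtm_irrefl gtS_iff[of "snd p" "snd p" "fst p" "fst p"] by auto
  qed
  show "transp_on (modMon m n k) gtS"
  proof (rule transp_onI)
    fix p q r assume M: "p \<in> modMon m n k" "q \<in> modMon m n k" "r \<in> modMon m n k" and g: "gtS p q" "gtS q r"
    obtain a i b j c l where e: "p = (a, i)" "q = (b, j)" "r = (c, l)" by (cases p; cases q; cases r)
    note A = act_P_modMon[OF M(1)[unfolded e]] act_P_modMon[OF M(2)[unfolded e]] act_P_modMon[OF M(3)[unfolded e]]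
    show "gtS p r"
      using g A gtm_trans[of "mon_act a (P i)" "mon_act b (P j)" "mon_act c (P l)"]
      unfolding e by (auto simp: gtS_iff)
  qed
  show "totalp_on (modMon m n k) gtS"
  proof (rule totalp_onI)
    fix p q assume M: "p \<in> modMon m n k" "q \<in> modMon m n k" and ne: "p \<noteq> q"
    obtain a i b j where e: "p = (a, i)" "q = (b, j)" by (cases p; cases q)
    note A = act_P_modMon[OF M(1)[unfolded e]] act_P_modMon[OF M(2)[unfolded e]]
    have "gtm (mon_act a (P i)) (mon_act b (P j)) \<or> mon_act a (P i) = mon_act b (P j) \<or> gtm (mon_act b (P j)) (mon_act a (P i))"
      using A gtm_cases by blast
    moreover have "i \<noteq> j" if "mon_act a (P i) = mon_act b (P j)" using that ne e by auto
    ultimately show "gtS p q \<or> gtS q p"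
      using A unfolding e by (auto simp: gtS_iff)
  qed
qed

lemma schreyer_modmon_order: "modmon_order m n gt k gtS"
proof
  have "gtS (mon_act a p) (mon_act a q)"
    if "p \<in> modMon m n k" "q \<in> modMon m n k" "a \<in> Mon m n" "gtS p q" for p q a
  proof -
    obtain b i c j where e: "p = (b, i)" "q = (c, j)" by (cases p; cases q)
    note A = act_P_modMon[OF that(1)[unfolded e]] act_P_modMon[OF that(2)[unfolded e]]
    show ?thesis
      using that(3,4) A gtm_act[of "mon_act b (P i)" "mon_act c (P j)" a]
      unfolding e by (auto simp: gtS_iff mon_act_add)
  qed
  moreover have "gt a b \<longleftrightarrow> gtS (a, i) (b, i)" if "a \<in> Mon m n" "b \<in> Mon m n" "i < k" for a b i
  proof -
    have "gt a b \<longleftrightarrow> gtm (mon_act a (P i)) (mon_act b (P i))"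
      using gt_imp_gtm_act[of a b "P i"] gt_imp_gtm_act[of b a "P i"] gt_cases[OF that(1,2)] that P_modMon[OF that(3)]
        gtm_irrefl[of "mon_act a (P i)"] gtm_trans[of "mon_act a (P i)" "mon_act b (P i)" "mon_act a (P i)"]
      by auto
    then show ?thesis using that(3) by (simp add: gtS_iff)
  qed
  ultimately show "module_monomial_ordering m n k gt gtS"
    unfolding module_monomial_ordering_def using schreyer_total_ordering monord by blast
qed

sublocale S: modmon_order m n gt k gtS
  by (rule schreyer_modmon_order)

definition eval_gen :: "(nat \<Rightarrow> 'k rx) \<Rightarrow> (nat \<Rightarrow> 'k rx)" where
  "eval_gen Q = (\<lambda>l. \<Sum>\<nu><k. Q \<nu> * G \<nu> l)"

lemma eval_gen_free: "Q \<in> free_mod k (RX m n) \<Longrightarrow> eval_gen Q \<in> free_mod s (RX m n)"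
  unfolding eval_gen_def by (intro free_mod_sum free_mod_scale free_mod_nth[of Q k] G_free) auto

definition Syz :: "(nat \<Rightarrow> 'k rx) set" where
  "Syz = {Q \<in> free_mod k (RX m n). eval_gen Q = (\<lambda>_. 0)}"

lemma vsupp_term_bound:
  assumes Q: "Q \<in> free_mod k (RX m n)" and \<nu>: "\<nu> < k" and q: "q \<in> vsupp (\<lambda>l. Q \<nu> * G \<nu> l)"
  obtains b where "b \<in> supp (Q \<nu>)" "b \<in> Mon m n" "gtm (mon_act b (P \<nu>)) q \<or> q = mon_act b (P \<nu>)" "q \<in> modMon m n s"
proof -
  obtain b r where b: "b \<in> supp (Q \<nu>)" "r \<in> vsupp (G \<nu>)" "q = mon_act b r" using q by (rule vsupp_scale)
  have bM: "b \<in> Mon m n" using free_mod_nth[OF Q, of \<nu>] b(1) by (auto simp: RX_def)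
  have r: "r \<in> modMon m n s" "r = P \<nu> \<or> gtm (P \<nu>) r"
    using vsupp_free_mod[OF G_free[OF \<nu>]] b(2) G_lead[OF \<nu>] by (auto simp: is_lead_def)
  have "gtm (mon_act b (P \<nu>)) q \<or> q = mon_act b (P \<nu>)"
    using r gtm_act[of "P \<nu>" r b] P_modMon[OF \<nu>] bM b(3) by auto
  then show thesis using that b(1) bM r(1) b(3) by simp
qed

text \<open>
  No summand \<open>Q\<^sub>\<nu> G\<^sub>\<nu>\<close> exceeds \<open>a lm(G\<^sub>i)\<close>, by the choice of the Schreyer ordering. If only the
  \<open>i\<close>-th summand reaches this monomial, its coefficient in the sum is a product of two leading
  coefficients. Any other \<open>\<nu>\<close> that reaches it is larger than \<open>i\<close>, because of the tie-break of the
  Schreyer ordering.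
\<close>

lemma cancellation_dichotomy:
  assumes Q: "Q \<in> free_mod k (RX m n)" and lead: "is_lead gtS (vsupp Q) (a, i)"
  shows "is_lead gtm (vsupp (eval_gen Q)) (mon_act a (P i)) \<or>
    (\<exists>j b. i < j \<and> j < k \<and> b \<in> supp (Q j) \<and> mon_act b (P j) = mon_act a (P i))"
proof (rule disjCI)
  assume nc: "\<not> (\<exists>j b. i < j \<and> j < k \<and> b \<in> supp (Q j) \<and> mon_act b (P j) = mon_act a (P i))"
  let ?p = "mon_act a (P i)"
  have ai: "(a, i) \<in> modMon m n k" by (rule S.lead_in_modMon[OF Q lead])
  note A = act_P_modMon[OF ai]
  have i: "i < k" and a: "a \<in> Mon m n" and pM: "?p \<in> modMon m n s" using A by auto
  have a_supp: "a \<in> supp (Q i)" using lead by (simp add: is_lead_def mem_vsupp)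
  have QM: "b \<in> Mon m n" if "b \<in> supp (Q \<nu>)" for b \<nu>
    using free_mod_nth[OF Q, of \<nu>] that by (auto simp: RX_def)
  have below: "gtm ?p (mon_act b (P \<nu>)) \<or> ?p = mon_act b (P \<nu>) \<and> i \<le> \<nu>" if "b \<in> supp (Q \<nu>)" "\<nu> < k" for b \<nu>
  proof (cases "(b, \<nu>) = (a, i)")
    case False
    then have "gtS (a, i) (b, \<nu>)" using lead that(1) unfolding is_lead_def mem_vsupp[symmetric] by blast
    then show ?thesis using gtS_iff[OF i that(2)] by auto
  qed simp
  have low: "gtm ?p q \<or> ?p = q" if q: "q \<in> vsupp (eval_gen Q)" for q
  proof -
    obtain \<nu> where \<nu>: "\<nu> < k" "q \<in> vsupp (\<lambda>l. Q \<nu> * G \<nu> l)"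
      using q vsupp_sum[of "\<lambda>\<nu> l. Q \<nu> * G \<nu> l" "{..<k}"] unfolding eval_gen_def by auto
    obtain b where b: "b \<in> supp (Q \<nu>)" "b \<in> Mon m n" "gtm (mon_act b (P \<nu>)) q \<or> q = mon_act b (P \<nu>)" "q \<in> modMon m n s"
      using vsupp_term_bound[OF Q \<nu>] .
    then show ?thesis
      using below[OF b(1) \<nu>(1)] gtm_trans[of ?p "mon_act b (P \<nu>)" q] pM P_modMon[OF \<nu>(1)] by auto
  qed
  have other: "mcoeff (Q \<nu> * G \<nu> (snd ?p)) (fst ?p) = 0" if \<nu>: "\<nu> < k" "\<nu> \<noteq> i" for \<nu>
  proof (rule ccontr)
    assume "mcoeff (Q \<nu> * G \<nu> (snd ?p)) (fst ?p) \<noteq> 0"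
    then have "?p \<in> vsupp (\<lambda>l. Q \<nu> * G \<nu> l)" by (simp add: mem_vsupp' supp_def)
    from vsupp_term_bound[OF Q \<nu>(1) this] obtain b where
      b: "b \<in> supp (Q \<nu>)" "b \<in> Mon m n" "gtm (mon_act b (P \<nu>)) ?p \<or> ?p = mon_act b (P \<nu>)" by blast
    have "mon_act b (P \<nu>) \<in> modMon m n s" using b(2) P_modMon[OF \<nu>(1)] by simp
    then have "?p = mon_act b (P \<nu>)" "i \<le> \<nu>"
      using b(3) below[OF b(1) \<nu>(1)] pM gtm_irrefl[of ?p] gtm_trans[of ?p "mon_act b (P \<nu>)" ?p] by auto
    then show False using nc b(1) \<nu> by (metis le_neq_implies_less)
  qed
  have "mcoeff (eval_gen Q (snd ?p)) (fst ?p) = (\<Sum>\<nu><k. if \<nu> = i then mcoeff (Q i * G i (snd ?p)) (fst ?p) else 0)"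
    unfolding eval_gen_def mcoeff_sum by (rule sum.cong[OF refl]) (use other in auto)
  also have "\<dots> = mcoeff (Q i * G i (snd (P i))) (a + fst (P i))" using i by simp
  also have "\<dots> = mcoeff (Q i) a * mcoeff (G i (snd (P i))) (fst (P i))"
  proof (rule mcoeff_scale_lead[OF free_mod_nth[OF Q] _ a G_free[OF i] _ P_modMon[OF i]])
    show "gtm (P i) q \<or> P i = q" if "q \<in> vsupp (G i)" for q using G_lead[OF i] that by (auto simp: is_lead_def)
    show "gt a b \<or> a = b" if b: "b \<in> supp (Q i)" for b
    proof (rule ccontr)
      assume n: "\<not> (gt a b \<or> a = b)"
      then have "gt b a" using gt_cases[OF a QM[OF b]] by blast
      then have "gtm (mon_act b (P i)) ?p" using gt_imp_gtm_act[OF _ QM[OF b] a P_modMon[OF i]] by blast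
      moreover have "gtm ?p (mon_act b (P i))" using below[OF b i] n by auto
      ultimately show False
        using gtm_trans[of ?p "mon_act b (P i)" ?p] gtm_irrefl[OF pM] pM QM[OF b] P_modMon[OF i] by auto
    qed
  qed
  also have "\<dots> \<noteq> 0"
    using a_supp G_lead[OF i] by (simp add: supp_def is_lead_def mem_vsupp')
  finally have "?p \<in> vsupp (eval_gen Q)" by (simp add: mem_vsupp' supp_def)
  then show "is_lead gtm (vsupp (eval_gen Q)) ?p" using low unfolding is_lead_def by metis
qed

section \<open>Syzygies from S-polynomials\<close>

text \<open>
  The monomial \<open>m\<^sub>j\<^sub>i\<close>, with \<open>i\<close> the index of the vector that it multiplies.
\<close>

definition quot :: "nat \<Rightarrow> nat \<Rightarrow> mon" where
  "quot i j = mlcm (fst (P i)) (fst (P j)) - fst (P i)"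

text \<open>
  The multiplier of \<open>g\<^sub>i\<close> in \<open>spoly(g\<^sub>i, g\<^sub>j)\<close>, which is \<open>0\<close> if the least common multiple is \<open>0\<close>.
\<close>

definition cofactor :: "nat \<Rightarrow> nat \<Rightarrow> 'k rx" where
  "cofactor i j = (if snd (P i) = snd (P j) then mterm (1 / mcoeff (G i (snd (P i))) (fst (P i))) (quot i j) else 0)"

lemma quot_Mon:
  assumes "i < k" "j < k" shows "quot i j \<in> Mon m n"
proof -
  have "fst (P i) \<in> Mon m n" "fst (P j) \<in> Mon m n" using P_modMon[OF assms(1)] P_modMon[OF assms(2)] by (auto simp: modMon_def mem_Times_iff)
  then have "quot i j + fst (P i) \<in> Mon m n" unfolding quot_def mlcm_diff_add by (rule mlcm_Mon)
  then show ?thesis by simp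
qed

lemma cofactor_RX: "i < k \<Longrightarrow> j < k \<Longrightarrow> cofactor i j \<in> RX m n"
  by (simp add: cofactor_def RX_mterm quot_Mon)

lemma lc_G_nonzero: "i < k \<Longrightarrow> mcoeff (G i (snd (P i))) (fst (P i)) \<noteq> 0"
  using G_lead[of i] by (simp add: is_lead_def mem_vsupp' supp_def)

lemma quot_act_P:
  assumes "snd (P i) = snd (P j)"
  shows "mon_act (quot i j) (P i) = mon_act (quot j i) (P j)"
  using assms mlcm_diff_add[of "fst (P i)" "fst (P j)"] mlcm_diff_add[of "fst (P j)" "fst (P i)"]
  by (simp add: quot_def prod_eq_iff mon_act_def mlcm_commute)

lemma lcm_over_lt_eq:
  assumes "i < k" "j < k"
  shows "lcm_over_lt m n gt gtm (g i) (g j) = to_loc (cofactor i j)"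
proof -
  let ?c = "mcoeff (G i (snd (P i))) (fst (P i))"
  have lc: "lc m n gt gtm (g i) = ?c"
    using lm_lc_Fract(2)[OF G_free[OF assms(1)] G_lead[OF assms(1)] U] by (simp add: g_eq[OF assms(1)])
  have nz: "mterm ?c 0 \<noteq> 0"
  proof
    assume "mterm ?c 0 = 0"
    then have "mcoeff (mterm ?c 0) 0 = 0" by simp
    then show False using lc_G_nonzero[OF assms(1)] by (simp add: mcoeff_mterm)
  qed
  show ?thesis
  proof (cases "snd (P i) = snd (P j)")
    case True
    have "mon_quot (mon_lcm (Some (P i)) (Some (P j))) (Some (P i)) = (mterm 1 (quot i j) :: 'k rx)"
      using True by (cases "P i") (simp add: mon_lcm_Some quot_def)
    also have "\<dots> = cofactor i j * mterm ?c 0"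
      using True lc_G_nonzero[OF assms(1)] by (simp add: cofactor_def mterm_mult)
    finally show ?thesis
      using nz by (simp add: lcm_over_lt_def lm_g assms lc to_loc_simps)
  next
    case False
    then show ?thesis
      by (simp add: lcm_over_lt_def lm_g assms mon_lcm_Some cofactor_def to_loc_simps)
  qed
qed

definition spair :: "nat \<Rightarrow> nat \<Rightarrow> nat \<Rightarrow> 'k rx" where
  "spair i j = (\<lambda>l. cofactor i j * G i l - cofactor j i * G j l)"

lemma spair_free: "i < k \<Longrightarrow> j < k \<Longrightarrow> spair i j \<in> free_mod s (RX m n)"
  unfolding spair_def by (intro free_mod_minus free_mod_scale cofactor_RX G_free)

lemma spoly_eq:
  assumes "i < k" "j < k"
  shows "spoly m n gt gtm (g i) (g j) = (\<lambda>l. Fract (spair i j l) U)"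
  unfolding spoly_def lcm_over_lt_eq[OF assms] lcm_over_lt_eq[OF assms(2,1)]
  by (rule ext) (simp add: assms g_eq spair_def Fract_conv_to_loc to_loc_simps diff_divide_distrib)

lemma cofactor_mult_lead:
  assumes ij: "i < k" "j < k" "snd (P i) = snd (P j)"
  shows "is_lead gtm (vsupp (\<lambda>l. cofactor i j * G i l)) (mon_act (quot i j) (P i))"
    and "mcoeff (cofactor i j * G i (snd (P i))) (quot i j + fst (P i)) = 1"
proof -
  let ?c = "mcoeff (G i (snd (P i))) (fst (P i))"
  have l: "is_lead gt (supp (cofactor i j)) (quot i j)"
    using ij(3) lc_G_nonzero[OF ij(1)] by (auto simp: is_lead_def supp_def cofactor_def mcoeff_mterm)
  show "is_lead gtm (vsupp (\<lambda>l. cofactor i j * G i l)) (mon_act (quot i j) (P i))"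
    by (rule lead_scale(1)[OF cofactor_RX[OF ij(1,2)] l G_free[OF ij(1)] G_lead[OF ij(1)]])
  show "mcoeff (cofactor i j * G i (snd (P i))) (quot i j + fst (P i)) = 1"
    using lc_G_nonzero[OF ij(1)] ij(3) by (simp add: cofactor_def)
qed

lemma spair_below_lcm:
  assumes ij: "i < k" "j < k" "snd (P i) = snd (P j)" and p: "p \<in> vsupp (spair i j)"
  shows "gtm (mon_act (quot i j) (P i)) p"
proof -
  let ?L = "mon_act (quot i j) (P i)"
  have L: "?L = mon_act (quot j i) (P j)" using quot_act_P[OF ij(3)] .
  have "p \<in> vsupp (\<lambda>l. cofactor i j * G i l) \<union> vsupp (\<lambda>l. cofactor j i * G j l)"
    using p vsupp_minus[of "\<lambda>l. cofactor i j * G i l" "\<lambda>l. cofactor j i * G j l"] unfolding spair_def by blast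
  then have "p = ?L \<or> gtm ?L p"
    using cofactor_mult_lead(1)[OF ij] cofactor_mult_lead(1)[OF ij(2,1) ij(3)[symmetric]]
    unfolding L[symmetric] is_lead_def by blast
  moreover have "mcoeff (spair i j (snd ?L)) (fst ?L) = 0"
    using cofactor_mult_lead(2)[OF ij] cofactor_mult_lead(2)[OF ij(2,1) ij(3)[symmetric]]
      arg_cong[OF L, of fst] ij(3) by (simp add: spair_def)
  then have "?L \<notin> vsupp (spair i j)" by (simp add: mem_vsupp' supp_def)
  ultimately show ?thesis using p by blast
qed

text \<open>
  A numerator of \<open>s\<^sub>i\<^sub>j\<close>, if the quotients of the division have numerators \<open>Q\<close> and denominator \<open>W\<close>.
\<close>

definition pair_syz :: "'k rx \<Rightarrow> (nat \<Rightarrow> 'k rx) \<Rightarrow> nat \<Rightarrow> nat \<Rightarrow> (nat \<Rightarrow> 'k rx)" where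
  "pair_syz W Q i j = (\<lambda>l. W * (cofactor i j * unit_vec i l - cofactor j i * unit_vec j l) - Q l)"

lemma pair_syz_free:
  assumes "i < k" "j < k" "W \<in> RX m n" "Q \<in> free_mod k (RX m n)"
  shows "pair_syz W Q i j \<in> free_mod k (RX m n)"
proof -
  have u: "(unit_vec i :: nat \<Rightarrow> 'k rx) \<in> free_mod k (RX m n)" if "i < k" for i
    using that by (auto simp: unit_vec_def free_mod_def)
  show ?thesis
    unfolding pair_syz_def by (intro free_mod_minus free_mod_scale u cofactor_RX assms)
qed

text \<open>
  At \<open>\<epsilon>\<^sub>i\<close> and \<open>\<epsilon>\<^sub>j\<close> the first two terms have the monomials \<open>m\<^sub>j\<^sub>i\<close> and \<open>m\<^sub>i\<^sub>j\<close>, both corresponding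
  to the least common multiple of \<open>lm(g\<^sub>i)\<close> and \<open>lm(g\<^sub>j)\<close>; the former wins because \<open>i < j\<close>. The terms
  from \<open>Q\<close> correspond to monomials of products \<open>q\<^sub>\<nu> g\<^sub>\<nu>\<close>, which are strictly smaller, since the
  leading terms cancel in the S-polynomial.
\<close>

lemma pair_syz_lead:
  assumes ij: "i < j" "j < k" "snd (P i) = snd (P j)" and W: "W \<in> S_gt m n gt" and Q: "Q \<in> free_mod k (RX m n)"
    and bound: "\<And>\<nu> b. \<nu> < k \<Longrightarrow> b \<in> supp (Q \<nu>) \<Longrightarrow> gtm (mon_act (quot i j) (P i)) (mon_act b (P \<nu>))"
  shows "is_lead gtS (vsupp (pair_syz W Q i j)) (quot i j, i)"
proof -
  have i: "i < k" using ij by simp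
  let ?L = "mon_act (quot i j) (P i)"
  have L: "?L = mon_act (quot j i) (P j)" using quot_act_P[OF ij(3)] .
  have LM: "?L \<in> modMon m n s" using quot_Mon[OF i ij(2)] P_modMon[OF i] by simp
  have W': "W \<in> RX m n" "mcoeff W 0 = 1" "is_lead gt (supp W) 0" using W by (auto simp: S_gt_iff)
  have "quot i j \<notin> supp (Q i)" using bound[OF i] gtm_irrefl[OF LM] by blast
  moreover have "mcoeff (W * cofactor i j) (quot i j) = 1 / mcoeff (G i (snd (P i))) (fst (P i))"
    using ij(3) mcoeff_mterm_mult[of _ "quot i j" W 0] W'(2) by (simp add: cofactor_def mult.commute[of W])
  ultimately have "mcoeff (pair_syz W Q i j i) (quot i j) \<noteq> 0"
    using ij lc_G_nonzero[OF i] by (simp add: pair_syz_def unit_vec_def supp_def)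
  then have mem: "(quot i j, i) \<in> vsupp (pair_syz W Q i j)" by (simp add: mem_vsupp supp_def)
  moreover have "gtS (quot i j, i) q" if q: "q \<in> vsupp (pair_syz W Q i j)" "q \<noteq> (quot i j, i)" for q
  proof -
    obtain b \<nu> where e: "q = (b, \<nu>)" by (cases q)
    have "(b, \<nu>) \<in> modMon m n k"
      using vsupp_free_mod[OF pair_syz_free[OF i ij(2) W'(1) Q]] q(1) e by blast
    then have \<nu>: "\<nu> < k" and b: "b \<in> Mon m n" by (auto simp: modMon_def)
    have W_bound: "gtm ?L (mon_act b (P \<nu>)) \<or> b = quot \<nu> \<nu>'"
      if b': "b \<in> supp (W * cofactor \<nu> \<nu>')" and eq: "mon_act (quot \<nu> \<nu>') (P \<nu>) = ?L" for \<nu>'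
    proof -
      obtain c d where c: "c \<in> supp W" "d \<in> supp (cofactor \<nu> \<nu>')" "b = c + d" using supp_mult[OF b'] by blast
      have d: "d = quot \<nu> \<nu>'" using c(2) by (auto simp: cofactor_def supp_def mcoeff_mterm split: if_splits)
      have cM: "c \<in> Mon m n" using c(1) W'(1) by (auto simp: RX_def)
      have "c = 0 \<or> gt 0 c" using c(1) W'(3) by (auto simp: is_lead_def)
      then show ?thesis
      proof
        assume "gt 0 c"
        then have "gtm (mon_act 0 ?L) (mon_act c ?L)" using gt_imp_gtm_act[of 0 c ?L] cM LM by simp
        then show ?thesis unfolding c(3) d mon_act_add eq by simp
      qed (use c d in simp)
    qed
    have "b \<in> supp (Q \<nu>) \<or> \<nu> = i \<and> b \<in> supp (W * cofactor i j) \<or> \<nu> = j \<and> b \<in> supp (W * cofactor j i)"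
      using q(1) ij(1) unfolding e by (auto simp: mem_vsupp supp_def pair_syz_def unit_vec_def split: if_splits)
    then have "gtm ?L (mon_act b (P \<nu>)) \<or> \<nu> = j \<and> b = quot j i"
    proof (elim disjE conjE)
      assume "b \<in> supp (Q \<nu>)"
      then show ?thesis using bound[OF \<nu>] by blast
    next
      assume "\<nu> = i" "b \<in> supp (W * cofactor i j)"
      then show ?thesis using W_bound[of j] q(2) e by blast
    next
      assume "\<nu> = j" "b \<in> supp (W * cofactor j i)"
      then show ?thesis using W_bound[of i] L by metis
    qed
    then show ?thesis
      unfolding e using gtS_iff[OF i \<nu>] L ij(1) by auto
  qed
  ultimately show ?thesis by (auto simp: is_lead_def)
qed

lemma unit_vec_sum:
  assumes "i < k"
  shows "(\<Sum>\<nu><k. x * unit_vec i \<nu> * y \<nu>) = x * (y i :: 'r::comm_ring_1)"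
proof -
  have "(\<Sum>\<nu><k. x * unit_vec i \<nu> * y \<nu>) = (\<Sum>\<nu><k. if \<nu> = i then x * y i else 0)"
    by (rule sum.cong) (auto simp: unit_vec_def)
  then show ?thesis using assms by simp
qed

lemma eval_pair_syz:
  assumes "i < k" "j < k"
  shows "eval_gen (pair_syz W Q i j) = (\<lambda>l. W * spair i j l - eval_gen Q l)"
proof
  fix l
  have "eval_gen (pair_syz W Q i j) l = (\<Sum>\<nu><k. (W * cofactor i j) * unit_vec i \<nu> * G \<nu> l
      - (W * cofactor j i) * unit_vec j \<nu> * G \<nu> l - Q \<nu> * G \<nu> l)"
    unfolding eval_gen_def by (rule sum.cong) (simp_all add: pair_syz_def algebra_simps)
  then show "eval_gen (pair_syz W Q i j) l = W * spair i j l - eval_gen Q l"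
    by (simp only: sum_subtractf unit_vec_sum[OF assms(1)] unit_vec_sum[OF assms(2)] eval_gen_def[of Q])
      (simp add: spair_def algebra_simps)
qed

text \<open>
  The bound on \<open>lm(q\<^sub>\<nu> g\<^sub>\<nu>)\<close> becomes one for every monomial of the numerator of \<open>q\<^sub>\<nu>\<close>, and a
  standard representation becomes an equation over \<open>R[x]\<close>. The factor \<open>W\<close> covers the weak
  representations; for an ordinary division \<open>W = 1\<close>.
\<close>

lemma division_numerators:
  assumes ij: "i < k" "j < k" and W: "W \<in> S_gt m n gt"
    and div: "division_with_remainder m n s gt gtm k g (\<lambda>l. to_loc W * spoly m n gt gtm (g i) (g j) l) q r"
  shows "\<exists>V\<in>S_gt m n gt. \<exists>Q\<in>free_mod k (RX m n). (\<forall>\<nu><k. q \<nu> = Fract (Q \<nu>) V) \<and>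
    (\<forall>\<nu><k. \<forall>b\<in>supp (Q \<nu>). \<exists>p\<in>vsupp (spair i j). p = mon_act b (P \<nu>) \<or> gtm p (mon_act b (P \<nu>))) \<and>
    (r = (\<lambda>_. 0) \<longrightarrow> (\<lambda>l. V * W * spair i j l) = eval_gen Q)"
proof -
  have d: "\<And>\<nu>. \<nu> < k \<Longrightarrow> q \<nu> \<in> RXloc m n gt"
      "(\<lambda>l. to_loc W * spoly m n gt gtm (g i) (g j) l) = (\<lambda>l. (\<Sum>\<nu><k. q \<nu> * g \<nu> l) + r l)"
      "\<And>\<nu>. \<nu> < k \<Longrightarrow> ge0 gtm (lm m n gt gtm (\<lambda>l. to_loc W * spoly m n gt gtm (g i) (g j) l)) (lm m n gt gtm (\<lambda>l. q \<nu> * g \<nu> l))"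
    using div unfolding division_with_remainder_def by blast+
  obtain V Q0 where V: "V \<in> S_gt m n gt" "\<And>\<nu>. \<nu> < k \<Longrightarrow> Q0 \<nu> \<in> RX m n \<and> q \<nu> = Fract (Q0 \<nu>) V"
    using common_denominator[of "{..<k}" q] d(1) by auto
  define Q where "Q \<nu> = (if \<nu> < k then Q0 \<nu> else 0)" for \<nu>
  have Q: "Q \<in> free_mod k (RX m n)" "\<And>\<nu>. \<nu> < k \<Longrightarrow> q \<nu> = Fract (Q \<nu>) V"
    using V(2) by (auto simp: Q_def free_mod_def)
  have nz: "to_loc U \<noteq> 0" "to_loc V \<noteq> 0" using S_gt_nonzero U V(1) by auto
  have W': "W \<in> RX m n" "mcoeff W 0 = 1" "is_lead gt (supp W) 0" using W by (auto simp: S_gt_iff)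
  have lhs: "(\<lambda>l. to_loc W * spoly m n gt gtm (g i) (g j) l) = (\<lambda>l. Fract (W * spair i j l) U)"
    by (simp add: spoly_eq[OF ij] Fract_conv_to_loc to_loc_simps)
  have rhs: "(\<lambda>l. q \<nu> * g \<nu> l) = (\<lambda>l. Fract (Q \<nu> * G \<nu> l) (V * U))" if "\<nu> < k" for \<nu>
    using Q(2)[OF that] g_eq[OF that] by (simp add: Fract_conv_to_loc to_loc_simps)
  have bound: "\<exists>p\<in>vsupp (spair i j). p = mon_act b (P \<nu>) \<or> gtm p (mon_act b (P \<nu>))"
    if \<nu>: "\<nu> < k" and b: "b \<in> supp (Q \<nu>)" for \<nu> b
  proof -
    have Q\<nu>: "Q \<nu> \<in> RX m n" using free_mod_nth[OF Q(1)] .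
    have "Q \<nu> \<noteq> 0" using b by auto
    then obtain c where c: "is_lead gt (supp (Q \<nu>)) c" using ring_ex_lead[OF Q\<nu>] by blast
    have cM: "c \<in> Mon m n" and bM: "b \<in> Mon m n" using c b Q\<nu> by (auto simp: is_lead_def RX_def)
    have "lm m n gt gtm (\<lambda>l. q \<nu> * g \<nu> l) = Some (mon_act c (P \<nu>))"
      unfolding rhs[OF \<nu>]
      by (rule lm_lc_Fract(1)[OF free_mod_scale[OF Q\<nu> G_free[OF \<nu>]] lead_scale(1)[OF Q\<nu> c G_free[OF \<nu>] G_lead[OF \<nu>]]
            S_gt_mult[OF V(1) U]])
    then have ge: "ge0 gtm (lm m n gt gtm (\<lambda>l. Fract (W * spair i j l) U)) (Some (mon_act c (P \<nu>)))"
      using d(3)[OF \<nu>] unfolding lhs by simp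
    have "spair i j \<noteq> (\<lambda>_. 0)"
    proof
      assume "spair i j = (\<lambda>_. 0)"
      then have "(\<lambda>l. Fract (W * spair i j l) U) = (\<lambda>_. 0)" by (simp add: Fract_conv_to_loc to_loc_simps)
      then show False using ge by (simp add: ge0_def lm_zero)
    qed
    then obtain p where p: "is_lead gtm (vsupp (spair i j)) p" using vector_ex_lead[OF spair_free[OF ij]] by blast
    have "is_lead gtm (vsupp (\<lambda>l. W * spair i j l)) p"
      using lead_scale(1)[OF W'(1,3) spair_free[OF ij] p] by simp
    from lm_lc_Fract(1)[OF free_mod_scale[OF W'(1) spair_free[OF ij]] this U] ge
    have pc: "p = mon_act c (P \<nu>) \<or> gtm p (mon_act c (P \<nu>))" by (simp add: ge0_def)
    have "c = b \<or> gt c b" using c b by (auto simp: is_lead_def)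
    then have "mon_act c (P \<nu>) = mon_act b (P \<nu>) \<or> gtm (mon_act c (P \<nu>)) (mon_act b (P \<nu>))"
      using gt_imp_gtm_act[OF _ cM bM P_modMon[OF \<nu>]] by blast
    then have "p = mon_act b (P \<nu>) \<or> gtm p (mon_act b (P \<nu>))"
      using pc gtm_trans[of p "mon_act c (P \<nu>)" "mon_act b (P \<nu>)"] lead_in_modMon[OF spair_free[OF ij] p]
        P_modMon[OF \<nu>] cM bM by auto
    moreover have "p \<in> vsupp (spair i j)" using p by (simp add: is_lead_def)
    ultimately show ?thesis by blast
  qed
  have eval: "(\<lambda>l. V * W * spair i j l) = eval_gen Q" if r: "r = (\<lambda>_. 0)"
  proof
    fix l
    have "Fract (W * spair i j l) U = (\<Sum>\<nu><k. q \<nu> * g \<nu> l)"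
      using fun_cong[OF d(2), of l] fun_cong[OF lhs, of l] r by simp
    also have "\<dots> = (\<Sum>\<nu><k. Fract (Q \<nu> * G \<nu> l) (V * U))"
      by (rule sum.cong) (use rhs in \<open>auto dest: fun_cong\<close>)
    also have "\<dots> = to_loc (eval_gen Q l) / to_loc (V * U)"
      by (simp add: Fract_conv_to_loc eval_gen_def to_loc_sum sum_divide_distrib)
    finally have "to_loc (V * W * spair i j l) = to_loc (eval_gen Q l)"
      using nz by (simp add: Fract_conv_to_loc to_loc_simps field_simps)
    then show "V * W * spair i j l = eval_gen Q l" by simp
  qed
  show ?thesis using V(1) Q bound eval by blast
qed

lemma pair_bound:
  assumes ij: "i < k" "j < k" "snd (P i) = snd (P j)" and Q: "Q \<in> free_mod k (RX m n)"
    and bound: "\<forall>\<nu><k. \<forall>b\<in>supp (Q \<nu>). \<exists>p\<in>vsupp (spair i j). p = mon_act b (P \<nu>) \<or> gtm p (mon_act b (P \<nu>))"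
    and \<nu>: "\<nu> < k" "b \<in> supp (Q \<nu>)"
  shows "gtm (mon_act (quot i j) (P i)) (mon_act b (P \<nu>))"
proof -
  obtain p where p: "p \<in> vsupp (spair i j)" "p = mon_act b (P \<nu>) \<or> gtm p (mon_act b (P \<nu>))"
    using bound \<nu> by blast
  have "b \<in> Mon m n" using free_mod_nth[OF Q, of \<nu>] \<nu>(2) by (auto simp: RX_def)
  moreover have "p \<in> modMon m n s" using vsupp_free_mod[OF spair_free[OF ij(1,2)]] p(1) by blast
  ultimately show ?thesis
    using spair_below_lcm[OF ij p(1)] p(2) gtm_trans[of "mon_act (quot i j) (P i)" p "mon_act b (P \<nu>)"]
      quot_Mon[OF ij(1,2)] P_modMon[OF ij(1)] P_modMon[OF \<nu>(1)] by auto
qed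

lemma eval_gen_minus: "eval_gen (\<lambda>l. v l - w l) = (\<lambda>l. eval_gen v l - eval_gen w l)"
  by (simp add: eval_gen_def algebra_simps sum_subtractf)

lemma eval_gen_scale: "eval_gen (\<lambda>l. u * v l) = (\<lambda>l. u * eval_gen v l)"
  by (simp add: eval_gen_def algebra_simps sum_distrib_left)

section \<open>The standard bases\<close>

lemma cancellation_dvd:
  assumes Q: "Q \<in> free_mod k (RX m n)" "is_lead gtS (vsupp Q) (a, i)"
    and nl: "\<not> is_lead gtm (vsupp (eval_gen Q)) (mon_act a (P i))"
  obtains j e where "i < j" "j < k" "snd (P i) = snd (P j)" "e \<in> Mon m n" "a = e + quot i j"
proof -
  obtain j b where j: "i < j" "j < k" "mon_act b (P j) = mon_act a (P i)"
    using cancellation_dichotomy[OF Q] nl by blast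
  have "snd (P i) = snd (P j)" using arg_cong[OF j(3), of snd] by simp
  moreover obtain e where e: "a = e + quot i j" using mlcm_quotient_dvd[OF j(3)] unfolding quot_def .
  moreover have "e \<in> Mon m n" using S.lead_in_modMon[OF Q] e by (simp add: modMon_def)
  ultimately show thesis using that j by blast
qed

text \<open>
  Write \<open>f\<close> as the image of a vector \<open>Q\<close> and replace \<open>Q\<close> by its weak normal form \<open>R\<close> modulo the
  syzygies, which changes \<open>f\<close> by a factor in \<open>S\<^sub>>\<close> only. If the largest monomial cancelled in the image
  of \<open>R\<close>, then \<open>lm(R)\<close> would be a multiple of the leading monomial of one of the syzygies from
  S-polynomials.
\<close>

lemma generators_leading:
  assumes weak: "\<And>i j. i < j \<Longrightarrow> j < k \<Longrightarrow> has_weak_standard_rep m n s gt gtm k g (spoly m n gt gtm (g i) (g j))"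
    and f: "f \<in> mod_span (RXloc m n gt) (g ` {..<k})" "f \<noteq> (\<lambda>_. 0)"
  shows "\<exists>i<k. \<exists>a\<in>Mon m n. lm m n gt gtm f = Some (mon_act a (P i))"
proof -
  have pair: "\<exists>v\<in>Syz. is_lead gtS (vsupp v) (quot i j, i)" if ij: "i < j" "j < k" "snd (P i) = snd (P j)" for i j
  proof -
    have i: "i < k" using ij by simp
    obtain W q where W: "W \<in> S_gt m n gt"
      "division_with_remainder m n s gt gtm k g (\<lambda>l. to_loc W * spoly m n gt gtm (g i) (g j) l) q (\<lambda>_. 0)"
      using weak[OF ij(1,2)] unfolding has_weak_standard_rep_def has_standard_rep_def by blast
    obtain V Q where V: "V \<in> S_gt m n gt" and Q: "Q \<in> free_mod k (RX m n)" and
      bd: "\<forall>\<nu><k. \<forall>b\<in>supp (Q \<nu>). \<exists>p\<in>vsupp (spair i j). p = mon_act b (P \<nu>) \<or> gtm p (mon_act b (P \<nu>))" and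
      ev: "(\<lambda>l. V * W * spair i j l) = eval_gen Q"
      using division_numerators[OF i ij(2) W] by blast
    have VW: "V * W \<in> S_gt m n gt" using S_gt_mult[OF V W(1)] .
    have "pair_syz (V * W) Q i j \<in> Syz"
      using pair_syz_free[OF i ij(2) S_gt_in_RX[OF VW] Q] fun_cong[OF ev]
      by (simp add: Syz_def eval_pair_syz[OF i ij(2)])
    moreover have "is_lead gtS (vsupp (pair_syz (V * W) Q i j)) (quot i j, i)"
      by (rule pair_syz_lead[OF ij VW Q pair_bound[OF i ij(2,3) Q bd]])
    ultimately show ?thesis by blast
  qed
  obtain q where q: "f = (\<lambda>l. \<Sum>\<nu><k. q \<nu> * g \<nu> l)" "\<And>\<nu>. \<nu> < k \<Longrightarrow> q \<nu> \<in> RXloc m n gt"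
    using f(1) unfolding mod_span_family[OF closed_RXloc finite_lessThan] by blast
  obtain V Q0 where V: "V \<in> S_gt m n gt" "\<And>\<nu>. \<nu> < k \<Longrightarrow> Q0 \<nu> \<in> RX m n \<and> q \<nu> = Fract (Q0 \<nu>) V"
    using common_denominator[of "{..<k}" q] q(2) by auto
  define Q where "Q \<nu> = (if \<nu> < k then Q0 \<nu> else 0)" for \<nu>
  have Q: "Q \<in> free_mod k (RX m n)" "\<And>\<nu>. \<nu> < k \<Longrightarrow> q \<nu> = Fract (Q \<nu>) V"
    using V(2) by (auto simp: Q_def free_mod_def)
  have f_eq: "f l = to_loc (eval_gen Q l) / (to_loc V * to_loc U)" for l
    unfolding q(1) eval_gen_def
    by (simp add: Q(2) g_eq Fract_conv_to_loc to_loc_simps to_loc_sum sum_divide_distrib)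
  have Syz0: "(\<lambda>_. 0) \<in> Syz" by (simp add: Syz_def eval_gen_def)
  have "\<exists>u\<in>S_gt m n gt. \<exists>R\<in>free_mod k (RX m n). (\<lambda>l. u * Q l - R l) \<in> Syz \<and>
      (R = (\<lambda>_. 0) \<or> (\<exists>p. is_lead gtS (vsupp R) p \<and> (\<forall>v\<in>Syz. \<not> is_lead gtS (vsupp v) p)))"
  proof (rule S.weak_normal_form[OF Syz0 _ _ _ Q(1)])
    show "(\<lambda>l. v l - w l) \<in> Syz" if "v \<in> Syz" "w \<in> Syz" for v w
      using that by (auto simp: Syz_def eval_gen_minus intro: free_mod_minus)
    show "(\<lambda>l. u * v l) \<in> Syz" if "u \<in> RX m n" "v \<in> Syz" for u v
      using that by (auto simp: Syz_def eval_gen_scale intro: free_mod_scale)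
    show "Syz \<subseteq> free_mod k (RX m n)" by (auto simp: Syz_def)
  qed
  then obtain u R where u: "u \<in> S_gt m n gt" and R: "R \<in> free_mod k (RX m n)" and uR: "(\<lambda>l. u * Q l - R l) \<in> Syz"
    and alt: "R = (\<lambda>_. 0) \<or> (\<exists>p. is_lead gtS (vsupp R) p \<and> (\<forall>v\<in>Syz. \<not> is_lead gtS (vsupp v) p))" by blast
  have "(\<lambda>l. u * eval_gen Q l - eval_gen R l) = (\<lambda>_. 0)"
    using uR by (simp add: Syz_def eval_gen_minus eval_gen_scale)
  then have ev: "eval_gen R l = u * eval_gen Q l" for l by (metis eq_iff_diff_eq_0)
  have nz: "to_loc u \<noteq> 0" "to_loc V \<noteq> 0" "to_loc U \<noteq> 0" using S_gt_nonzero u V(1) U by auto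
  have f_R: "f = (\<lambda>l. Fract (eval_gen R l) (u * (V * U)))"
    using nz by (simp add: fun_eq_iff f_eq ev Fract_conv_to_loc to_loc_simps)
  have "R \<noteq> (\<lambda>_. 0)"
  proof
    assume "R = (\<lambda>_. 0)"
    then have "f = (\<lambda>_. 0)" unfolding f_R by (simp add: eval_gen_def Fract_conv_to_loc to_loc_simps)
    then show False using f(2) by blast
  qed
  then obtain a i where ai: "is_lead gtS (vsupp R) (a, i)" "\<And>v. v \<in> Syz \<Longrightarrow> \<not> is_lead gtS (vsupp v) (a, i)"
    using alt by auto
  have aiM: "i < k" "a \<in> Mon m n" using S.lead_in_modMon[OF R ai(1)] by (auto simp: modMon_def)
  have "is_lead gtm (vsupp (eval_gen R)) (mon_act a (P i))"
  proof (rule ccontr)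
    assume "\<not> ?thesis"
    from cancellation_dvd[OF R ai(1) this] obtain j e
      where j: "i < j" "j < k" "snd (P i) = snd (P j)" "e \<in> Mon m n" "a = e + quot i j" by blast
    obtain v where v: "v \<in> Syz" "is_lead gtS (vsupp v) (quot i j, i)" using pair[OF j(1-3)] by blast
    have vf: "v \<in> free_mod k (RX m n)" "eval_gen v = (\<lambda>_. 0)" using v(1) by (auto simp: Syz_def)
    have "is_lead gt (supp (mterm 1 e :: 'k rx)) e" by (auto simp: is_lead_def supp_def mcoeff_mterm)
    from S.lead_scale(1)[OF RX_mterm[OF j(4)] this vf(1) v(2)]
    have "is_lead gtS (vsupp (\<lambda>l. mterm 1 e * v l)) (a, i)" using j(5) by simp
    moreover have "(\<lambda>l. mterm 1 e * v l) \<in> Syz"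
      using vf j(4) by (auto simp: Syz_def eval_gen_scale intro!: free_mod_scale RX_mterm)
    ultimately show False using ai(2) by blast
  qed
  then have "lm m n gt gtm f = Some (mon_act a (P i))"
    unfolding f_R by (intro lm_lc_Fract(1) eval_gen_free R S_gt_mult u V(1) U)
  then show ?thesis using aiM by blast
qed

lemma generators_standard_basis:
  assumes weak: "\<And>i j. i < j \<Longrightarrow> j < k \<Longrightarrow> has_weak_standard_rep m n s gt gtm k g (spoly m n gt gtm (g i) (g j))"
  shows "standard_basis m n gt gtm (mod_span (RXloc m n gt) (g ` {..<k})) (g ` {..<k})"
proof (rule standard_basisI)
  have one: "1 \<in> RXloc m n gt" using to_loc_RXloc[of 1] by (simp add: to_loc_simps)
  show "g ` {..<k} \<subseteq> mod_span (RXloc m n gt) (g ` {..<k})"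
  proof
    fix x assume x: "x \<in> g ` {..<k}"
    have "x = (\<lambda>l. \<Sum>y\<in>{x}. 1 * y l)" by simp
    then show "x \<in> mod_span (RXloc m n gt) (g ` {..<k})"
      unfolding mod_span_def using x one by (intro CollectI exI[of _ "{x}"] exI[of _ "\<lambda>_. 1"]) simp
  qed
  fix f assume "f \<in> mod_span (RXloc m n gt) (g ` {..<k})" "f \<noteq> (\<lambda>_. 0)"
  from generators_leading[OF weak this] obtain i a
    where "i < k" "a \<in> Mon m n" "lm m n gt gtm f = Some (mon_act a (P i))" by blast
  then show "\<exists>g\<in>g ` {..<k}. \<exists>p. \<exists>b\<in>Mon m n. lm m n gt gtm g = Some p \<and> lm m n gt gtm f = Some (mon_act b p)"
    using lm_g by (intro bexI[of _ "g i"] exI[of _ "P i"] bexI[of _ a]) auto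
qed simp

lemma lcm_over_lt_RXloc: "i < k \<Longrightarrow> j < k \<Longrightarrow> lcm_over_lt m n gt gtm (g i) (g j) \<in> RXloc m n gt"
  by (simp add: lcm_over_lt_eq to_loc_RXloc cofactor_RX)

text \<open>
  The remainder lies in the submodule generated by the \<open>g\<^sub>\<nu>\<close>, so that its leading monomial, if any,
  is divisible by some \<open>lm(g\<^sub>\<nu>)\<close>.
\<close>

lemma remainder_zero:
  assumes weak: "\<And>i j. i < j \<Longrightarrow> j < k \<Longrightarrow> has_weak_standard_rep m n s gt gtm k g (spoly m n gt gtm (g i) (g j))"
    and ij: "i < j" "j < k"
    and div: "division_with_remainder m n s gt gtm k g (spoly m n gt gtm (g i) (g j)) q r"
  shows "r = (\<lambda>_. 0)"
proof (rule ccontr)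
  assume nz: "r \<noteq> (\<lambda>_. 0)"
  have i: "i < k" using ij by simp
  have d: "\<And>\<nu>. \<nu> < k \<Longrightarrow> q \<nu> \<in> RXloc m n gt"
      "spoly m n gt gtm (g i) (g j) = (\<lambda>l. (\<Sum>\<nu><k. q \<nu> * g \<nu> l) + r l)"
      "\<And>\<nu>. \<nu> < k \<Longrightarrow> \<not> mon_dvd (lm m n gt gtm (g \<nu>)) (lm m n gt gtm r)"
    using div nz unfolding division_with_remainder_def by blast+
  define c where "c \<nu> = lcm_over_lt m n gt gtm (g i) (g j) * unit_vec i \<nu>
      - lcm_over_lt m n gt gtm (g j) (g i) * unit_vec j \<nu> - q \<nu>" for \<nu>
  have "r = (\<lambda>l. \<Sum>\<nu><k. c \<nu> * g \<nu> l)"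
  proof
    fix l
    have "(\<Sum>\<nu><k. c \<nu> * g \<nu> l) = spoly m n gt gtm (g i) (g j) l - (\<Sum>\<nu><k. q \<nu> * g \<nu> l)"
      by (simp add: c_def left_diff_distrib sum_subtractf unit_vec_sum[OF i] unit_vec_sum[OF ij(2)] spoly_def)
    then show "r l = (\<Sum>\<nu><k. c \<nu> * g \<nu> l)" using fun_cong[OF d(2), of l] by simp
  qed
  moreover have "c \<nu> \<in> RXloc m n gt" if "\<nu> < k" for \<nu>
  proof -
    have "(1 :: 'k rx fract) \<in> RXloc m n gt" using to_loc_RXloc[of "1 :: 'k rx"] by (simp add: to_loc_simps)
    then have "(unit_vec i \<nu> :: 'k rx fract) \<in> RXloc m n gt" for i by (simp add: unit_vec_def)
    then show ?thesis unfolding c_def by (intro RXloc_add_mult_minus lcm_over_lt_RXloc i ij d(1) that)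
  qed
  ultimately have "r \<in> mod_span (RXloc m n gt) (g ` {..<k})"
    unfolding mod_span_family[OF closed_RXloc finite_lessThan] by blast
  from generators_leading[OF weak this nz] obtain \<nu> a
    where "\<nu> < k" "lm m n gt gtm r = Some (mon_act a (P \<nu>))" by blast
  then show False using d(3)[of \<nu>] lm_g[of \<nu>] by (auto simp: mon_dvd_def)
qed

text \<open>
  In the image of a syzygy the largest monomial must cancel. So \<open>cancellation_dvd\<close> provides the
  \<open>s\<^sub>i\<^sub>j\<close> whose leading monomial \<open>m\<^sub>j\<^sub>i \<epsilon>\<^sub>i\<close> divides the given one.
\<close>

lemma schreyer_syzygies_standard_basis:
  assumes weak: "\<And>i j. i < j \<Longrightarrow> j < k \<Longrightarrow> has_weak_standard_rep m n s gt gtm k g (spoly m n gt gtm (g i) (g j))"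
    and div: "\<And>i j. i < j \<Longrightarrow> j < k \<Longrightarrow>
      division_with_remainder m n s gt gtm k g (spoly m n gt gtm (g i) (g j)) (q i j) (r i j)"
  shows "standard_basis m n gt gtS (syz m n gt k g) {schreyer_syz m n gt gtm k g q i j | i j. i < j \<and> j < k}"
proof (rule S.standard_basisI)
  let ?H = "{schreyer_syz m n gt gtm k g q i j | i j. i < j \<and> j < k}"
  have "?H \<subseteq> (\<lambda>(i, j). schreyer_syz m n gt gtm k g q i j) ` ({..<k} \<times> {..<k})" by auto
  then show "finite ?H" by (rule finite_subset) simp
  have num: "\<exists>V\<in>S_gt m n gt. \<exists>Q\<in>free_mod k (RX m n).
      schreyer_syz m n gt gtm k g q i j = (\<lambda>l. Fract (pair_syz V Q i j l) V) \<and>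
      eval_gen (pair_syz V Q i j) = (\<lambda>_. 0) \<and>
      (snd (P i) = snd (P j) \<longrightarrow> is_lead gtS (vsupp (pair_syz V Q i j)) (quot i j, i))"
    if ij: "i < j" "j < k" for i j
  proof -
    have i: "i < k" using ij by simp
    have r0: "r i j = (\<lambda>_. 0)" using remainder_zero[OF weak ij div[OF ij]] .
    have "division_with_remainder m n s gt gtm k g (\<lambda>l. to_loc 1 * spoly m n gt gtm (g i) (g j) l) (q i j) (r i j)"
      using div[OF ij] by (simp add: to_loc_simps)
    from division_numerators[OF i ij(2) S_gt_one this] r0 obtain V Q where V: "V \<in> S_gt m n gt"
      and Q: "Q \<in> free_mod k (RX m n)" "\<And>\<nu>. \<nu> < k \<Longrightarrow> q i j \<nu> = Fract (Q \<nu>) V"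
      and bd: "\<forall>\<nu><k. \<forall>b\<in>supp (Q \<nu>). \<exists>p\<in>vsupp (spair i j). p = mon_act b (P \<nu>) \<or> gtm p (mon_act b (P \<nu>))"
      and ev: "(\<lambda>l. V * 1 * spair i j l) = eval_gen Q" by blast
    have nz: "to_loc V \<noteq> 0" using S_gt_nonzero[OF V] by simp
    have "schreyer_syz m n gt gtm k g q i j = (\<lambda>l. Fract (pair_syz V Q i j l) V)"
    proof
      fix l
      have "(\<Sum>\<nu><k. q i j \<nu> * unit_vec \<nu> l) = (\<Sum>\<nu><k. if \<nu> = l then q i j l else 0)"
        by (rule sum.cong) (auto simp: unit_vec_def)
      also have "\<dots> = Fract (Q l) V"
        using Q by (auto simp: Fract_conv_to_loc free_mod_def to_loc_simps)
      finally have s: "(\<Sum>\<nu><k. q i j \<nu> * unit_vec \<nu> l) = Fract (Q l) V" .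
      have uv: "(unit_vec a l :: 'k rx fract) = to_loc (unit_vec a l)" for a
        by (simp add: unit_vec_def to_loc_simps)
      show "schreyer_syz m n gt gtm k g q i j l = Fract (pair_syz V Q i j l) V"
        unfolding schreyer_syz_def s unfolding uv lcm_over_lt_eq[OF i ij(2)] lcm_over_lt_eq[OF ij(2) i]
        using nz by (simp add: Fract_conv_to_loc pair_syz_def to_loc_simps diff_divide_distrib)
    qed
    moreover have "eval_gen (pair_syz V Q i j) = (\<lambda>_. 0)"
      using fun_cong[OF ev] by (simp add: eval_pair_syz[OF i ij(2)])
    moreover have "is_lead gtS (vsupp (pair_syz V Q i j)) (quot i j, i)" if "snd (P i) = snd (P j)"
      by (rule pair_syz_lead[OF ij that V Q(1) pair_bound[OF i ij(2) that Q(1) bd]])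
    ultimately show ?thesis using V Q(1) by blast
  qed
  have syz_iff: "eval_gen X = (\<lambda>_. 0) \<longleftrightarrow> (\<forall>l. (\<Sum>\<nu><k. Fract (X \<nu>) V * g \<nu> l) = 0)"
    if V: "V \<in> S_gt m n gt" for X V
  proof -
    have nz: "to_loc V \<noteq> 0" "to_loc U \<noteq> 0" using S_gt_nonzero V U by auto
    have "(\<Sum>\<nu><k. Fract (X \<nu>) V * g \<nu> l) = to_loc (eval_gen X l) / (to_loc V * to_loc U)" for l
      by (simp add: eval_gen_def g_eq Fract_conv_to_loc to_loc_simps to_loc_sum sum_divide_distrib)
    then show ?thesis using nz by (simp add: fun_eq_iff)
  qed
  show "?H \<subseteq> syz m n gt k g"
  proof
    fix h assume "h \<in> ?H"
    then obtain i j where ij: "i < j" "j < k" "h = schreyer_syz m n gt gtm k g q i j" by blast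
    obtain V Q where V: "V \<in> S_gt m n gt" "Q \<in> free_mod k (RX m n)"
      "h = (\<lambda>l. Fract (pair_syz V Q i j l) V)" "eval_gen (pair_syz V Q i j) = (\<lambda>_. 0)"
      using num[OF ij(1,2)] ij(3) by blast
    have "pair_syz V Q i j \<in> free_mod k (RX m n)" using pair_syz_free[of i j V Q] ij V S_gt_in_RX[OF V(1)] by simp
    then have "h \<in> free_mod k (RXloc m n gt)"
      unfolding V(3) using V(1) by (auto simp: free_mod_def intro!: RXloc_I) (simp add: Fract_conv_to_loc to_loc_simps)
    then show "h \<in> syz m n gt k g"
      using V(4) unfolding syz_iff[OF V(1)] syz_def V(3) by blast
  qed
  fix h assume h: "h \<in> syz m n gt k g" "h \<noteq> (\<lambda>_. 0)"
  then have "h \<in> free_mod k (RXloc m n gt)" by (simp add: syz_def)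
  then obtain V X where V: "V \<in> S_gt m n gt" and X: "X \<in> free_mod k (RX m n)" and hX: "h = (\<lambda>l. Fract (X l) V)"
    by (rule free_mod_RXloc_numerator)
  have ev: "eval_gen X = (\<lambda>_. 0)" using h(1) unfolding syz_iff[OF V] syz_def hX by blast
  have "X \<noteq> (\<lambda>_. 0)" using h(2) unfolding hX by (auto simp: Fract_conv_to_loc to_loc_simps)
  then obtain a i where ai: "is_lead gtS (vsupp X) (a, i)" using S.vector_ex_lead[OF X] by auto
  have "\<not> is_lead gtm (vsupp (eval_gen X)) (mon_act a (P i))"
    unfolding ev by (simp add: is_lead_def vsupp_def)
  from cancellation_dvd[OF X ai this] obtain j e
    where j: "i < j" "j < k" "snd (P i) = snd (P j)" "e \<in> Mon m n" "a = e + quot i j" by blast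
  obtain V' Q where V': "V' \<in> S_gt m n gt" "Q \<in> free_mod k (RX m n)"
      "schreyer_syz m n gt gtm k g q i j = (\<lambda>l. Fract (pair_syz V' Q i j l) V')"
      "is_lead gtS (vsupp (pair_syz V' Q i j)) (quot i j, i)"
    using num[OF j(1,2)] j(3) by blast
  have "pair_syz V' Q i j \<in> free_mod k (RX m n)" using pair_syz_free[of i j V' Q] j V' S_gt_in_RX[OF V'(1)] by simp
  then have "lm m n gt gtS (schreyer_syz m n gt gtm k g q i j) = Some (quot i j, i)"
    unfolding V'(3) by (rule S.lm_lc_Fract(1)[OF _ V'(4,1)])
  moreover have "lm m n gt gtS h = Some (mon_act e (quot i j, i))"
    unfolding hX using S.lm_lc_Fract(1)[OF X ai V] j(5) by simp
  ultimately show "\<exists>g\<in>?H. \<exists>p. \<exists>b\<in>Mon m n. lm m n gt gtS g = Some p \<and> lm m n gt gtS h = Some (mon_act b p)"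
    using j by blast
qed

end

theorem theorem5p3:
  fixes m n s k :: nat
    and gt :: "mon \<Rightarrow> mon \<Rightarrow> bool"
    and gtm :: "modmon \<Rightarrow> modmon \<Rightarrow> bool"
    and g :: "nat \<Rightarrow> nat \<Rightarrow> 'k::field rx fract"
    and q :: "nat \<Rightarrow> nat \<Rightarrow> nat \<Rightarrow> 'k rx fract"
    and r :: "nat \<Rightarrow> nat \<Rightarrow> nat \<Rightarrow> 'k rx fract"
  assumes "module_monomial_ordering m n s gt gtm"
    and "t_local m gt"
    and "\<And>i. i < k \<Longrightarrow> g i \<in> free_mod s (RXloc m n gt)"
    and "\<And>i. i < k \<Longrightarrow> g i \<noteq> (\<lambda>_. 0)"
    and "\<And>i j. i < j \<Longrightarrow> j < k \<Longrightarrow>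
           has_weak_standard_rep m n s gt gtm k g (spoly m n gt gtm (g i) (g j))"
    and "\<And>i j. i < j \<Longrightarrow> j < k \<Longrightarrow>
           division_with_remainder m n s gt gtm k g (spoly m n gt gtm (g i) (g j)) (q i j) (r i j)"
  shows "standard_basis m n gt gtm (mod_span (RXloc m n gt) (g ` {..<k})) (g ` {..<k}) \<and>
         standard_basis m n gt (schreyer_ordering m n gt gtm g) (syz m n gt k g)
           {schreyer_syz m n gt gtm k g q i j | i j. i < j \<and> j < k}"
proof -
  interpret modmon_order m n gt s gtm
    using assms(1,2) by unfold_locales (auto simp: module_monomial_ordering_def)
  have "\<exists>U\<in>S_gt m n gt. \<exists>X. \<forall>x\<in>{..<k} \<times> {..<s}. X x \<in> RX m n \<and> g (fst x) (snd x) = Fract (X x) U"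
    using assms(3) by (intro common_denominator) (auto simp: free_mod_def)
  then obtain U X where U: "U \<in> S_gt m n gt"
    and X: "\<And>\<nu> l. \<nu> < k \<Longrightarrow> l < s \<Longrightarrow> X (\<nu>, l) \<in> RX m n \<and> g \<nu> l = Fract (X (\<nu>, l)) U" by force
  define G where "G \<nu> l = (if l < s then X (\<nu>, l) else 0)" for \<nu> l
  have G: "G \<nu> \<in> free_mod s (RX m n)" "g \<nu> = (\<lambda>l. Fract (G \<nu> l) U)" if "\<nu> < k" for \<nu>
  proof -
    show "G \<nu> \<in> free_mod s (RX m n)" using X[OF that] by (simp add: free_mod_def G_def)
    show "g \<nu> = (\<lambda>l. Fract (G \<nu> l) U)"
      using X[OF that] assms(3)[OF that] by (auto simp: fun_eq_iff G_def free_mod_def Fract_conv_to_loc to_loc_simps)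
  qed
  have "\<exists>p. is_lead gtm (vsupp (G \<nu>)) p" if "\<nu> < k" for \<nu>
  proof (rule vector_ex_lead[OF G(1)[OF that]])
    show "G \<nu> \<noteq> (\<lambda>_. 0)"
      using assms(4)[OF that] G(2)[OF that] by (auto simp: Fract_conv_to_loc to_loc_simps)
  qed
  then obtain P where P: "\<And>\<nu>. \<nu> < k \<Longrightarrow> is_lead gtm (vsupp (G \<nu>)) (P \<nu>)" by metis
  interpret generators m n gt s gtm k g G U P
    by unfold_locales (use U G P in auto)
  show ?thesis
    using generators_standard_basis schreyer_syzygies_standard_basis assms(5,6) by blast
qed

end
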